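(* Let $\{r_i\}_{i=1}^\infty$ be the sequence of all rational numbers in lowest terms in the open interval $(0,1)$, ordered first by increasing denominator and, for equal denominators, by increasing numerator: \[ r_1=\tfrac12,\ r_2=\tfrac13,\ r_3=\tfrac23,\ r_4=\tfrac14,\ r_5=\tfrac34,\ \dots \] For a rational $r\in(0,1)$ let $L(r)$ denote the number of digits in its (finite) continued fraction expansion. Let $f:\mathbb{N}\to\mathbb{N}$ and let $x_f$ be the real number whose continued fraction expansion is obtained by concatenating, in order, the finite continued fraction expansions of $r_{f(1)}, r_{f(2)}, r_{f(3)},\dots$. Suppose that \[ N= o\Big( \sum_{n=1}^N L(r_{f(n)}) \Big) \quad\text{and}\quad N\cdot \max_{1\le n \le N} L(r_{f(n)}) = O\Big( \sum_{n=1}^N L(r_{f(n)})\Big) \] as $N\to\infty$, and that for every set $S\subset\mathbb{N}$ with $\#\{n\in S: n\le x\}=O(x/\log x)$, the set $f^{-1}(S)$ has asymptotic density $0$. Then $x_f$ is CF-normal.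
   Context: Every $x\in[0,1)$ has a continued fraction expansion $x=\langle a_1,a_2,\dots\rangle=1/(a_1+1/(a_2+\cdots))$ with $a_i\in\mathbb{N}$; it is infinite and unique for irrational $x$. A rational number has two finite expansions (one ending in a digit $\ge 2$, one ending in $1$); by convention the longer one (ending in the digit $1$) is always used. The Gauss measure is $\mu(A)=\frac{1}{\log 2}\int_A \frac{dx}{1+x}$. For a finite string $s=[d_1,\dots,d_k]$ of positive integers, the cylinder set is $C_s=\{x\in[0,1): a_i(x)=d_i,\ 1\le i\le k\}$. For real $x$, $A_s(N;x)$ is the number of indices $1\le i\le N$ such that the string $s$ occurs in the continued fraction expansion of $x$ starting at digit $a_i$. A number $x\in[0,1)$ is CF-normal if $\lim_{N\to\infty}A_s(N;x)/N=\mu(C_s)$ for every finite string $s$ of positive integers. A set $S\subset\mathbb{N}$ has asymptotic density $\rho$ if $\#\{n\le N:n\in S\}/N\to\rho$. *)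

theory Defs
  imports "HOL-Analysis.Analysis" "HOL-Library.Landau_Symbols"
begin

definition gauss_map :: "real \<Rightarrow> real" where
  "gauss_map x = frac (1 / x)"

text \<open>The i-th continued fraction digit a_i(x), for i \<ge> 1 (index 0 is unused).
  For irrational x in [0,1) this is the (unique, infinite) expansion.\<close>
definition cf_digit :: "real \<Rightarrow> nat \<Rightarrow> nat" where
  "cf_digit x i = nat \<lfloor>1 / ((gauss_map ^^ (i - 1)) x)\<rfloor>"

definition gauss_measure :: "real set \<Rightarrow> real" where
  "gauss_measure A = (1 / ln 2) * (LINT x:A|lborel. 1 / (1 + x))"

definition cylinder :: "nat list \<Rightarrow> real set" where
  "cylinder s = {x. 0 \<le> x \<and> x < 1 \<and> (\<forall>i<length s. cf_digit x (i + 1) = s ! i)}"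

definition occ_count :: "nat list \<Rightarrow> nat \<Rightarrow> real \<Rightarrow> nat" where
  "occ_count s N x = card {i \<in> {1..N}. \<forall>j<length s. cf_digit x (i + j) = s ! j}"

definition cf_normal :: "real \<Rightarrow> bool" where
  "cf_normal x \<longleftrightarrow> 0 \<le> x \<and> x < 1 \<and>
     (\<forall>s. (\<forall>d\<in>set s. d > 0) \<longrightarrow>
        (\<lambda>N. real (occ_count s N x) / real N) \<longlonglongrightarrow> gauss_measure (cylinder s))"

text \<open>Shorter expansion of p/q for 0 < p < q (Euclidean algorithm); ends in a digit \<ge> 2.\<close>
function cf_short :: "nat \<Rightarrow> nat \<Rightarrow> nat list" where
  "cf_short p q = (if p = 0 then [] else (q div p) # cf_short (q mod p) p)"
  by auto
termination by (relation "Wellfounded.measure fst") auto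

declare cf_short.simps[simp del]

text \<open>The longer expansion (ending in the digit 1), used by convention.\<close>
definition cf_rat :: "rat \<Rightarrow> nat list" where
  "cf_rat r = (let (p, q) = quotient_of r; xs = cf_short (nat p) (nat q)
               in butlast xs @ [last xs - 1, 1])"

definition cf_len :: "rat \<Rightarrow> nat" where
  "cf_len r = length (cf_rat r)"

definition rats01 :: "rat set" where
  "rats01 = {r. 0 < r \<and> r < 1}"

definition rat_before :: "rat \<Rightarrow> rat \<Rightarrow> bool" where
  "rat_before y x \<longleftrightarrow> snd (quotient_of y) < snd (quotient_of x) \<or>
     (snd (quotient_of y) = snd (quotient_of x) \<and> fst (quotient_of y) < fst (quotient_of x))"

definition rseq :: "nat \<Rightarrow> rat" where
  "rseq n = (THE x. x \<in> rats01 \<and> card {y \<in> rats01. rat_before y x} = n - 1)"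

definition cum_len :: "(nat \<Rightarrow> nat list) \<Rightarrow> nat \<Rightarrow> nat" where
  "cum_len g n = (\<Sum>k=1..n. length (g k))"

text \<open>i-th digit (i \<ge> 1) of the concatenation g 1 @ g 2 @ g 3 @ ...\<close>
definition concat_digits :: "(nat \<Rightarrow> nat list) \<Rightarrow> nat \<Rightarrow> nat" where
  "concat_digits g i = (let n = (LEAST n. i \<le> cum_len g n) in g n ! (i - cum_len g (n - 1) - 1))"

definition cf_real :: "(nat \<Rightarrow> nat) \<Rightarrow> real" where
  "cf_real a = (THE x. 0 \<le> x \<and> x < 1 \<and> (\<forall>i\<ge>1. cf_digit x i = a i))"

definition x_f :: "(nat \<Rightarrow> nat) \<Rightarrow> real" where
  "x_f f = cf_real (concat_digits (\<lambda>n. cf_rat (rseq (f n))))"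

definition has_density :: "nat set \<Rightarrow> real \<Rightarrow> bool" where
  "has_density A \<rho> \<longleftrightarrow>
     (\<lambda>N. real (card {n \<in> A. 1 \<le> n \<and> n \<le> N}) / real N) \<longlonglongrightarrow> \<rho>"

end

theory Submission
  imports Defs "HOL-Probability.Probability" "HOL-Real_Asymp.Real_Asymp"
begin

text \<open>
  Given the digits \<open>a\<^sub>1, \<dots>, a\<^sub>n\<close> of a Lebesgue random number, the law of the following digits depends only on
  \<open>\<theta> = q\<^bsub>n-1\<^esub> / q\<^sub>n\<close>, and \<open>\<theta>\<close> is a Markov chain with the explicit transitions
  \<open>\<theta> \<mapsto> 1 / (a + \<theta>)\<close> of probability \<open>(1 + \<theta>) / ((a + \<theta>) (a + 1 + \<theta>))\<close>. Its transition operator contracts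
  Lipschitz constants by \<open>7/8\<close> and preserves Gauss measure, so correlations of occurrences of a word \<open>s\<close> decay
  exponentially, the variance of their number among \<open>k\<close> digits is \<open>O(k)\<close>, and the frequency of \<open>s\<close> deviates by
  \<open>\<epsilon>\<close> from its Gauss measure with probability only \<open>O(1/k)\<close>.

  A finite expansion \<open>t\<close> of denominator \<open>q\<close> has probability of order \<open>1/q\<^sup>2\<close>. Extending each \<open>t\<close> with \<open>q \<le> m\<close> by
  the least digit that pushes the denominator beyond \<open>m\<close> gives disjoint cylinders of probability at least
  \<open>1/(8m\<^sup>2)\<close>; as all but \<open>O(m\<^bsup>7/4\<^esup>)\<close> of the \<open>t\<close> have length of order \<open>log m\<close>, only \<open>O(m\<^sup>2 / log m)\<close> of them
  have a bad frequency of \<open>s\<close>. There are at least \<open>m\<^sup>2/16\<close> fractions of denominator at most \<open>m\<close>, so the bad indices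
  of the enumeration form a set \<open>S\<close> as in the hypothesis on \<open>f\<close>, and bad blocks contribute a negligible
  proportion of the digits of the concatenation; so do the boundaries between blocks and the last incomplete block.
\<close>

section \<open>The digit process\<close>

text \<open>Since \<open>f\<close> is constrained only through sets with O(x / log x) elements, the
  exceptional set has to be that thin, and a Chebyshev bound O(1/k) at k of order log m yields
  exactly this saving with nothing to spare. Two losses of a factor log m must therefore be avoided.
  Bad words have many different lengths, and a union bound over all lengths up to O(log m) would
  give only O(1); deviations are instead controlled on boundedly many multiples of some
  \<open>M\<close> of order log m. Likewise the cylinders of words of different lengths are nested,
  so the words of denominator at most m have total probability of order log m; the extension by one
  digit restores disjointness. The state \<theta> describes the past because the conditional law of
  all later digits is then an explicit function of one number; \<theta> = 0 is Lebesgue measure. The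
  probability takes place on words of a fixed length, so discrete distributions suffice.\<close>

definition digit_prob :: "real \<Rightarrow> nat \<Rightarrow> real" where
  "digit_prob \<theta> a = (if a = 0 then 0 else (1 + \<theta>) / ((a + \<theta>) * (a + 1 + \<theta>)))"

lemma digit_prob_nonneg: "\<theta> \<ge> 0 \<Longrightarrow> digit_prob \<theta> a \<ge> 0"
  by (simp add: digit_prob_def)

text \<open>\<open>digit_prob \<theta> a\<close> is (1 + \<theta>) / (a + \<theta>) minus its value
  at a + 1, so the sum telescopes. This difference is the mass of {1 / (a + 1)..1 / a} under the
  density (1 + \<theta>) / (1 + \<theta> x)^2. The digit 0 has no mass; the \<open>Suc N\<close>
  terms cover the digits 1 to N.\<close>

lemma sum_digit_prob:
  assumes "\<theta> \<ge> 0"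
  shows "(\<Sum>a<Suc N. digit_prob \<theta> a) = N / (N + 1 + \<theta>)"
proof (induction N)
  case (Suc N)
  have "(real N + 1 + \<theta>) \<noteq> 0" "(real N + 2 + \<theta>) \<noteq> 0" using assms by linarith+
  then have "real N / (real N + 1 + \<theta>) + (1 + \<theta>) / ((real N + 1 + \<theta>) * (real N + 2 + \<theta>))
      = (real N + 1) / (real N + 2 + \<theta>)"
    by (simp add: divide_simps) (simp add: algebra_simps)
  with Suc show ?case by (simp add: digit_prob_def add_ac)
qed (simp add: digit_prob_def)

lemma sums_digit_prob:
  assumes "\<theta> \<ge> 0"
  shows "digit_prob \<theta> sums 1"
proof -
  have "(\<lambda>N. real N / (real N + 1 + \<theta>)) \<longlonglongrightarrow> 1" by real_asymp
  then have "(\<lambda>N. \<Sum>a<Suc N. digit_prob \<theta> a) \<longlonglongrightarrow> 1"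
    by (simp only: sum_digit_prob[OF assms])
  then show ?thesis unfolding sums_def by (subst (asm) filterlim_sequentially_Suc)
qed

definition digit_pmf :: "real \<Rightarrow> nat pmf" where
  "digit_pmf \<theta> = embed_pmf (digit_prob \<theta>)"

lemma pmf_digit_pmf:
  assumes "\<theta> \<ge> 0"
  shows "pmf (digit_pmf \<theta>) a = digit_prob \<theta> a"
  unfolding digit_pmf_def
proof (rule pmf_embed_pmf)
  show "0 \<le> digit_prob \<theta> x" for x using assms by (rule digit_prob_nonneg)
  have "(\<integral>\<^sup>+x. ennreal (digit_prob \<theta> x) \<partial>count_space UNIV) = (\<Sum>x. ennreal (digit_prob \<theta> x))"
    by (rule nn_integral_count_space_nat)
  also have "\<dots> = ennreal 1"
    using sums_digit_prob[OF assms] digit_prob_nonneg[OF assms]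
    by (intro suminf_ennreal_eq) auto
  finally show "(\<integral>\<^sup>+x. ennreal (digit_prob \<theta> x) \<partial>count_space UNIV) = 1" by simp
qed

lemma set_digit_pmf: "\<theta> \<ge> 0 \<Longrightarrow> a \<in> set_pmf (digit_pmf \<theta>) \<Longrightarrow> a \<ge> 1"
  by (auto simp: set_pmf_iff pmf_digit_pmf digit_prob_def split: if_splits)

section \<open>Expectations under discrete distributions\<close>

lemma integrable_pmf_bounded:
  fixes f :: "'a \<Rightarrow> real"
  assumes "\<And>x. x \<in> set_pmf p \<Longrightarrow> \<bar>f x\<bar> \<le> B"
  shows "integrable (measure_pmf p) f"
  by (rule measure_pmf.integrable_const_bound[where B=B]) (auto simp: AE_measure_pmf_iff assms)

lemma abs_expectation_pmf_le:
  fixes f :: "'a \<Rightarrow> real"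
  assumes "\<And>x. x \<in> set_pmf p \<Longrightarrow> \<bar>f x\<bar> \<le> B"
  shows "\<bar>measure_pmf.expectation p f\<bar> \<le> B"
proof -
  have "B \<ge> 0" using assms set_pmf_not_empty[of p] by fastforce
  have "\<bar>measure_pmf.expectation p f\<bar> \<le> measure_pmf.expectation p (\<lambda>x. \<bar>f x\<bar>)"
    by (rule integral_abs_bound)
  also have "\<dots> \<le> measure_pmf.expectation p (\<lambda>x. B)"
    by (intro integral_mono_AE integrable_pmf_bounded[where B=B]) (auto simp: AE_measure_pmf_iff assms \<open>B \<ge> 0\<close>)
  finally show ?thesis by simp
qed

text \<open>The tower rule. Adding \<open>B\<close> makes the integrand nonnegative, so the rule is
  inherited from the nonnegative integral, and \<open>B\<close> cancels at the end.\<close>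

lemma expectation_bind_pmf_bounded:
  fixes f :: "'b \<Rightarrow> real"
  assumes B: "\<And>x. \<bar>f x\<bar> \<le> B"
  shows "measure_pmf.expectation (bind_pmf p g) f
    = measure_pmf.expectation p (\<lambda>x. measure_pmf.expectation (g x) f)"
proof -
  have i: "integrable (measure_pmf q) f" for q by (rule integrable_pmf_bounded[OF B])
  have nn: "(\<integral>\<^sup>+x. ennreal (f x + B) \<partial>measure_pmf q) = ennreal (measure_pmf.expectation q f + B)" for q
  proof -
    have "f x + B \<ge> 0" for x using B[of x] by linarith
    then have "(\<integral>\<^sup>+x. ennreal (f x + B) \<partial>measure_pmf q) = ennreal (measure_pmf.expectation q (\<lambda>x. f x + B))"
      using i by (intro nn_integral_eq_integral) auto
    then show ?thesis using i by simp
  qed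
  have b: "\<bar>measure_pmf.expectation q f\<bar> \<le> B" for q by (rule abs_expectation_pmf_le[OF B])
  have b0: "measure_pmf.expectation q f + B \<ge> 0" for q using b[of q] by linarith
  have iB: "integrable (measure_pmf p) (\<lambda>x. measure_pmf.expectation (g x) f)"
    by (rule integrable_pmf_bounded[OF b])
  have "ennreal (measure_pmf.expectation (bind_pmf p g) f + B)
     = (\<integral>\<^sup>+x. ennreal (measure_pmf.expectation (g x) f + B) \<partial>measure_pmf p)"
    by (simp flip: nn)
  also have "\<dots> = ennreal (measure_pmf.expectation p (\<lambda>x. measure_pmf.expectation (g x) f + B))"
    using b0 iB by (intro nn_integral_eq_integral) auto
  also have "measure_pmf.expectation p (\<lambda>x. measure_pmf.expectation (g x) f + B)
    = measure_pmf.expectation p (\<lambda>x. measure_pmf.expectation (g x) f) + B"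
    using iB by simp
  finally show ?thesis
    using b0[of "bind_pmf p g"] abs_expectation_pmf_le[of p "\<lambda>x. measure_pmf.expectation (g x) f" B, OF b]
    by (subst (asm) ennreal_inj) auto
qed

section \<open>The transition operator of the chain\<close>

definition digit_op :: "(real \<Rightarrow> real) \<Rightarrow> real \<Rightarrow> real" where
  "digit_op f \<theta> = measure_pmf.expectation (digit_pmf \<theta>) (\<lambda>a. f (1 / (a + \<theta>)))"

lemma sums_expectation_pmf_nat:
  fixes f :: "nat \<Rightarrow> real"
  assumes "\<And>x. x \<in> set_pmf p \<Longrightarrow> \<bar>f x\<bar> \<le> B"
  shows "(\<lambda>a. pmf p a * f a) sums measure_pmf.expectation p f"
proof -
  have "integrable (measure_pmf p) f" using assms by (rule integrable_pmf_bounded)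
  then have "integrable (count_space UNIV) (\<lambda>a. pmf p a * f a)"
    by (simp add: measure_pmf_eq_density integrable_density)
  from sums_integral_count_space_nat[OF this]
  show ?thesis by (simp add: measure_pmf_eq_density integral_density)
qed

lemma recip_shift_unit:
  fixes a :: nat and \<theta> :: real assumes "a \<ge> 1" "\<theta> \<ge> 0" shows "1 / (a + \<theta>) \<in> {0..1}"
  using assms by (auto simp: divide_simps)

lemma lipschitz_unit_bounded:
  fixes f :: "real \<Rightarrow> real"
  assumes "L-lipschitz_on {0..1} f" "\<theta> \<in> {0..1}"
  shows "\<bar>f \<theta> - f 0\<bar> \<le> L * \<theta>"
  using lipschitz_onD[OF assms(1) assms(2), of 0] assms(2) by (simp add: dist_real_def)

lemma lipschitz_unit_abs_le:
  fixes f :: "real \<Rightarrow> real"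
  assumes "L-lipschitz_on {0..1} f" "\<theta> \<in> {0..1}"
  shows "\<bar>f \<theta>\<bar> \<le> L + \<bar>f 0\<bar>"
proof -
  have "L * \<theta> \<le> L * 1"
    using assms lipschitz_on_nonneg[OF assms(1)] by (intro mult_left_mono) auto
  then show ?thesis using lipschitz_unit_bounded[OF assms] by linarith
qed

lemma sums_digit_op:
  fixes \<theta> :: real
  assumes L: "L-lipschitz_on {0..1} f" and "\<theta> \<ge> 0"
  shows "(\<lambda>a. digit_prob \<theta> a * f (1 / (a + \<theta>))) sums digit_op f \<theta>"
proof -
  have "\<bar>f (1 / (a + \<theta>))\<bar> \<le> L + \<bar>f 0\<bar>" if "a \<in> set_pmf (digit_pmf \<theta>)" for a
    using lipschitz_unit_abs_le[OF L recip_shift_unit] set_digit_pmf[OF assms(2) that] assms(2) by blast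
  from sums_expectation_pmf_nat[of "digit_pmf \<theta>", OF this] show ?thesis
    by (simp add: digit_op_def pmf_digit_pmf[OF assms(2)])
qed

text \<open>The part of the difference in which the weights stay fixed. The map \<theta> to 1 / (a +
  \<theta>) contracts by 1 for a = 1 and by 1/4 for larger digits; since the digit 1 has probability
  1 / (2 + \<theta>) \<le> 1/2, the average factor is at most 1/4 + 3/4 * 1/2 = 5/8.\<close>

lemma digit_op_argument_bound:
  fixes f :: "real \<Rightarrow> real" and \<theta> \<phi> :: real
  assumes L: "L-lipschitz_on {0..1} f" and t: "\<theta> \<in> {0..1}" "\<phi> \<in> {0..1}"
  shows "\<bar>\<Sum>a<Suc N. digit_prob \<theta> a * (f (1 / (a + \<theta>)) - f (1 / (a + \<phi>)))\<bar> \<le> 5/8 * L * \<bar>\<theta> - \<phi>\<bar>"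
proof -
  have L0: "L \<ge> 0" using L by (rule lipschitz_on_nonneg)
  define w where "w a = (if a = 1 then 1 else 1/4 :: real)" for a :: nat
  have ptw: "\<bar>digit_prob \<theta> a * (f (1 / (a + \<theta>)) - f (1 / (a + \<phi>)))\<bar> \<le> digit_prob \<theta> a * w a * (L * \<bar>\<theta> - \<phi>\<bar>)" for a
  proof (cases "a = 0")
    case False
    have "\<bar>f (1 / (a + \<theta>)) - f (1 / (a + \<phi>))\<bar> \<le> L * \<bar>1 / (a + \<theta>) - 1 / (a + \<phi>)\<bar>"
      using lipschitz_onD[OF L recip_shift_unit recip_shift_unit, of a \<theta> a \<phi>] False t by (simp add: dist_real_def)
    also have "1 / (a + \<theta>) - 1 / (a + \<phi>) = (\<phi> - \<theta>) / ((a + \<theta>) * (a + \<phi>))"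
      using False t by (simp add: field_simps)
    also have "\<bar>(\<phi> - \<theta>) / ((a + \<theta>) * (a + \<phi>))\<bar> \<le> w a * \<bar>\<theta> - \<phi>\<bar>"
    proof -
      have "(a + \<theta>) * (a + \<phi>) \<ge> 1 / w a"
      proof (cases "a = 1")
        case True
        then show ?thesis using t mult_mono[of 1 "1 + \<theta>" 1 "1 + \<phi>"] by (simp add: w_def)
      next
        case False
        then show ?thesis using t \<open>a \<noteq> 0\<close> mult_mono[of 2 "a + \<theta>" 2 "a + \<phi>"] by (simp add: w_def)
      qed
      moreover have "w a > 0" by (simp add: w_def)
      ultimately have "1 \<le> w a * ((a + \<theta>) * (a + \<phi>))" by (simp add: field_simps)
      moreover have "(a + \<theta>) * (a + \<phi>) > 0" using False t by (intro mult_pos_pos) auto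
      ultimately have "1 / ((a + \<theta>) * (a + \<phi>)) \<le> w a" by (simp add: pos_divide_le_eq)
      from mult_right_mono[OF this, of "\<bar>\<theta> - \<phi>\<bar>"] \<open>(a + \<theta>) * (a + \<phi>) > 0\<close>
      show ?thesis by (simp add: abs_minus_commute)
    qed
    finally have "\<bar>f (1 / (a + \<theta>)) - f (1 / (a + \<phi>))\<bar> \<le> L * (w a * \<bar>\<theta> - \<phi>\<bar>)"
      using L0 by (simp add: mult_left_mono)
    from mult_left_mono[OF this digit_prob_nonneg[of \<theta> a]]
    show ?thesis using t digit_prob_nonneg[of \<theta> a] by (simp add: abs_mult mult_ac)
  qed (simp add: digit_prob_def)
  have "\<bar>\<Sum>a<Suc N. digit_prob \<theta> a * (f (1 / (a + \<theta>)) - f (1 / (a + \<phi>)))\<bar>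
     \<le> (\<Sum>a<Suc N. digit_prob \<theta> a * w a * (L * \<bar>\<theta> - \<phi>\<bar>))"
    by (intro order.trans[OF sum_abs] sum_mono ptw)
  also have "\<dots> = (\<Sum>a<Suc N. digit_prob \<theta> a * w a) * (L * \<bar>\<theta> - \<phi>\<bar>)" by (simp only: sum_distrib_right)
  also have "\<dots> \<le> 5/8 * (L * \<bar>\<theta> - \<phi>\<bar>)"
  proof (intro mult_right_mono)
    have "(\<Sum>a<Suc N. digit_prob \<theta> a * w a) \<le> (\<Sum>a<Suc N. digit_prob \<theta> a * (1/4) + (if a = 1 then 3/8 else 0))"
    proof (intro sum_mono)
      fix a
      have "digit_prob \<theta> 1 \<le> 1/2" using t by (simp add: digit_prob_def divide_simps)
      then show "digit_prob \<theta> a * w a \<le> digit_prob \<theta> a * (1/4) + (if a = 1 then 3/8 else 0)"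
        by (auto simp: w_def)
    qed
    also have "\<dots> \<le> (\<Sum>a<Suc N. digit_prob \<theta> a) * (1/4) + 3/8"
      by (simp only: sum.distrib sum_distrib_right sum.delta) simp
    also have "(\<Sum>a<Suc N. digit_prob \<theta> a) \<le> 1"
      using t by (subst sum_digit_prob) (auto simp: divide_simps)
    finally show "(\<Sum>a<Suc N. digit_prob \<theta> a * w a) \<le> 5/8" by simp
  qed (use L0 in auto)
  finally show ?thesis by simp
qed

text \<open>Abel summation: the distribution functions of the first digit are \<open>N / (N + 1 + \<theta>)\<close>, and the
  values \<open>f (1 / (N + \<phi>))\<close> vary slowly.\<close>

lemma digit_op_weight_bound:
  fixes f :: "real \<Rightarrow> real" and \<theta> \<phi> :: real
  assumes L: "L-lipschitz_on {0..1} f" and t: "\<theta> \<in> {0..1}" "\<phi> \<in> {0..1}" and N: "N \<ge> 1"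
  defines "D \<equiv> \<lambda>N::nat. N / (N + 1 + \<theta>) - N / (N + 1 + \<phi>)"
  shows "\<bar>(\<Sum>a<Suc N. (digit_prob \<theta> a - digit_prob \<phi> a) * f (1 / (a + \<phi>))) - D N * f (1 / (N + \<phi>))\<bar>
     \<le> L * \<bar>\<theta> - \<phi>\<bar> * (1/4 - 1 / (2 * real N * (real N + 1)))"
  using N
proof (induction N rule: nat_induct_at_least)
  case base
  \<comment> \<open>At N = 1 both sides vanish, since 1/4 = 1 / (2 * 1 * 2).\<close>
  have "D 1 = digit_prob \<theta> 1 - digit_prob \<phi> 1" using t by (simp add: D_def digit_prob_def add_ac)
  then show ?case by (simp add: digit_prob_def)
next
  case (Suc N)
  have L0: "L \<ge> 0" using L by (rule lipschitz_on_nonneg)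
  have DS: "digit_prob \<theta> (Suc N) - digit_prob \<phi> (Suc N) = D (Suc N) - D N"
    using sum_digit_prob[of \<theta> N] sum_digit_prob[of \<theta> "Suc N"] sum_digit_prob[of \<phi> N] sum_digit_prob[of \<phi> "Suc N"] t
    by (simp add: D_def add_ac)
  have f1: "\<bar>f (1 / (N + \<phi>)) - f (1 / (Suc N + \<phi>))\<bar> \<le> L * (1 / (real N * (real N + 1)))"
  proof -
    have "\<bar>f (1 / (N + \<phi>)) - f (1 / (Suc N + \<phi>))\<bar> \<le> L * \<bar>1 / (N + \<phi>) - 1 / (Suc N + \<phi>)\<bar>"
      using lipschitz_onD[OF L recip_shift_unit recip_shift_unit, of N \<phi> "Suc N" \<phi>] Suc t by (simp add: dist_real_def)
    also have "1 / (N + \<phi>) - 1 / (Suc N + \<phi>) = 1 / ((N + \<phi>) * (N + 1 + \<phi>))"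
      using Suc t by (simp add: field_simps)
    also have "\<bar>\<dots>\<bar> = 1 / ((N + \<phi>) * (N + 1 + \<phi>))" using Suc t by simp
    also have "\<dots> \<le> 1 / (real N * (real N + 1))"
      using Suc.hyps t by (intro divide_left_mono mult_mono mult_pos_pos) auto
    finally show ?thesis using L0 by (simp add: mult_left_mono)
  qed
  have d1: "\<bar>D N\<bar> \<le> \<bar>\<theta> - \<phi>\<bar> * (real N / ((real N + 1) * (real N + 1)))"
  proof -
    have "D N = N * (\<phi> - \<theta>) / ((N + 1 + \<theta>) * (N + 1 + \<phi>))"
      using Suc t by (simp add: D_def field_simps)
    then have "\<bar>D N\<bar> = \<bar>\<theta> - \<phi>\<bar> * (N / ((N + 1 + \<theta>) * (N + 1 + \<phi>)))"
      using t by (simp add: abs_mult abs_minus_commute)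
    also have "\<dots> \<le> \<bar>\<theta> - \<phi>\<bar> * (real N / ((real N + 1) * (real N + 1)))"
      using t by (intro mult_left_mono divide_left_mono mult_mono mult_pos_pos) auto
    finally show ?thesis .
  qed
  \<comment> \<open>The increment is 1 / (n + 1)^3, dominated by 1 / (n (n + 1) (n + 2)), which is a
    difference of consecutive values of 1 / (2 n (n + 1)).\<close>
  have tele: "real N / ((real N + 1) * (real N + 1)) * (1 / (real N * (real N + 1))) \<le> 1 / (2 * real N * (real N + 1)) - 1 / (2 * real (Suc N) * (real (Suc N) + 1))"
  proof -
    define n where "n = real N"
    have n: "n \<ge> 1" using Suc by (simp add: n_def)
    have "n / ((n + 1) * (n + 1)) * (1 / (n * (n + 1))) = 1 / ((n + 1) * ((n + 1) * (n + 1)))"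
      using n by simp
    also have "\<dots> \<le> 1 / (n * ((n + 1) * (n + 2)))"
    proof (intro divide_left_mono)
      show "n * ((n + 1) * (n + 2)) \<le> (n + 1) * ((n + 1) * (n + 1))"
        using n by (simp add: algebra_simps)
    qed (use n in auto)
    also have "\<dots> = 1 / (2 * n * (n + 1)) - 1 / (2 * (n + 1) * (n + 2))"
    proof -
      have "n + 1 \<noteq> 0" "n + 2 \<noteq> 0" "n \<noteq> 0" using n by auto
      then show ?thesis by (simp add: divide_simps) (simp add: algebra_simps)
    qed
    finally show ?thesis by (simp add: n_def algebra_simps)
  qed
  have "(\<Sum>a<Suc (Suc N). (digit_prob \<theta> a - digit_prob \<phi> a) * f (1 / (a + \<phi>))) - D (Suc N) * f (1 / (Suc N + \<phi>))
     = ((\<Sum>a<Suc N. (digit_prob \<theta> a - digit_prob \<phi> a) * f (1 / (a + \<phi>))) - D N * f (1 / (N + \<phi>)))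
       + D N * (f (1 / (N + \<phi>)) - f (1 / (Suc N + \<phi>)))"
    by (subst sum.lessThan_Suc, subst DS) (simp add: algebra_simps)
  also have "\<bar>\<dots>\<bar> \<le> L * \<bar>\<theta> - \<phi>\<bar> * (1/4 - 1 / (2 * real N * (real N + 1)))
     + \<bar>\<theta> - \<phi>\<bar> * (real N / ((real N + 1) * (real N + 1))) * (L * (1 / (real N * (real N + 1))))"
  proof (rule order.trans[OF abs_triangle_ineq add_mono[OF Suc.IH]])
    show "\<bar>D N * (f (1 / (N + \<phi>)) - f (1 / (Suc N + \<phi>)))\<bar>
       \<le> \<bar>\<theta> - \<phi>\<bar> * (real N / ((real N + 1) * (real N + 1))) * (L * (1 / (real N * (real N + 1))))"
      unfolding abs_mult by (rule mult_mono[OF d1 f1]) auto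
  qed
  also have "\<bar>\<theta> - \<phi>\<bar> * (real N / ((real N + 1) * (real N + 1))) * (L * (1 / (real N * (real N + 1))))
     = L * \<bar>\<theta> - \<phi>\<bar> * (real N / ((real N + 1) * (real N + 1)) * (1 / (real N * (real N + 1))))" by (simp only: mult_ac)
  also have "\<dots> \<le> L * \<bar>\<theta> - \<phi>\<bar> * (1 / (2 * real N * (real N + 1)) - 1 / (2 * real (Suc N) * (real (Suc N) + 1)))"
    using L0 by (intro mult_left_mono[OF tele]) auto
  also have "L * \<bar>\<theta> - \<phi>\<bar> * (1/4 - 1 / (2 * real N * (real N + 1))) + \<dots> = L * \<bar>\<theta> - \<phi>\<bar> * (1/4 - 1 / (2 * real (Suc N) * (real (Suc N) + 1)))"
    by (simp only: distrib_left[symmetric]) simp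
  finally show ?case by simp
qed

text \<open>Moving the arguments costs 5/8 and moving the weights 1/4, whence 7/8. Both estimates
  concern the digits up to \<open>N\<close>; the boundary term of Abel summation carries the factor
  \<open>D N\<close>, which tends to 0.\<close>

lemma digit_op_lipschitz:
  assumes L: "L-lipschitz_on {0..1} f"
  shows "(7/8 * L)-lipschitz_on {0..1} (digit_op f)"
proof (rule lipschitz_onI)
  have L0: "L \<ge> 0" using L by (rule lipschitz_on_nonneg)
  then show "0 \<le> 7/8 * L" by simp
  fix \<theta> \<phi> :: real assume t: "\<theta> \<in> {0..1}" "\<phi> \<in> {0..1}"
  define D where "D N = real N / (N + 1 + \<theta>) - N / (N + 1 + \<phi>)" for N :: nat
  define S where "S \<theta> N = (\<Sum>a<Suc N. digit_prob \<theta> a * f (1 / (a + \<theta>)))" for \<theta> :: real and N :: nat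
  have lim: "S \<theta> \<longlonglongrightarrow> digit_op f \<theta>" if "\<theta> \<in> {0..1}" for \<theta>
    using sums_digit_op[OF L, of \<theta>] that unfolding sums_def S_def
    by (subst filterlim_sequentially_Suc) auto
  have bound: "\<bar>S \<theta> N - S \<phi> N\<bar> \<le> 7/8 * L * \<bar>\<theta> - \<phi>\<bar> + \<bar>D N\<bar> * (L + \<bar>f 0\<bar>)" if N: "N \<ge> 1" for N
  proof -
    have "S \<theta> N - S \<phi> N = (\<Sum>a<Suc N. digit_prob \<theta> a * (f (1 / (a + \<theta>)) - f (1 / (a + \<phi>))))
        + (\<Sum>a<Suc N. (digit_prob \<theta> a - digit_prob \<phi> a) * f (1 / (a + \<phi>)))"
      unfolding S_def sum_subtractf[symmetric] sum.distrib[symmetric]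
      by (intro sum.cong) (auto simp: algebra_simps)
    moreover note digit_op_argument_bound[OF L t, of N] 
    moreover have "\<bar>(\<Sum>a<Suc N. (digit_prob \<theta> a - digit_prob \<phi> a) * f (1 / (a + \<phi>))) - D N * f (1 / (N + \<phi>))\<bar>
      \<le> 1/4 * L * \<bar>\<theta> - \<phi>\<bar>"
    proof -
      have "L * \<bar>\<theta> - \<phi>\<bar> * (1/4 - 1 / (2 * real N * (real N + 1))) \<le> L * \<bar>\<theta> - \<phi>\<bar> * (1/4)"
        using L0 by (intro mult_left_mono) auto
      from order.trans[OF digit_op_weight_bound[OF L t N] this] show ?thesis unfolding D_def by (simp only: mult_ac)
    qed
    moreover have "\<bar>D N * f (1 / (N + \<phi>))\<bar> \<le> \<bar>D N\<bar> * (L + \<bar>f 0\<bar>)"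
      unfolding abs_mult using lipschitz_unit_abs_le[OF L recip_shift_unit[OF N]] t
      by (intro mult_left_mono) auto
    ultimately show ?thesis by linarith
  qed
  have D0: "D \<longlonglongrightarrow> 0"
  proof -
    have "(\<lambda>N::nat. real N / (N + 1 + \<theta>)) \<longlonglongrightarrow> 1" for \<theta> :: real by real_asymp
    from tendsto_diff[OF this this] show ?thesis unfolding D_def by simp
  qed
  have l1: "(\<lambda>N. \<bar>S \<theta> N - S \<phi> N\<bar>) \<longlonglongrightarrow> \<bar>digit_op f \<theta> - digit_op f \<phi>\<bar>"
    using lim t by (intro tendsto_intros) auto
  have "(\<lambda>N. 7/8 * L * \<bar>\<theta> - \<phi>\<bar> + \<bar>D N\<bar> * (L + \<bar>f 0\<bar>)) \<longlonglongrightarrow> 7/8 * L * \<bar>\<theta> - \<phi>\<bar> + \<bar>0\<bar> * (L + \<bar>f 0\<bar>)"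
    using D0 by (intro tendsto_intros)
  then have "\<bar>digit_op f \<theta> - digit_op f \<phi>\<bar> \<le> 7/8 * L * \<bar>\<theta> - \<phi>\<bar> + \<bar>0\<bar> * (L + \<bar>f 0\<bar>)"
    using bound by (intro LIMSEQ_le[OF l1]) auto
  then show "dist (digit_op f \<theta>) (digit_op f \<phi>) \<le> 7/8 * L * dist \<theta> \<phi>" by (simp add: dist_real_def)
qed

lemma digit_op_funpow_lipschitz:
  assumes L: "L-lipschitz_on {0..1} f"
  shows "((7/8) ^ n * L)-lipschitz_on {0..1} ((digit_op ^^ n) f)"
proof (induction n)
  case (Suc n)
  from digit_op_lipschitz[OF Suc.IH] show ?case by (simp add: mult_ac)
qed (use L in auto)

section \<open>Identification of the stationary mean\<close>

definition gauss_mean :: "(real \<Rightarrow> real) \<Rightarrow> real" where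
  "gauss_mean f = (1 / ln 2) * integral {0..1} (\<lambda>x. f x / (1 + x))"

lemma integral_recip_one_plus:
  fixes a b :: real
  assumes "0 \<le> a" "a \<le> b"
  shows "((\<lambda>x. 1 / (1 + x)) has_integral (ln (1 + b) - ln (1 + a))) {a..b}"
  using assms
  by (intro fundamental_theorem_of_calculus)
     (auto intro!: derivative_eq_intros simp: has_real_derivative_iff_has_vector_derivative[symmetric] divide_simps)

lemma gauss_mean_integrable:
  assumes "continuous_on {0..1} f" "0 \<le> a" "b \<le> 1"
  shows "(\<lambda>x. f x / (1 + x)) integrable_on {a..(b::real)}"
  using assms
  by (intro integrable_continuous_real continuous_intros continuous_on_subset[OF assms(1)]) auto

text \<open>Gauss measure has mass 1, so a uniform bound on f - c passes to the mean. Taking for c a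
  value of an iterate gives convergence to the mean; c = B = 1/2 puts means of probabilities into
  the unit interval.\<close>

lemma gauss_mean_bound:
  assumes f: "continuous_on {0..1} f" and "\<And>\<theta>. \<theta> \<in> {0..1} \<Longrightarrow> \<bar>f \<theta> - c\<bar> \<le> B"
  shows "\<bar>gauss_mean f - c\<bar> \<le> B"
proof -
  have B0: "B \<ge> 0" using assms(2)[of 0] by auto
  have i: "((\<lambda>x. 1 / (1 + x)) has_integral ln 2) {0..1::real}"
    using integral_recip_one_plus[of 0 1] by simp
  have "((\<lambda>x. f x / (1 + x)) has_integral (ln 2 * gauss_mean f)) {0..1}"
    using gauss_mean_integrable[OF f, of 0 1] by (simp add: gauss_mean_def has_integral_integral)
  from has_integral_diff[OF this has_integral_mult_right[OF i, of c]]
  have d: "((\<lambda>x. (f x - c) / (1 + x)) has_integral (ln 2 * (gauss_mean f - c))) {0..1}"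
    by (simp add: diff_divide_distrib algebra_simps)
  have "norm (ln 2 * (gauss_mean f - c)) \<le> B * ln 2"
  proof -
    have "norm (integral {0..1} (\<lambda>x. (f x - c) / (1 + x))) \<le> integral {0..1} (\<lambda>x. B * (1 / (1 + x)))"
    proof (rule integral_norm_bound_integral)
      show "(\<lambda>x. (f x - c) / (1 + x)) integrable_on {0..1}" using d by blast
      show "(\<lambda>x. B * (1 / (1 + x))) integrable_on {0..1::real}" using has_integral_mult_right[OF i, of B] by blast
      fix x :: real assume x: "x \<in> {0..1}"
      then show "norm ((f x - c) / (1 + x)) \<le> B * (1 / (1 + x))"
        using assms(2)[OF x] by (auto simp: divide_simps)
    qed
    then show ?thesis using d has_integral_mult_right[OF i, of B] by (simp add: integral_unique)
  qed
  then show ?thesis by (simp add: abs_mult)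
qed

text \<open>Gauss measure is stationary for the chain \<open>\<theta> \<mapsto> 1 / (a + \<theta>)\<close>: the substitution
  \<open>t = 1 / (a + \<theta>)\<close> maps the term for the digit \<open>a\<close> to the integral over \<open>{1 / (a + 1)..1 / a}\<close>.\<close>

lemma gauss_mean_digit_term:
  fixes a :: nat
  assumes f: "continuous_on {0..1} f" and a: "a \<ge> 1"
  shows "((\<lambda>\<theta>. digit_prob \<theta> a * f (1 / (a + \<theta>)) / (1 + \<theta>)) has_integral
     integral {1 / (a + 1)..1 / a} (\<lambda>x. f x / (1 + x))) {0..1::real}"
proof -
  let ?g = "\<lambda>\<theta>::real. 1 / (a + \<theta>)"
  have sub: "?g ` {0..1} \<subseteq> {0..1}" using recip_shift_unit[OF a] by auto
  have cf: "continuous_on {0..1} (\<lambda>x. f x / (1 + x))" by (intro continuous_intros f) auto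
  have cg: "continuous_on {0..1} ?g" using a by (intro continuous_intros) auto
  have dg: "(?g has_real_derivative - 1 / (a + x)\<^sup>2) (at x within {0..1})" if "x \<in> {0..1} - {}" for x :: real
    using a that by (auto intro!: derivative_eq_intros simp: power2_eq_square)
  have "((\<lambda>\<theta>. (- 1 / (a + \<theta>)\<^sup>2) *\<^sub>R (f (?g \<theta>) / (1 + ?g \<theta>))) has_integral
     (integral {?g 0..?g 1} (\<lambda>x. f x / (1 + x)) - integral {?g 1..?g 0} (\<lambda>x. f x / (1 + x)))) {0..1}"
    by (rule has_integral_substitution_general[OF _ _ sub cf cg dg]) auto
  \<comment> \<open>\<open>?g\<close> decreases, so this interval is empty: of the two orientations
    in the substitution formula only the reversed one survives, and its minus sign is removed by the
    negation that follows.\<close>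
  moreover have "{?g 0..?g 1} = {} \<or> ?g 0 = ?g 1" using a by (auto simp: divide_simps)
  then have "integral {?g 0..?g 1} (\<lambda>x. f x / (1 + x)) = 0" by auto
  ultimately have "((\<lambda>\<theta>. (- 1 / (a + \<theta>)\<^sup>2) *\<^sub>R (f (?g \<theta>) / (1 + ?g \<theta>))) has_integral
     - integral {?g 1..?g 0} (\<lambda>x. f x / (1 + x))) {0..1}" by simp
  from has_integral_neg[OF this]
  have "((\<lambda>\<theta>. (1 / (a + \<theta>)\<^sup>2) * (f (?g \<theta>) / (1 + ?g \<theta>))) has_integral
     integral {1 / (a + 1)..1 / a} (\<lambda>x. f x / (1 + x))) {0..1}" by (simp add: add_ac)
  moreover have "(1 / (a + \<theta>)\<^sup>2) * (f (?g \<theta>) / (1 + ?g \<theta>)) = digit_prob \<theta> a * f (?g \<theta>) / (1 + \<theta>)"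
    if t: "\<theta> \<in> {0..1}" for \<theta> :: real
  proof -
    define y where "y = a + \<theta>"
    have y: "y > 0" "a + 1 + \<theta> = y + 1" "1 + \<theta> \<noteq> 0" using a t by (auto simp: y_def)
    have "1 / y\<^sup>2 * (F / (1 + 1 / y)) = (1 + \<theta>) / (y * (y + 1)) * F / (1 + \<theta>)" for F :: real
    proof -
      have "1 + 1 / y = (y + 1) / y" using y(1) by (simp add: field_simps)
      then show ?thesis using y by (simp add: power2_eq_square)
    qed
    from this[of "f (1 / y)"] show ?thesis
      using a unfolding digit_prob_def y(2) unfolding y_def[symmetric] by (simp add: y_def)
  qed
  ultimately show ?thesis by (rule has_integral_eq[rotated])
qed

text \<open>The intervals {1 / (a + 1)..1 / a} of the digits up to N tile {1 / (N + 1)..1}.\<close>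

lemma gauss_mean_digit_partial:
  assumes f: "continuous_on {0..1} f"
  shows "((\<lambda>\<theta>. (\<Sum>a<Suc N. digit_prob \<theta> a * f (1 / (a + \<theta>))) / (1 + \<theta>)) has_integral
     integral {1 / (N + 1)..1} (\<lambda>x. f x / (1 + x))) {0..1::real}"
proof (induction N)
  case (Suc N)
  have "integral {1 / (real (Suc N) + 1)..1 / Suc N} (\<lambda>x. f x / (1 + x)) + integral {1 / Suc N..1} (\<lambda>x. f x / (1 + x))
     = integral {1 / (real (Suc N) + 1)..1} (\<lambda>x. f x / (1 + x))"
    by (intro Henstock_Kurzweil_Integration.integral_combine gauss_mean_integrable f) (auto simp: divide_simps)
  with has_integral_add[OF Suc gauss_mean_digit_term[OF f, of "Suc N"]]
  show ?case by (simp add: add_divide_distrib add_ac)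
qed (simp add: digit_prob_def)

lemma abs_div_one_plus_le:
  fixes u x :: real
  assumes "x \<ge> 0" shows "\<bar>u / (1 + x)\<bar> \<le> \<bar>u\<bar>"
  using divide_left_mono[of 1 "1 + x" "\<bar>u\<bar>"] assms by (simp add: abs_divide)

text \<open>\<open>digit_op f\<close> is 1 + \<theta> times the Gauss-Kuzmin operator applied to f x
  / (1 + x), so this is the invariance of Gauss measure. Sum and integral are interchanged by
  cutting at the digit N: larger digits have probability at most 2 / (N + 1), and the integral
  misses an interval of length 1 / (N + 1).\<close>

lemma gauss_mean_digit_op:
  assumes L: "L-lipschitz_on {0..1} f"
  shows "gauss_mean (digit_op f) = gauss_mean f"
proof -
  have f: "continuous_on {0..1} f" using L by (rule lipschitz_on_continuous_on)
  have Uf: "continuous_on {0..1} (digit_op f)" using digit_op_lipschitz[OF L] by (rule lipschitz_on_continuous_on)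
  define B where "B = L + \<bar>f 0\<bar>"
  have B: "\<bar>f \<theta>\<bar> \<le> B" if "\<theta> \<in> {0..1}" for \<theta>
    unfolding B_def using L that by (rule lipschitz_unit_abs_le)
  have B0: "B \<ge> 0" using B[of 0] by auto
  define S where "S N \<theta> = (\<Sum>a<Suc N. digit_prob \<theta> a * f (1 / (a + \<theta>)))" for N and \<theta> :: real
  define I where "I N = integral {1 / (real N + 1)..1} (\<lambda>x. f x / (1 + x))" for N :: nat
  have SI: "((\<lambda>\<theta>. S N \<theta> / (1 + \<theta>)) has_integral I N) {0..1}" for N
    using gauss_mean_digit_partial[OF f, of N] unfolding S_def I_def by (simp add: add_ac)
  have tail: "\<bar>digit_op f \<theta> - S N \<theta>\<bar> \<le> B * (2 / (real N + 1))" if t: "\<theta> \<in> {0..1}" for N \<theta>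
  proof -
    have s1: "(\<lambda>a. digit_prob \<theta> (a + Suc N) * f (1 / (real (a + Suc N) + \<theta>))) sums (digit_op f \<theta> - S N \<theta>)"
      using sums_digit_op[OF L, of \<theta>] t unfolding S_def by (intro sums_split_initial_segment) auto
    have "(\<lambda>a. digit_prob \<theta> (a + Suc N)) sums (1 - (\<Sum>a<Suc N. digit_prob \<theta> a))"
      using sums_digit_prob[of \<theta>] t by (intro sums_split_initial_segment) auto
    moreover have "1 - (\<Sum>a<Suc N. digit_prob \<theta> a) = (1 + \<theta>) / (N + 1 + \<theta>)"
      using t by (subst sum_digit_prob) (auto simp: field_simps)
    ultimately have s2: "(\<lambda>a. B * digit_prob \<theta> (a + Suc N)) sums (B * ((1 + \<theta>) / (N + 1 + \<theta>)))"
      by (intro sums_mult) simp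
    have "norm (digit_prob \<theta> (a + Suc N) * f (1 / (real (a + Suc N) + \<theta>))) \<le> B * digit_prob \<theta> (a + Suc N)" for a
      using B[OF recip_shift_unit[of "a + Suc N" \<theta>]] t digit_prob_nonneg[of \<theta> "a + Suc N"]
      by (simp add: abs_mult mult.commute[of B] mult_left_mono)
    then have "norm (digit_op f \<theta> - S N \<theta>) \<le> B * ((1 + \<theta>) / (N + 1 + \<theta>))"
      unfolding sums_unique[OF s1] sums_unique[OF s2] by (intro norm_suminf_le sums_summable[OF s2])
    also have "\<dots> \<le> B * (2 / (real N + 1))"
      using t B0 by (intro mult_left_mono frac_le) auto
    finally show ?thesis by simp
  qed
  have e1: "\<bar>integral {0..1} (\<lambda>x. digit_op f x / (1 + x)) - I N\<bar> \<le> B * (2 / (real N + 1))" for N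
  proof -
    have i: "(\<lambda>x. digit_op f x / (1 + x)) integrable_on {0..1}" by (rule gauss_mean_integrable[OF Uf]) auto
    have "((\<lambda>x. digit_op f x / (1 + x) - S N x / (1 + x)) has_integral
        (integral {0..1} (\<lambda>x. digit_op f x / (1 + x)) - I N)) {0..1}"
      using i SI by (intro has_integral_diff) (auto simp: has_integral_integral)
    then have "norm (integral {0..1} (\<lambda>x. digit_op f x / (1 + x)) - I N) \<le> (B * (2 / (real N + 1))) * measure lborel (cbox 0 (1::real))"
    proof (intro has_integral_bound[where f="\<lambda>x. digit_op f x / (1 + x) - S N x / (1 + x)"])
      fix x :: real assume "x \<in> cbox 0 1"
      then have x: "x \<in> {0..1}" by simp
      have "\<bar>(digit_op f x - S N x) / (1 + x)\<bar> \<le> \<bar>digit_op f x - S N x\<bar>"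
        using x by (intro abs_div_one_plus_le) auto
      also have "\<dots> \<le> B * (2 / (real N + 1))" by (rule tail[OF x])
      finally show "norm (digit_op f x / (1 + x) - S N x / (1 + x)) \<le> B * (2 / (real N + 1))"
        by (simp add: diff_divide_distrib)
    qed (use B0 in auto)
    then show ?thesis by simp
  qed
  have e2: "\<bar>integral {0..1} (\<lambda>x. f x / (1 + x)) - I N\<bar> \<le> B * (2 / (real N + 1))" for N
  proof -
    have "integral {0..1 / (real N + 1)} (\<lambda>x. f x / (1 + x)) + I N = integral {0..1} (\<lambda>x. f x / (1 + x))"
      unfolding I_def by (intro Henstock_Kurzweil_Integration.integral_combine gauss_mean_integrable f) (auto simp: divide_simps)
    moreover have "norm (integral {0..1 / (real N + 1)} (\<lambda>x. f x / (1 + x))) \<le> B * (1 / (real N + 1) - 0)"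
    proof (rule integral_bound)
      have "1 / (real N + 1) \<le> 1" by simp
      then have sub: "{0..1 / (real N + 1)} \<subseteq> {0..1}" by (subst atLeastatMost_subset_iff) auto
      from continuous_on_subset[OF f this]
      show "continuous_on {0..1 / (real N + 1)} (\<lambda>x. f x / (1 + x))"
        by (intro continuous_intros) auto
      fix x :: real assume x: "x \<in> {0..1 / (real N + 1)}"
      then have x': "x \<in> {0..1}" using sub by blast
      have "\<bar>f x / (1 + x)\<bar> \<le> \<bar>f x\<bar>"
        using x' by (intro abs_div_one_plus_le) auto
      then show "norm (f x / (1 + x)) \<le> B" using B[OF x'] by simp
    qed auto
    moreover have "B * (1 / (real N + 1) - 0) \<le> B * (2 / (real N + 1))"
      using B0 by (intro mult_left_mono) (auto simp: divide_simps)
    ultimately show ?thesis unfolding real_norm_def by linarith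
  qed
  have "\<bar>integral {0..1} (\<lambda>x. digit_op f x / (1 + x)) - integral {0..1} (\<lambda>x. f x / (1 + x))\<bar> \<le> 4 * B / (real N + 1)" for N
  proof -
    have "4 * B / (real N + 1) = B * (2 / (real N + 1)) + B * (2 / (real N + 1))" by simp
    then show ?thesis using e1[of N] e2[of N] by linarith
  qed
  moreover have "(\<lambda>N. 4 * B / (real N + 1)) \<longlonglongrightarrow> 0" by real_asymp
  ultimately have "\<bar>integral {0..1} (\<lambda>x. digit_op f x / (1 + x)) - integral {0..1} (\<lambda>x. f x / (1 + x))\<bar> \<le> 0"
    by (intro LIMSEQ_le[OF tendsto_const]) (auto simp: add_ac)
  then show ?thesis unfolding gauss_mean_def by simp
qed

text \<open>The iterate has the same mean as \<open>f\<close> by invariance and varies by at most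
  (7/8)^n L over the unit interval, so each of its values is that close to the mean.\<close>

lemma digit_op_funpow_converges:
  assumes L: "L-lipschitz_on {0..1} f" and t: "\<theta> \<in> {0..1}"
  shows "\<bar>(digit_op ^^ n) f \<theta> - gauss_mean f\<bar> \<le> (7/8) ^ n * L"
proof -
  note Ln = digit_op_funpow_lipschitz[OF L, of n]
  have inv: "gauss_mean ((digit_op ^^ n) f) = gauss_mean f" for n
  proof (induction n)
    case (Suc n)
    then show ?case using gauss_mean_digit_op[OF digit_op_funpow_lipschitz[OF L, of n]] by simp
  qed auto
  have "\<bar>gauss_mean ((digit_op ^^ n) f) - (digit_op ^^ n) f \<theta>\<bar> \<le> (7/8) ^ n * L"
  proof (rule gauss_mean_bound)
    show "continuous_on {0..1} ((digit_op ^^ n) f)" using Ln by (rule lipschitz_on_continuous_on)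
    fix \<phi> :: real assume p: "\<phi> \<in> {0..1}"
    have "\<bar>(digit_op ^^ n) f \<phi> - (digit_op ^^ n) f \<theta>\<bar> \<le> (7/8) ^ n * L * \<bar>\<phi> - \<theta>\<bar>"
      using lipschitz_onD[OF Ln p t] by (simp add: dist_real_def)
    also have "\<dots> \<le> (7/8) ^ n * L * 1"
      using p t lipschitz_on_nonneg[OF L] by (intro mult_left_mono) auto
    finally show "\<bar>(digit_op ^^ n) f \<phi> - (digit_op ^^ n) f \<theta>\<bar> \<le> (7/8) ^ n * L" by simp
  qed
  then show ?thesis by (simp add: inv abs_minus_commute)
qed

section \<open>The joint law of the first n digits\<close>

fun digits_pmf :: "nat \<Rightarrow> real \<Rightarrow> nat list pmf" where
  "digits_pmf 0 \<theta> = return_pmf []"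
| "digits_pmf (Suc n) \<theta> = bind_pmf (digit_pmf \<theta>) (\<lambda>a. map_pmf ((#) a) (digits_pmf n (1 / (real a + \<theta>))))"

text \<open>The fold puts the latest digit outermost, so this is the continued fraction of the
  reversed word with tail \<theta>. A fraction \<theta> = x / y moves to y / (a y + x), the
  recursion of the denominators.\<close>

definition past :: "real \<Rightarrow> nat list \<Rightarrow> real" where
  "past \<theta> t = foldl (\<lambda>\<theta> a. 1 / (real a + \<theta>)) \<theta> t"

lemma past_simps [simp]:
  "past \<theta> [] = \<theta>" "past \<theta> (a # t) = past (1 / (real a + \<theta>)) t"
  by (simp_all add: past_def)

lemma past_unit: "\<theta> \<in> {0..1} \<Longrightarrow> \<forall>a\<in>set t. a \<ge> 1 \<Longrightarrow> past \<theta> t \<in> {0..1}"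
proof (induction t arbitrary: \<theta>)
  case (Cons a t)
  have "1 / (real a + \<theta>) \<in> {0..1}" using Cons.prems by (intro recip_shift_unit) auto
  then show ?case using Cons by simp
qed simp

lemma set_digits_pmf:
  assumes "\<theta> \<in> {0..1}" "t \<in> set_pmf (digits_pmf n \<theta>)"
  shows "length t = n \<and> (\<forall>a\<in>set t. a \<ge> 1)"
  using assms
proof (induction n arbitrary: \<theta> t)
  case (Suc n)
  then obtain a t' where a: "a \<in> set_pmf (digit_pmf \<theta>)" "t = a # t'" "t' \<in> set_pmf (digits_pmf n (1 / (real a + \<theta>)))"
    by auto
  have "a \<ge> 1" using set_digit_pmf[OF _ a(1)] Suc.prems by auto
  moreover from this have "1 / (real a + \<theta>) \<in> {0..1}" using Suc.prems by (intro recip_shift_unit) auto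
  ultimately show ?case using Suc.IH a by fastforce
qed simp

text \<open>The Markov property: the first m digits act on the later ones only through
  \<open>past \<theta> t\<close>.\<close>

lemma digits_pmf_add:
  "digits_pmf (m + n) \<theta> = bind_pmf (digits_pmf m \<theta>) (\<lambda>t. map_pmf ((@) t) (digits_pmf n (past \<theta> t)))"
proof (induction m arbitrary: \<theta>)
  case 0
  have "(@) [] = (id :: nat list \<Rightarrow> nat list)" by auto
  then show ?case by (simp add: bind_return_pmf map_pmf_id)
next
  case (Suc m)
  then show ?case
    by (simp add: bind_assoc_pmf bind_map_pmf map_bind_pmf map_pmf_comp append_Cons[abs_def])
qed

lemma expectation_digits_add:
  fixes \<phi> :: "nat list \<Rightarrow> real"
  assumes "\<And>t. \<bar>\<phi> t\<bar> \<le> B"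
  shows "measure_pmf.expectation (digits_pmf (m + n) \<theta>) \<phi>
    = measure_pmf.expectation (digits_pmf m \<theta>)
        (\<lambda>t. measure_pmf.expectation (digits_pmf n (past \<theta> t)) (\<lambda>t'. \<phi> (t @ t')))"
  unfolding digits_pmf_add by (subst expectation_bind_pmf_bounded[OF assms]) simp

text \<open>Consistency of the laws for different lengths, which stands in for a measure on infinite
  digit sequences.\<close>

lemma expectation_digits_take:
  fixes \<phi> :: "nat list \<Rightarrow> real"
  assumes B: "\<And>t. \<bar>\<phi> t\<bar> \<le> B" and "m \<le> n" "\<theta> \<in> {0..1}"
  shows "measure_pmf.expectation (digits_pmf n \<theta>) (\<lambda>t. \<phi> (take m t))
    = measure_pmf.expectation (digits_pmf m \<theta>) \<phi>"
proof -
  obtain k where n: "n = m + k" using assms(2) le_Suc_ex by blast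
  show ?thesis unfolding n
    by (subst expectation_digits_add[OF B])
       (use set_digits_pmf[OF assms(3)] in \<open>auto intro!: integral_cong_AE simp: AE_measure_pmf_iff\<close>)
qed

lemma expectation_past:
  assumes L: "L-lipschitz_on {0..1} f" and t: "\<theta> \<in> {0..1}"
  shows "measure_pmf.expectation (digits_pmf n \<theta>) (\<lambda>t. f (past \<theta> t)) = (digit_op ^^ n) f \<theta>"
proof -
  \<comment> \<open>\<open>f\<close> is controlled on the unit interval only, whereas the tower rule
    asks for a global bound; clamping the argument supplies it and changes nothing on the
    support.\<close>
  define g where "g x = f (max 0 (min 1 x))" for x
  have gB: "\<bar>g x\<bar> \<le> L + \<bar>f 0\<bar>" for x
    unfolding g_def by (rule lipschitz_unit_abs_le[OF L]) auto
  have "measure_pmf.expectation (digits_pmf n \<theta>) (\<lambda>t. g (past \<theta> t)) = (digit_op ^^ n) f \<theta>"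
    using t
  proof (induction n arbitrary: \<theta>)
    case 0 then show ?case by (auto simp: g_def max_def min_def)
  next
    case (Suc n)
    have "measure_pmf.expectation (digits_pmf (Suc n) \<theta>) (\<lambda>t. g (past \<theta> t))
      = measure_pmf.expectation (digit_pmf \<theta>)
         (\<lambda>a. measure_pmf.expectation (digits_pmf n (1 / (real a + \<theta>))) (\<lambda>t. g (past (1 / (real a + \<theta>)) t)))"
      unfolding digits_pmf.simps by (subst expectation_bind_pmf_bounded[OF gB]) simp
    also have "\<dots> = measure_pmf.expectation (digit_pmf \<theta>) (\<lambda>a. (digit_op ^^ n) f (1 / (real a + \<theta>)))"
    proof (intro integral_cong_AE)
      have "1 / (real a + \<theta>) \<in> {0..1}" if "a \<in> set_pmf (digit_pmf \<theta>)" for a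
        using set_digit_pmf[OF _ that] Suc.prems by (intro recip_shift_unit) auto
      then show "AE a in measure_pmf (digit_pmf \<theta>).
        measure_pmf.expectation (digits_pmf n (1 / (real a + \<theta>))) (\<lambda>t. g (past (1 / (real a + \<theta>)) t)) = (digit_op ^^ n) f (1 / (real a + \<theta>))"
        using Suc.IH by (auto simp: AE_measure_pmf_iff)
    qed auto
    also have "\<dots> = (digit_op ^^ Suc n) f \<theta>" by (simp add: digit_op_def)
    finally show ?case .
  qed
  moreover have "measure_pmf.expectation (digits_pmf n \<theta>) (\<lambda>t. f (past \<theta> t)) = measure_pmf.expectation (digits_pmf n \<theta>) (\<lambda>t. g (past \<theta> t))"
  proof (intro integral_cong_AE)
    have "past \<theta> x \<in> {0..1}" if "x \<in> set_pmf (digits_pmf n \<theta>)" for x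
      using past_unit[OF t] set_digits_pmf[OF t that] by blast
    then show "AE x in measure_pmf (digits_pmf n \<theta>). f (past \<theta> x) = g (past \<theta> x)"
      by (simp add: AE_measure_pmf_iff g_def)
  qed auto
  ultimately show ?thesis by simp
qed

definition word_prob :: "nat list \<Rightarrow> real \<Rightarrow> real" where
  "word_prob s \<theta> = pmf (digits_pmf (length s) \<theta>) s"

lemma word_prob_Nil [simp]: "word_prob [] \<theta> = 1"
  by (simp add: word_prob_def)

lemma word_prob_Cons:
  assumes "\<theta> \<ge> 0"
  shows "word_prob (a # s) \<theta> = digit_prob \<theta> a * word_prob s (1 / (real a + \<theta>))"
proof -
  have "word_prob (a # s) \<theta> = measure_pmf.expectation (digit_pmf \<theta>)
     (\<lambda>b. pmf (map_pmf ((#) b) (digits_pmf (length s) (1 / (real b + \<theta>)))) (a # s))"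
    by (simp add: word_prob_def pmf_bind)
  also have "\<dots> = (\<Sum>b\<in>{a}. pmf (digit_pmf \<theta>) b *\<^sub>R pmf (map_pmf ((#) b) (digits_pmf (length s) (1 / (real b + \<theta>)))) (a # s))"
  proof (rule integral_measure_pmf)
    fix b assume "pmf (map_pmf ((#) b) (digits_pmf (length s) (1 / (real b + \<theta>)))) (a # s) \<noteq> 0"
    then have "a # s \<in> set_pmf (map_pmf ((#) b) (digits_pmf (length s) (1 / (real b + \<theta>))))"
      unfolding set_pmf_iff .
    then show "b \<in> {a}" by auto
  qed auto
  also have "\<dots> = digit_prob \<theta> a * word_prob s (1 / (real a + \<theta>))"
    using pmf_map_inj'[of "(#) a" "digits_pmf (length s) (1 / (real a + \<theta>))" s] assms
    by (simp add: pmf_digit_pmf word_prob_def)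
  finally show ?thesis .
qed

section \<open>Cylinders\<close>

text \<open>The inverse branch of the iterated Gauss map that belongs to \<open>s\<close>, with tail
  \<open>y\<close>; the images of 0 and 1 are the end points of the cylinder.\<close>

definition cf_eval :: "nat list \<Rightarrow> real \<Rightarrow> real" where
  "cf_eval s y = foldr (\<lambda>a x. 1 / (real a + x)) s y"

lemma cf_eval_simps [simp]: "cf_eval [] y = y" "cf_eval (a # s) y = 1 / (real a + cf_eval s y)"
  by (simp_all add: cf_eval_def)

lemma cf_eval_append: "cf_eval (s @ t) y = cf_eval s (cf_eval t y)"
  by (simp add: cf_eval_def)

lemma cf_eval_unit: "y \<in> {0..1} \<Longrightarrow> \<forall>a\<in>set s. a \<ge> 1 \<Longrightarrow> cf_eval s y \<in> {0..1}"
proof (induction s)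
  case (Cons a s)
  have "1 / (real a + cf_eval s y) \<in> {0..1}" using Cons by (intro recip_shift_unit) auto
  then show ?case by simp
qed simp

text \<open>The distribution function of the fractional part when the past is \<open>\<theta>\<close>: the law of
  \<open>[0; a\<^sub>1, a\<^sub>2, \<dots>]\<close> under the digit process started at \<open>\<theta>\<close> has density
  \<open>(1 + \<theta>) / (1 + \<theta> x)\<^sup>2\<close>.\<close>

definition past_cdf :: "real \<Rightarrow> real \<Rightarrow> real" where
  "past_cdf x \<theta> = (1 + \<theta>) * x / (1 + \<theta> * x)"

lemma past_cdf_lipschitz:
  assumes x: "x \<in> {0..1}"
  shows "1-lipschitz_on {0..1} (past_cdf x)"
proof (rule lipschitz_onI)
  fix \<theta> \<phi> :: real assume t: "\<theta> \<in> {0..1}" "\<phi> \<in> {0..1}"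
  have p: "1 + \<theta> * x \<ge> 1" "1 + \<phi> * x \<ge> 1" using x t by auto
  have eq: "past_cdf x \<theta> - past_cdf x \<phi> = (\<theta> - \<phi>) * (x * (1 - x) / ((1 + \<theta> * x) * (1 + \<phi> * x)))"
  proof -
    have "past_cdf x \<theta> - past_cdf x \<phi>
      = ((1 + \<theta>) * x * (1 + \<phi> * x) - (1 + \<phi>) * x * (1 + \<theta> * x)) / ((1 + \<theta> * x) * (1 + \<phi> * x))"
      unfolding past_cdf_def using p by (subst diff_frac_eq) auto
    also have "(1 + \<theta>) * x * (1 + \<phi> * x) - (1 + \<phi>) * x * (1 + \<theta> * x) = (\<theta> - \<phi>) * (x * (1 - x))"
      by (simp add: algebra_simps)
    finally show ?thesis by simp
  qed
  have "x * (1 - x) / ((1 + \<theta> * x) * (1 + \<phi> * x)) \<le> 1 / 1"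
    using x p mult_mono[of x 1 "1 - x" 1] mult_mono[of 1 "1 + \<theta> * x" 1 "1 + \<phi> * x"]
    by (intro frac_le) auto
  moreover have "x * (1 - x) / ((1 + \<theta> * x) * (1 + \<phi> * x)) \<ge> 0" using x p by auto
  ultimately have "\<bar>x * (1 - x) / ((1 + \<theta> * x) * (1 + \<phi> * x))\<bar> \<le> 1" by linarith
  then have "\<bar>\<theta> - \<phi>\<bar> * \<bar>x * (1 - x) / ((1 + \<theta> * x) * (1 + \<phi> * x))\<bar> \<le> \<bar>\<theta> - \<phi>\<bar> * 1"
    by (rule mult_left_mono) auto
  then show "dist (past_cdf x \<theta>) (past_cdf x \<phi>) \<le> 1 * dist \<theta> \<phi>"
    unfolding dist_real_def eq abs_mult by (simp only: mult_1 mult_1_right)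
qed simp

text \<open>Both sides are the probability that the first digit is a and the remaining fraction lies
  between y and x: on the left by conditioning on the digit, on the right directly, with the end
  points swapped because t to 1 / (a + t) decreases.\<close>

lemma past_cdf_step:
  fixes a :: nat
  assumes "x \<in> {0..1}" "y \<in> {0..1}" "\<theta> \<in> {0..1}" "a \<ge> 1"
  shows "digit_prob \<theta> a * (past_cdf x (1 / (real a + \<theta>)) - past_cdf y (1 / (real a + \<theta>)))
    = past_cdf (1 / (real a + y)) \<theta> - past_cdf (1 / (real a + x)) \<theta>"
proof -
  define b where "b = a + \<theta>"
  have b: "b > 0" "b + x > 0" "b + y > 0" "real a + x > 0" "a + y > 0" using assms by (auto simp: b_def)
  have e1: "past_cdf x (1 / b) = (b + 1) * x / (b + x)" if "x \<in> {0..1}" for x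
  proof -
    have "b + x > 0" using that b by auto
    moreover have "1 + 1 / b = (b + 1) / b" "1 + 1 / b * x = (b + x) / b" using b(1) by (simp_all add: field_simps)
    ultimately show ?thesis using b(1) by (simp add: past_cdf_def)
  qed
  have e2: "past_cdf (1 / (real a + x)) \<theta> = (1 + \<theta>) / (b + x)" if "x \<in> {0..1}" for x
  proof -
    have "b + x > 0" "real a + x > 0" using that b assms by auto
    moreover from this have "1 + \<theta> * (1 / (real a + x)) = (b + x) / (real a + x)" by (simp add: b_def field_simps)
    ultimately show ?thesis by (simp add: past_cdf_def)
  qed
  have "(1 + \<theta>) / (b * (b + 1)) * ((b + 1) * x / (b + x) - (b + 1) * y / (b + y))
    = (1 + \<theta>) / (b * (b + 1)) * ((b + 1) * (x / (b + x) - y / (b + y)))"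
    by (simp only: right_diff_distrib times_divide_eq_right)
  also have "\<dots> = (1 + \<theta>) / b * (x / (b + x) - y / (b + y))"
    using b(1) by simp
  also have "x / (b + x) - y / (b + y) = b * (1 / (b + y) - 1 / (b + x))"
    using b by (simp add: field_simps)
  also have "(1 + \<theta>) / b * (b * (1 / (b + y) - 1 / (b + x))) = (1 + \<theta>) / (b + y) - (1 + \<theta>) / (b + x)"
    using b(1) by (simp add: right_diff_distrib)
  finally have "(1 + \<theta>) / (b * (b + 1)) * ((b + 1) * x / (b + x) - (b + 1) * y / (b + y))
    = (1 + \<theta>) / (b + y) - (1 + \<theta>) / (b + x)" .
  moreover have "digit_prob \<theta> a = (1 + \<theta>) / (b * (b + 1))"
    using assms(4) by (simp add: digit_prob_def b_def add_ac)
  ultimately show ?thesis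
    unfolding b_def[symmetric] e1[OF assms(1)] e1[OF assms(2)] e2[OF assms(1)] e2[OF assms(2)] by simp
qed

text \<open>The probability of a word is the mass of the interval between the images of 0 and 1.
  Each digit reverses the orientation, hence the sign by parity.\<close>

lemma word_prob_eq:
  assumes "\<forall>a\<in>set s. a \<ge> 1" "\<theta> \<in> {0..1}"
  shows "word_prob s \<theta> = (if even (length s) then 1 else -1) *
     (past_cdf (cf_eval s 1) \<theta> - past_cdf (cf_eval s 0) \<theta>)"
  using assms
proof (induction s arbitrary: \<theta>)
  case Nil
  then show ?case by (simp add: past_cdf_def)
next
  case (Cons a s)
  have u: "1 / (real a + \<theta>) \<in> {0..1}" using Cons.prems by (intro recip_shift_unit) auto
  have "word_prob (a # s) \<theta> = (if even (length s) then 1 else -1) *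
    (digit_prob \<theta> a * (past_cdf (cf_eval s 1) (1 / (real a + \<theta>)) - past_cdf (cf_eval s 0) (1 / (real a + \<theta>))))"
    using Cons.IH[OF _ u] Cons.prems by (simp add: word_prob_Cons)
  also have "digit_prob \<theta> a * (past_cdf (cf_eval s 1) (1 / (real a + \<theta>)) - past_cdf (cf_eval s 0) (1 / (real a + \<theta>)))
    = past_cdf (1 / (real a + cf_eval s 0)) \<theta> - past_cdf (1 / (real a + cf_eval s 1)) \<theta>"
    using Cons.prems by (intro past_cdf_step cf_eval_unit) auto
  finally show ?case by simp
qed

text \<open>\<open>past_cdf x 0\<close> is x: for \<theta> = 0 the law is Lebesgue measure and the
  probability is a length.\<close>

lemma cf_eval_diff: "\<forall>a\<in>set s. a \<ge> 1 \<Longrightarrow> \<bar>cf_eval s 1 - cf_eval s 0\<bar> = word_prob s 0"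
  using word_prob_eq[of s 0] pmf_nonneg[of "digits_pmf (length s) 0" s]
  by (auto simp: past_cdf_def word_prob_def split: if_splits)

text \<open>One unit for each of the two distribution functions. The constant is independent of the
  word and becomes the 2 in the covariance bound.\<close>

lemma word_prob_lipschitz:
  assumes "\<forall>a\<in>set s. a \<ge> 1"
  shows "2-lipschitz_on {0..1} (word_prob s)"
proof -
  have "cf_eval s 1 \<in> {0..1}" "cf_eval s 0 \<in> {0..1}" using assms cf_eval_unit[of 0 s] cf_eval_unit[of 1 s] by auto
  then have "(1 + 1)-lipschitz_on {0..1} (\<lambda>\<theta>. past_cdf (cf_eval s 1) \<theta> - past_cdf (cf_eval s 0) \<theta>)"
    "(1 + 1)-lipschitz_on {0..1} (\<lambda>\<theta>. past_cdf (cf_eval s 0) \<theta> - past_cdf (cf_eval s 1) \<theta>)"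
    using lipschitz_on_diff[OF past_cdf_lipschitz past_cdf_lipschitz] by blast+
  then show ?thesis
    using word_prob_eq[OF assms] by (auto simp: lipschitz_on_def dist_real_def)
qed

text \<open>The factor 1 + \<theta> cancels and leaves x / (1 + \<theta> x), with antiderivative ln
  (1 + \<theta> x). Averaging over a stationary past thus yields the distribution function of Gauss
  measure, up to ln 2.\<close>

lemma gauss_mean_past_cdf:
  assumes x: "x \<in> {0..1}"
  shows "((\<lambda>\<theta>. past_cdf x \<theta> / (1 + \<theta>)) has_integral ln (1 + x)) {0..1}"
proof -
  have "((\<lambda>\<theta>. x / (1 + \<theta> * x)) has_integral (ln (1 + 1 * x) - ln (1 + 0 * x))) {0..1}"
  proof (rule fundamental_theorem_of_calculus)
    fix \<theta> :: real assume "\<theta> \<in> {0..1}"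
    then have "1 + \<theta> * x > 0" using x by (auto intro: add_pos_nonneg)
    then show "((\<lambda>\<theta>. ln (1 + \<theta> * x)) has_vector_derivative x / (1 + \<theta> * x)) (at \<theta> within {0..1})"
      unfolding has_real_derivative_iff_has_vector_derivative[symmetric]
      by (auto intro!: derivative_eq_intros)
  qed simp
  then have "((\<lambda>\<theta>. x / (1 + \<theta> * x)) has_integral ln (1 + x)) {0..1}" by simp
  moreover have "x / (1 + \<theta> * x) = past_cdf x \<theta> / (1 + \<theta>)" if "\<theta> \<in> {0..1}" for \<theta>
    using that by (simp add: past_cdf_def)
  ultimately show ?thesis by (rule has_integral_eq[rotated])
qed

lemma gauss_mean_word_prob:
  assumes "\<forall>a\<in>set s. a \<ge> 1"
  shows "gauss_mean (word_prob s) = (if even (length s) then 1 else -1) *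
     (ln (1 + cf_eval s 1) - ln (1 + cf_eval s 0)) / ln 2"
proof -
  define e :: real where "e = (if even (length s) then 1 else -1)"
  have u: "cf_eval s 1 \<in> {0..1}" "cf_eval s 0 \<in> {0..1}" using assms cf_eval_unit[of 0 s] cf_eval_unit[of 1 s] by auto
  have "((\<lambda>\<theta>. e * (past_cdf (cf_eval s 1) \<theta> / (1 + \<theta>) - past_cdf (cf_eval s 0) \<theta> / (1 + \<theta>)))
      has_integral e * (ln (1 + cf_eval s 1) - ln (1 + cf_eval s 0))) {0..1}"
    by (intro has_integral_mult_right has_integral_diff gauss_mean_past_cdf u)
  moreover have "e * (past_cdf (cf_eval s 1) \<theta> / (1 + \<theta>) - past_cdf (cf_eval s 0) \<theta> / (1 + \<theta>)) = word_prob s \<theta> / (1 + \<theta>)"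
    if "\<theta> \<in> {0..1}" for \<theta>
    using word_prob_eq[OF assms that] by (simp add: e_def diff_divide_distrib)
  ultimately have "((\<lambda>\<theta>. word_prob s \<theta> / (1 + \<theta>)) has_integral e * (ln (1 + cf_eval s 1) - ln (1 + cf_eval s 0))) {0..1}"
    by (rule has_integral_eq[rotated])
  then show ?thesis by (simp add: gauss_mean_def integral_unique e_def)
qed

section \<open>Cylinders as intervals\<close>

lemma cf_digit_Suc: "i \<ge> 1 \<Longrightarrow> cf_digit x (Suc i) = cf_digit (gauss_map x) i"
proof -
  assume "i \<ge> 1"
  then obtain k where i: "i = Suc k" by (cases i) auto
  show ?thesis unfolding cf_digit_def i diff_Suc_1 funpow_Suc_right o_apply by (rule refl)
qed

lemma cylinder_Nil: "cylinder [] = {0..<1}"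
  by (auto simp: cylinder_def)

lemma gauss_map_unit: "gauss_map x \<in> {0..<1}"
  by (simp add: gauss_map_def frac_lt_1)

lemma cylinder_Cons:
  "x \<in> cylinder (a # s) \<longleftrightarrow> x \<in> {0..<1} \<and> nat \<lfloor>1 / x\<rfloor> = a \<and> gauss_map x \<in> cylinder s"
proof -
  define P where "P i \<longleftrightarrow> cf_digit x (i + 1) = (a # s) ! i" for i
  have "P 0 \<longleftrightarrow> nat \<lfloor>1 / x\<rfloor> = a" by (simp add: P_def cf_digit_def)
  moreover have "P (Suc i) \<longleftrightarrow> cf_digit (gauss_map x) (i + 1) = s ! i" for i
    using cf_digit_Suc[of "i + 1" x] by (simp add: P_def)
  moreover have "(\<forall>i<length (a # s). P i) \<longleftrightarrow> P 0 \<and> (\<forall>i<length s. P (Suc i))"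
    unfolding length_Cons by (rule All_less_Suc2)
  ultimately have "(\<forall>i<length (a # s). P i) \<longleftrightarrow>
     nat \<lfloor>1 / x\<rfloor> = a \<and> (\<forall>i<length s. cf_digit (gauss_map x) (i + 1) = s ! i)" by simp
  then show ?thesis using gauss_map_unit[of x] unfolding cylinder_def P_def by fastforce
qed

lemma gauss_map_recip:
  fixes a :: nat
  assumes "a \<ge> 1" "0 < y" "y < 1"
  shows "nat \<lfloor>1 / (1 / (real a + y))\<rfloor> = a" "gauss_map (1 / (real a + y)) = y" "1 / (real a + y) \<in> {0<..<1}"
proof -
  have "\<lfloor>a + y\<rfloor> = int a" using assms by (intro floor_unique) auto
  then show "nat \<lfloor>1 / (1 / (real a + y))\<rfloor> = a" "gauss_map (1 / (real a + y)) = y"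
    by (simp_all add: gauss_map_def frac_def)
  show "1 / (real a + y) \<in> {0<..<1}" using assms by (auto simp: divide_simps)
qed

lemma gauss_map_digit:
  assumes "nat \<lfloor>1 / x\<rfloor> = a" "a \<ge> 1"
  shows "x = 1 / (real a + gauss_map x)"
proof -
  have "\<lfloor>1 / x\<rfloor> = int a" using assms by auto
  then have "real a + gauss_map x = 1 / x" by (simp add: gauss_map_def frac_def)
  then show ?thesis by (simp only: divide_divide_eq_right mult_1 div_by_1)
qed

lemma recip_closed_segment:
  fixes a :: nat and u v y :: real
  assumes "a \<ge> 1" "u \<ge> 0" "v \<ge> 0" "y \<in> closed_segment u v"
  shows "1 / (real a + y) \<in> closed_segment (1 / (real a + u)) (1 / (real a + v))"
proof -
  have mono: "1 / (real a + q) \<le> 1 / (real a + p)" if "0 \<le> p" "p \<le> q" for p q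
    using that assms(1) by (intro divide_left_mono mult_pos_pos) auto
  consider "u \<le> y" "y \<le> v" | "v \<le> y" "y \<le> u"
    using assms(4) by (auto simp: closed_segment_eq_real_ivl split: if_splits)
  then show ?thesis
  proof cases
    case 1
    with mono[of u y] mono[of y v] assms show ?thesis by (auto simp: closed_segment_eq_real_ivl)
  next
    case 2
    with mono[of v y] mono[of y u] assms show ?thesis by (auto simp: closed_segment_eq_real_ivl)
  qed
qed

lemma recip_open_segment:
  fixes a :: nat and u v x :: real
  assumes "a \<ge> 1" "u \<ge> 0" "v \<ge> 0" "x \<in> open_segment (1 / (real a + u)) (1 / (real a + v))"
  shows "\<exists>y\<in>open_segment u v. x = 1 / (real a + y)"
proof -
  have p: "real a + u > 0" "real a + v > 0" using assms by auto
  have x0: "x > 0"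
  proof -
    have "1 / (real a + u) > 0" "1 / (real a + v) > 0" using p by simp_all
    moreover have "1 / (real a + u) < x \<or> 1 / (real a + v) < x"
      using assms(4) unfolding open_segment_eq_real_ivl by (simp split: if_splits)
    ultimately show ?thesis by linarith
  qed
  have lt: "1 / (real a + p) < x \<longleftrightarrow> 1 / x - a < p" "x < 1 / (real a + p) \<longleftrightarrow> p < 1 / x - a"
    if "real a + p > 0" for p
  proof -
    have "1 / x - a < p \<longleftrightarrow> 1 / x < real a + p" "p < 1 / x - a \<longleftrightarrow> real a + p < 1 / x" by auto
    then show "1 / (real a + p) < x \<longleftrightarrow> 1 / x - a < p" "x < 1 / (real a + p) \<longleftrightarrow> p < 1 / x - a"
      using x0 that by (simp_all add: pos_divide_less_eq pos_less_divide_eq mult.commute)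
  qed
  have "1 / x - a \<in> open_segment u v"
    using assms(4) lt[OF p(1)] lt[OF p(2)] by (auto simp: open_segment_eq_real_ivl split: if_splits)
  then show ?thesis by (intro bexI[of _ "1 / x - a"]) auto
qed

lemma cylinder_subset_segment:
  assumes "\<forall>a\<in>set s. a \<ge> 1" "x \<in> cylinder s"
  shows "x \<in> closed_segment (cf_eval s 0) (cf_eval s 1)"
  using assms
proof (induction s arbitrary: x)
  case Nil
  then show ?case by (auto simp: cylinder_Nil closed_segment_eq_real_ivl)
next
  case (Cons a s)
  have "gauss_map x \<in> closed_segment (cf_eval s 0) (cf_eval s 1)" using Cons by (simp add: cylinder_Cons)
  moreover have "cf_eval s 0 \<in> {0..1}" "cf_eval s 1 \<in> {0..1}" using Cons.prems cf_eval_unit[of 0 s] cf_eval_unit[of 1 s] by auto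
  ultimately have "1 / (real a + gauss_map x) \<in> closed_segment (cf_eval (a # s) 0) (cf_eval (a # s) 1)"
    using Cons.prems by (simp add: recip_closed_segment)
  moreover have "x = 1 / (real a + gauss_map x)" using Cons.prems by (intro gauss_map_digit) (auto simp: cylinder_Cons)
  ultimately show ?case by (rule ssubst[rotated])
qed

text \<open>The segment is open because an end point is rational and its digits need not begin with
  \<open>s\<close>: for the word [1] the end points are 1 and 1/2. Openness keeps every remainder
  strictly between 0 and 1.\<close>

lemma segment_subset_cylinder:
  assumes "\<forall>a\<in>set s. a \<ge> 1" "x \<in> open_segment (cf_eval s 0) (cf_eval s 1)"
  shows "x \<in> cylinder s"
  using assms
proof (induction s arbitrary: x)
  case Nil
  then show ?case by (auto simp: cylinder_Nil open_segment_eq_real_ivl)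
next
  case (Cons a s)
  have u: "cf_eval s 0 \<in> {0..1}" "cf_eval s 1 \<in> {0..1}" using Cons.prems cf_eval_unit[of 0 s] cf_eval_unit[of 1 s] by auto
  obtain y where y: "y \<in> open_segment (cf_eval s 0) (cf_eval s 1)" "x = 1 / (real a + y)"
    using recip_open_segment[of a "cf_eval s 0" "cf_eval s 1" x] Cons.prems u by auto
  have "0 < y" "y < 1" using y(1) u by (auto simp: open_segment_eq_real_ivl split: if_splits)
  from gauss_map_recip[OF _ this, of a] show ?case
    using Cons.IH[OF _ y(1)] Cons.prems y(2) by (auto simp: cylinder_Cons)
qed

text \<open>The inclusions between open segment, cylinder and closed segment leave only two points
  undecided. These are a null set, and the cylinder is Borel as an open interval plus finitely many
  points.\<close>

lemma gauss_measure_cylinder: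
  assumes s: "\<forall>a\<in>set s. a \<ge> 1"
  shows "gauss_measure (cylinder s) = gauss_mean (word_prob s)"
proof -
  define u where "u = min (cf_eval s 0) (cf_eval s 1)"
  define v where "v = max (cf_eval s 0) (cf_eval s 1)"
  have unit: "cf_eval s 0 \<in> {0..1}" "cf_eval s 1 \<in> {0..1}" using s cf_eval_unit[of 0 s] cf_eval_unit[of 1 s] by auto
  then have uv: "0 \<le> u" "u \<le> v" "v \<le> 1" by (auto simp: u_def v_def)
  have seg: "closed_segment (cf_eval s 0) (cf_eval s 1) = {u..v}" "open_segment (cf_eval s 0) (cf_eval s 1) = {u<..<v}"
    unfolding u_def v_def closed_segment_eq_real_ivl open_segment_eq_real_ivl by (auto simp: min_def max_def)
  have sub: "cylinder s \<subseteq> {u..v}" "{u<..<v} \<subseteq> cylinder s"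
    using cylinder_subset_segment[OF s] segment_subset_cylinder[OF s] unfolding seg subset_iff by auto
  have ends: "x \<in> {u<..<v}" if "x \<in> {u..v}" "x \<noteq> u" "x \<noteq> v" for x using that by simp
  have ae: "AE x in lborel. (x \<in> cylinder s) = (x \<in> {u..v})"
    using AE_lborel_singleton[of u] AE_lborel_singleton[of v]
  proof eventually_elim
    case (elim x)
    then show ?case using subsetD[OF sub(1), of x] subsetD[OF sub(2), of x] ends[of x] by argo
  qed
  have mc: "cylinder s \<in> sets borel"
  proof -
    have "x \<in> {u, v}" if "x \<in> cylinder s - {u<..<v}" for x
      using subsetD[OF sub(1), of x] ends[of x] that by auto
    then have "cylinder s - {u<..<v} \<subseteq> {u, v}" by (rule subsetI)
    then have "finite (cylinder s - {u<..<v})" by (rule finite_subset) auto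
    then have "cylinder s - {u<..<v} \<in> sets borel" by (intro borel_closed finite_imp_closed)
    then have "{u<..<v} \<union> (cylinder s - {u<..<v}) \<in> sets borel" by (intro sets.Un) auto
    moreover have "{u<..<v} \<union> (cylinder s - {u<..<v}) = cylinder s" using sub(2) by blast
    ultimately show ?thesis by simp
  qed
  have m: "set_borel_measurable lborel A (\<lambda>x. 1 / (1 + x) :: real)" if "A \<in> sets borel" for A
    unfolding set_borel_measurable_def using that
    by (intro borel_measurable_scaleR borel_measurable_indicator borel_measurable_divide borel_measurable_add) auto
  have "(LINT x:cylinder s|lborel. 1 / (1 + x)) = (LINT x:{u..v}|lborel. 1 / (1 + x))"
    by (rule set_integral_cong_set[symmetric, OF m[OF mc] m ae]) auto
  also have "\<dots> = integral {u..v} (\<lambda>x. 1 / (1 + x))"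
  proof (rule set_borel_integral_eq_integral)
    have "continuous_on {u..v} (\<lambda>x. 1 / (1 + x))" using uv by (intro continuous_intros) auto
    then show "set_integrable lborel {u..v} (\<lambda>x. 1 / (1 + x))" by (rule borel_integrable_atLeastAtMost')
  qed
  also have "\<dots> = ln (1 + v) - ln (1 + u)"
    using integral_recip_one_plus[OF uv(1,2)] by (rule integral_unique)
  finally have g: "gauss_measure (cylinder s) = (ln (1 + v) - ln (1 + u)) / ln 2"
    by (simp add: gauss_measure_def)
  \<comment> \<open>At \<theta> = 0 the distribution function is the identity, so nonnegativity of
    the word probability tells which end point is larger.\<close>
  have sgn: "(if even (length s) then cf_eval s 0 \<le> cf_eval s 1 else cf_eval s 1 \<le> cf_eval s 0)"
    using word_prob_eq[OF s, of 0] pmf_nonneg[of "digits_pmf (length s) 0" s]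
    by (auto simp: past_cdf_def word_prob_def split: if_splits)
  show ?thesis
  proof (cases "even (length s)")
    case True
    then have "u = cf_eval s 0" "v = cf_eval s 1" using sgn by (auto simp: u_def v_def)
    with True show ?thesis unfolding g gauss_mean_word_prob[OF s] by simp
  next
    case False
    then have "u = cf_eval s 1" "v = cf_eval s 0" using sgn by (auto simp: u_def v_def)
    with False show ?thesis unfolding g gauss_mean_word_prob[OF s] by simp
  qed
qed

section \<open>Variance of word counts\<close>

definition hit :: "nat list \<Rightarrow> nat \<Rightarrow> nat list \<Rightarrow> bool" where
  "hit s i l \<longleftrightarrow> take (length s) (drop i l) = s"

text \<open>Only the start is required to lie below k; an occurrence may run on within
  \<open>l\<close>, but never past its end, where \<open>take\<close> comes out too short to equal
  \<open>s\<close>.\<close>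

definition hits :: "nat list \<Rightarrow> nat \<Rightarrow> nat list \<Rightarrow> real" where
  "hits s k l = (\<Sum>i<k. of_bool (hit s i l))"

lemma hit_append_left: "i + length s \<le> length t \<Longrightarrow> hit s i (t @ t') = hit s i t"
  by (simp add: hit_def)

lemma hit_append_right: "hit s (length t + i) (t @ t') = hit s i t'"
  by (simp add: hit_def)

lemma hit_length: "hit s i l \<Longrightarrow> i + length s \<le> length l \<or> s = []"
proof -
  assume "hit s i l"
  then have "length (take (length s) (drop i l)) = length s" unfolding hit_def by simp
  then have "length s \<le> length l - i" by simp
  moreover have "length s = 0 \<longleftrightarrow> s = []" by simp
  ultimately show ?thesis by linarith
qed

lemma hits_mono: "k \<le> k' \<Longrightarrow> hits s k l \<le> hits s k' l"
  unfolding hits_def by (intro sum_mono2) auto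

lemma hits_add_le: "hits s (k + d) l \<le> hits s k l + d"
  by (induction d) (auto simp: hits_def)

lemma word_prob_bounds: "0 \<le> word_prob s \<theta>" "word_prob s \<theta> \<le> 1"
  by (simp_all add: word_prob_def pmf_le_1)

lemma gauss_mean_word_prob_bounds:
  assumes "\<forall>a\<in>set s. a \<ge> 1"
  shows "0 \<le> gauss_mean (word_prob s)" "gauss_mean (word_prob s) \<le> 1"
proof -
  have "\<bar>gauss_mean (word_prob s) - 1/2\<bar> \<le> 1/2"
  proof (rule gauss_mean_bound)
    show "continuous_on {0..1} (word_prob s)"
      using word_prob_lipschitz[OF assms] by (rule lipschitz_on_continuous_on)
    show "\<bar>word_prob s \<theta> - 1/2\<bar> \<le> 1/2" for \<theta>
      using word_prob_bounds[of s \<theta>] by linarith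
  qed
  then show "0 \<le> gauss_mean (word_prob s)" "gauss_mean (word_prob s) \<le> 1" by linarith+
qed

text \<open>Given the first m digits, the conditional probability is \<open>word_prob s\<close> at
  the current past; averaging over these digits applies the operator m times.\<close>

lemma expectation_hit:
  assumes s: "\<forall>a\<in>set s. a \<ge> 1" and t: "\<theta> \<in> {0..1}" and n: "m + length s \<le> n"
  shows "measure_pmf.expectation (digits_pmf n \<theta>) (\<lambda>l. of_bool (hit s m l)) = (digit_op ^^ m) (word_prob s) \<theta>"
proof -
  obtain r where n': "n = m + r" and r: "length s \<le> r" using n by (metis add_le_cancel_left le_Suc_ex le_add1 le_trans)
  have base: "measure_pmf.expectation (digits_pmf r \<phi>) (\<lambda>l. of_bool (hit s 0 l)) = word_prob s \<phi>" if "\<phi> \<in> {0..1}" for \<phi>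
  proof -
    have "measure_pmf.expectation (digits_pmf r \<phi>) (\<lambda>l. of_bool (hit s 0 l) :: real)
      = measure_pmf.expectation (digits_pmf r \<phi>) (\<lambda>l. indicator {s} (take (length s) l))"
      by (rule Bochner_Integration.integral_cong) (auto simp: hit_def indicator_def)
    also have "\<dots> = measure_pmf.expectation (digits_pmf (length s) \<phi>) (indicator {s})"
      by (rule expectation_digits_take[where B=1]) (use r that in \<open>auto simp: indicator_def\<close>)
    also have "\<dots> = word_prob s \<phi>" by (simp add: word_prob_def measure_pmf_single)
    finally show ?thesis .
  qed
  have "measure_pmf.expectation (digits_pmf n \<theta>) (\<lambda>l. of_bool (hit s m l) :: real)
    = measure_pmf.expectation (digits_pmf m \<theta>)
        (\<lambda>t. measure_pmf.expectation (digits_pmf r (past \<theta> t)) (\<lambda>t'. of_bool (hit s m (t @ t'))))"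
    unfolding n' by (rule expectation_digits_add[where B=1]) auto
  also have "\<dots> = measure_pmf.expectation (digits_pmf m \<theta>) (\<lambda>t. word_prob s (past \<theta> t))"
  proof (intro integral_cong_AE)
    have "measure_pmf.expectation (digits_pmf r (past \<theta> u)) (\<lambda>t'. of_bool (hit s m (u @ t'))) = word_prob s (past \<theta> u)"
      if u: "u \<in> set_pmf (digits_pmf m \<theta>)" for u
    proof -
      have "length u = m" "\<forall>a\<in>set u. a \<ge> 1" using set_digits_pmf[OF t u] by auto
      then have "past \<theta> u \<in> {0..1}" "\<And>t'. hit s m (u @ t') = hit s 0 t'"
        using past_unit[OF t] hit_append_right[of s u 0] by auto
      then show ?thesis using base by simp
    qed
    then show "AE u in measure_pmf (digits_pmf m \<theta>).
      measure_pmf.expectation (digits_pmf r (past \<theta> u)) (\<lambda>t'. of_bool (hit s m (u @ t'))) = word_prob s (past \<theta> u)"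
      by (simp add: AE_measure_pmf_iff)
  qed auto
  also have "\<dots> = (digit_op ^^ m) (word_prob s) \<theta>"
    by (rule expectation_past[OF word_prob_lipschitz[OF s] t])
  finally show ?thesis .
qed

text \<open>Centring is by the stationary mean \<open>c\<close>, not by the actual means.
  Conditionally on the first i + length s digits the second factor has mean at most 2 (7/8)^m, where
  m = j - i - length s is the gap. The factor (8/7)^(length s) turns the gap into j - i and also
  makes the bound trivial for overlapping windows.\<close>

lemma hit_covariance:
  fixes s
  defines "c \<equiv> gauss_mean (word_prob s)"
  assumes s: "\<forall>a\<in>set s. a \<ge> 1" and ij: "i < j" and n: "j + length s \<le> n"
  shows "\<bar>measure_pmf.expectation (digits_pmf n 0) (\<lambda>l. (of_bool (hit s i l) - c) * (of_bool (hit s j l) - c))\<bar>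
    \<le> 2 * (8/7) ^ length s * (7/8) ^ (j - i)"
proof -
  have c: "0 \<le> c" "c \<le> 1" unfolding c_def by (rule gauss_mean_word_prob_bounds[OF s])+
  have b1: "\<bar>of_bool P - c\<bar> \<le> 1" for P :: bool using c by (cases P) auto
  have b2: "\<bar>(of_bool P - c) * (of_bool Q - c)\<bar> \<le> 1" for P Q :: bool
  proof -
    have "\<bar>of_bool P - c\<bar> * \<bar>of_bool Q - c\<bar> \<le> 1 * 1" by (intro mult_mono b1) auto
    then show ?thesis by (simp only: abs_mult mult_1)
  qed
  show ?thesis
  proof (cases "i + length s \<le> j")
    case False
    have "(7/8 :: real) ^ length s \<le> (7/8) ^ (j - i)" using False by (intro power_decreasing) auto
    then have "1 \<le> (8/7) ^ length s * (7/8 :: real) ^ (j - i)"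
      using mult_left_mono[of "(7/8 :: real) ^ length s" "(7/8) ^ (j - i)" "(8/7) ^ length s"]
      by (simp flip: power_mult_distrib)
    moreover have "\<bar>measure_pmf.expectation (digits_pmf n 0) (\<lambda>l. (of_bool (hit s i l) - c) * (of_bool (hit s j l) - c))\<bar> \<le> 1"
      by (rule abs_expectation_pmf_le) (rule b2)
    ultimately show ?thesis by simp
  next
    case True
    define m where "m = j - (i + length s)"
    define r where "r = n - j"
    have j: "j = i + length s + m" and n': "n = (i + length s) + (m + r)" and r: "length s \<le> r"
      using True n by (auto simp: m_def r_def)
    have inner: "\<bar>measure_pmf.expectation (digits_pmf (m + r) (past 0 u))
         (\<lambda>t'. (of_bool (hit s i (u @ t')) - c) * (of_bool (hit s j (u @ t')) - c))\<bar> \<le> (7/8) ^ m * 2"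
      if u: "u \<in> set_pmf (digits_pmf (i + length s) 0)" for u
    proof -
      have u': "length u = i + length s" "\<forall>a\<in>set u. a \<ge> 1" using set_digits_pmf[OF _ u] by auto
      have p: "past 0 u \<in> {0..1}" using u' by (intro past_unit) auto
      have h: "hit s i (u @ t') = hit s i u" "hit s j (u @ t') = hit s m t'" for t'
        using hit_append_left[of i s u t'] hit_append_right[of s u m t'] u' by (auto simp: j)
      have "measure_pmf.expectation (digits_pmf (m + r) (past 0 u)) (\<lambda>t'. (of_bool (hit s i (u @ t')) - c) * (of_bool (hit s j (u @ t')) - c))
        = (of_bool (hit s i u) - c) * (measure_pmf.expectation (digits_pmf (m + r) (past 0 u)) (\<lambda>t'. of_bool (hit s m t')) - c)"
        unfolding h using integrable_pmf_bounded[of "digits_pmf (m + r) (past 0 u)" "\<lambda>t'. of_bool (hit s m t')" 1] by simp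
      also have "\<dots> = (of_bool (hit s i u) - c) * ((digit_op ^^ m) (word_prob s) (past 0 u) - c)"
        using r by (subst expectation_hit[OF s p]) auto
      also have "\<bar>\<dots>\<bar> \<le> 1 * ((7/8) ^ m * 2)"
        unfolding abs_mult c_def[symmetric]
      proof (intro mult_mono b1)
        show "\<bar>(digit_op ^^ m) (word_prob s) (past 0 u) - c\<bar> \<le> (7/8) ^ m * 2"
          unfolding c_def by (rule digit_op_funpow_converges[OF word_prob_lipschitz[OF s] p])
      qed auto
      finally show ?thesis by simp
    qed
    have "\<bar>measure_pmf.expectation (digits_pmf n 0) (\<lambda>l. (of_bool (hit s i l) - c) * (of_bool (hit s j l) - c))\<bar> \<le> (7/8) ^ m * 2"
      unfolding n' by (subst expectation_digits_add[where B=1, OF b2]) (rule abs_expectation_pmf_le, rule inner)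
    also have "(7/8 :: real) ^ m = (8/7) ^ length s * (7/8) ^ (j - i)"
    proof -
      have "(7/8 :: real) ^ (j - i) = (7/8) ^ length s * (7/8) ^ m" by (simp add: j power_add)
      then show ?thesis by (simp flip: power_mult_distrib mult.assoc)
    qed
    finally show ?thesis by simp
  qed
qed

lemma sum_geometric_78: "(\<Sum>i<k. (7/8 :: real) ^ (k - i)) \<le> 7"
proof (induction k)
  case (Suc k)
  have "(\<Sum>i<Suc k. (7/8 :: real) ^ (Suc k - i)) = (\<Sum>i<k. (7/8) * (7/8) ^ (k - i)) + 7/8"
    by (simp add: Suc_diff_le)
  also have "\<dots> = 7/8 * ((\<Sum>i<k. (7/8) ^ (k - i)) + 1)" by (simp add: sum_distrib_left algebra_simps)
  also have "\<dots> \<le> 7" using Suc by simp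
  finally show ?case .
qed simp

text \<open>A new position adds twice its covariances with the earlier ones and a square of at most
  1; with the geometric sum bounded by 7 this is 2 * 2 * 7 = 28 times (8/7)^(length s), plus
  1.\<close>

lemma hits_variance:
  fixes s
  defines "c \<equiv> gauss_mean (word_prob s)"
  assumes s: "\<forall>a\<in>set s. a \<ge> 1" and n: "k + length s \<le> n"
  shows "measure_pmf.expectation (digits_pmf n 0) (\<lambda>l. (hits s k l - k * c)\<^sup>2) \<le> (28 * (8/7) ^ length s + 1) * k"
  using n
proof (induction k)
  case (Suc k)
  have c: "0 \<le> c" "c \<le> 1" unfolding c_def by (rule gauss_mean_word_prob_bounds[OF s])+
  define Z where "Z i l = of_bool (hit s i l) - c" for i l
  define Y where "Y k l = hits s k l - k * c" for k l
  let ?E = "measure_pmf.expectation (digits_pmf n 0)"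
  have Zb: "\<bar>Z i l\<bar> \<le> 1" for i l using c by (cases "hit s i l") (auto simp: Z_def)
  have Y: "Y k l = (\<Sum>i<k. Z i l)" for k l by (simp add: Y_def Z_def hits_def sum_subtractf)
  have Yb: "\<bar>Y k l\<bar> \<le> k" for k l
    unfolding Y using sum_mono[of "{..<k}" "\<lambda>i. \<bar>Z i l\<bar>" "\<lambda>i. 1"] Zb by (intro order.trans[OF sum_abs]) auto
  have i1: "integrable (measure_pmf (digits_pmf n 0)) (\<lambda>l. (Y k l)\<^sup>2)"
  proof (rule integrable_pmf_bounded)
    show "\<bar>(Y k l)\<^sup>2\<bar> \<le> (real k)\<^sup>2" for l using power_mono[OF Yb[of k l] abs_ge_zero, of 2] by simp
  qed
  have ZZ: "\<bar>Z i l * Z j l\<bar> \<le> 1" for i j l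
  proof -
    have "\<bar>Z i l\<bar> * \<bar>Z j l\<bar> \<le> 1 * 1" by (intro mult_mono Zb) auto
    then show ?thesis by (simp only: abs_mult mult_1)
  qed
  have i2: "integrable (measure_pmf (digits_pmf n 0)) (\<lambda>l. Z i l * Z j l)" for i j
    by (rule integrable_pmf_bounded[OF ZZ])
  have eq: "(Y (Suc k) l)\<^sup>2 = (Y k l)\<^sup>2 + (2 * (\<Sum>i<k. Z i l * Z k l) + Z k l * Z k l)" for l
    unfolding sum_distrib_right[symmetric] Y by (simp add: power2_eq_square algebra_simps)
  have "?E (\<lambda>l. (Y (Suc k) l)\<^sup>2) = ?E (\<lambda>l. (Y k l)\<^sup>2) + (2 * (\<Sum>i<k. ?E (\<lambda>l. Z i l * Z k l)) + ?E (\<lambda>l. Z k l * Z k l))"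
    unfolding eq using i1 i2 by simp
  also have "(\<Sum>i<k. ?E (\<lambda>l. Z i l * Z k l)) \<le> (\<Sum>i<k. 2 * (8/7) ^ length s * (7/8) ^ (k - i))"
  proof (intro sum_mono)
    fix i assume "i \<in> {..<k}"
    then have "\<bar>?E (\<lambda>l. Z i l * Z k l)\<bar> \<le> 2 * (8/7) ^ length s * (7/8) ^ (k - i)"
      using hit_covariance[OF s, of i k n] Suc.prems unfolding Z_def c_def by simp
    then show "?E (\<lambda>l. Z i l * Z k l) \<le> 2 * (8/7) ^ length s * (7/8) ^ (k - i)" by linarith
  qed
  also have "\<dots> = 2 * (8/7) ^ length s * (\<Sum>i<k. (7/8) ^ (k - i))" by (rule sum_distrib_left[symmetric])
  also have "\<dots> \<le> 2 * (8/7) ^ length s * 7" by (intro mult_left_mono sum_geometric_78) auto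
  also have "?E (\<lambda>l. Z k l * Z k l) \<le> 1"
    using abs_expectation_pmf_le[of "digits_pmf n 0" "\<lambda>l. Z k l * Z k l" 1, OF ZZ] by linarith
  also have "?E (\<lambda>l. (Y k l)\<^sup>2) \<le> (28 * (8/7) ^ length s + 1) * k" using Suc unfolding Y_def by simp
  finally show ?case unfolding Y_def by (simp add: algebra_simps)
qed (simp add: hits_def)

lemma hits_deviation:
  fixes s
  defines "c \<equiv> gauss_mean (word_prob s)"
  assumes s: "\<forall>a\<in>set s. a \<ge> 1" and n: "k + length s \<le> n" and d: "\<delta> > 0" and k: "k \<ge> 1"
  shows "measure_pmf.prob (digits_pmf n 0) {l. \<bar>hits s k l - k * c\<bar> > \<delta> * k} \<le> (28 * (8/7) ^ length s + 1) / (\<delta>\<^sup>2 * k)"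
proof -
  have c: "0 \<le> c" "c \<le> 1" unfolding c_def by (rule gauss_mean_word_prob_bounds[OF s])+
  let ?p = "digits_pmf n 0"
  have hb: "0 \<le> hits s k l" "hits s k l \<le> k" for l
    using sum_mono[of "{..<k}" "\<lambda>i. of_bool (hit s i l)" "\<lambda>i. 1 :: real"]
    unfolding hits_def by (auto intro: sum_nonneg)
  have kc: "0 \<le> k * c" "k * c \<le> k" using c by (auto simp: mult_left_le)
  have b: "\<bar>hits s k l - k * c\<bar> \<le> k" for l using hb[of l] kc by linarith
  have int: "integrable (measure_pmf ?p) (\<lambda>l. (hits s k l - k * c)\<^sup>2)"
  proof (rule integrable_pmf_bounded)
    show "\<bar>(hits s k l - k * c)\<^sup>2\<bar> \<le> (real k)\<^sup>2" for l using power_mono[OF b[of l] abs_ge_zero, of 2] by simp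
  qed
  have dk: "0 < (\<delta> * k)\<^sup>2" using d k by simp
  have "measure_pmf.prob ?p {l. \<bar>hits s k l - k * c\<bar> > \<delta> * k} \<le> measure_pmf.prob ?p {l \<in> space (measure_pmf ?p). (\<delta> * k)\<^sup>2 \<le> (hits s k l - k * c)\<^sup>2}"
  proof (intro measure_pmf.finite_measure_mono)
    show "{l. \<bar>hits s k l - k * c\<bar> > \<delta> * k} \<subseteq> {l \<in> space (measure_pmf ?p). (\<delta> * k)\<^sup>2 \<le> (hits s k l - k * c)\<^sup>2}"
      using d by (auto simp: abs_le_square_iff[symmetric])
  qed auto
  also have "\<dots> \<le> measure_pmf.expectation ?p (\<lambda>l. (hits s k l - k * c)\<^sup>2) / (\<delta> * k)\<^sup>2"
    by (rule integral_Markov_inequality_measure[OF int _ _ dk, of UNIV]) auto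
  also have "\<dots> \<le> ((28 * (8/7) ^ length s + 1) * k) / (\<delta> * k)\<^sup>2"
    using hits_variance[OF s n] dk unfolding c_def by (intro divide_right_mono) auto
  also have "\<dots> = (28 * (8/7) ^ length s + 1) / (\<delta>\<^sup>2 * k)"
    using k by (simp add: power2_eq_square power_mult_distrib)
  finally show ?thesis .
qed

section \<open>Counting words by denominator\<close>

fun den_step :: "nat \<times> nat \<Rightarrow> nat \<Rightarrow> nat \<times> nat" where
  "den_step (x, y) a = (y, a * y + x)"

text \<open>\<open>cf_dens t = (q', q)\<close> where \<open>q\<close> is the denominator of the continued fraction with digits \<open>t\<close>
  and \<open>q'\<close> that of its predecessor.\<close>

definition cf_dens :: "nat list \<Rightarrow> nat \<times> nat" where
  "cf_dens t = foldl den_step (0, 1) t"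

definition cf_den :: "nat list \<Rightarrow> nat" where
  "cf_den t = snd (cf_dens t)"

definition cf_den' :: "nat list \<Rightarrow> nat" where
  "cf_den' t = fst (cf_dens t)"

lemma cf_den_Nil [simp]: "cf_den [] = 1" "cf_den' [] = 0"
  by (simp_all add: cf_den_def cf_den'_def cf_dens_def)

lemma cf_den_snoc [simp]: "cf_den (t @ [a]) = a * cf_den t + cf_den' t" "cf_den' (t @ [a]) = cf_den t"
  by (simp_all add: cf_den_def cf_den'_def cf_dens_def split: prod.splits)
     (metis den_step.simps prod.collapse fst_conv snd_conv)+

abbreviation pos_digits :: "nat list \<Rightarrow> bool" where
  "pos_digits t \<equiv> \<forall>a\<in>set t. a \<ge> 1"

text \<open>With A = a y + x the next digit has probability y (y + x) / (A (A + y)), so the product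
  along the word telescopes. An arbitrary start pair is carried for the induction.\<close>

lemma word_prob_foldl:
  assumes "pos_digits t" "y > 0"
  shows "word_prob t (real x / real y) = real (y * (y + x)) /
    real (snd (foldl den_step (x, y) t) * (snd (foldl den_step (x, y) t) + fst (foldl den_step (x, y) t)))"
  using assms
proof (induction t arbitrary: x y)
  case (Cons a t)
  have a: "a \<ge> 1" "a * y + x > 0" using Cons.prems by auto
  define A where "A = real (a * y + x)"
  have A: "A > 0" using a(2) unfolding A_def of_nat_0_less_iff .
  have y: "real y > 0" using Cons.prems by simp
  have e: "real a + real x / real y = A / real y" using y by (simp add: A_def field_simps)
  have e': "real a + 1 + real x / real y = (A + y) / real y" using y by (simp add: A_def field_simps)
  have e'': "1 + real x / real y = (real y + x) / real y" using y by (simp add: field_simps)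
  have "word_prob (a # t) (real x / real y) = digit_prob (real x / real y) a * word_prob t (real y / real (a * y + x))"
    by (subst word_prob_Cons) (simp_all add: e A_def)
  also have "digit_prob (real x / real y) a = real (y * (y + x)) / (A * (A + y))"
  proof -
    have "A + real y > 0" using A y by linarith
    then show ?thesis using a(1) y A unfolding digit_prob_def e e' e'' by (simp add: divide_simps)
  qed
  also have "word_prob t (real y / real (a * y + x)) = (A * (A + y)) /
    real (snd (foldl den_step (y, a * y + x) t) * (snd (foldl den_step (y, a * y + x) t) + fst (foldl den_step (y, a * y + x) t)))"
    using Cons.IH[of "a * y + x" y] Cons.prems a unfolding A_def by simp
  finally show ?case using A y by simp
qed simp

lemma word_prob_0: "pos_digits t \<Longrightarrow> word_prob t 0 = 1 / (real (cf_den t) * (real (cf_den t) + real (cf_den' t)))"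
  using word_prob_foldl[of t 1 0] by (simp add: cf_den_def cf_den'_def cf_dens_def)

text \<open>q (q + q') is the reciprocal of the cylinder length and at least doubles with each
  digit, which makes lengths logarithmic in the denominator. The bound by the product of the digits
  serves to count words with few digits.\<close>

lemma cf_den_props:
  assumes "pos_digits t"
  shows "cf_den t \<ge> 1 \<and> cf_den' t \<le> cf_den t \<and> prod_list t \<le> cf_den t
    \<and> 2 ^ length t \<le> cf_den t * (cf_den t + cf_den' t)"
  using assms
proof (induction t rule: rev_induct)
  case (snoc a t)
  define q where "q = cf_den t"
  define q' where "q' = cf_den' t"
  have IH: "q \<ge> 1" "q' \<le> q" "prod_list t \<le> q" "2 ^ length t \<le> q * (q + q')"
    using snoc by (auto simp: q_def q'_def)
  have a: "a \<ge> 1" using snoc.prems by simp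
  have aq: "q \<le> a * q" using a by simp
  have "2 ^ Suc (length t) \<le> 2 * (q * (q + q'))" using IH(4) by simp
  also have "\<dots> \<le> (q + q') * (2 * q + q')" by (simp add: algebra_simps)
  also have "\<dots> \<le> (a * q + q') * (a * q + q' + q)" using aq by (intro mult_mono) auto
  finally have "2 ^ Suc (length t) \<le> (a * q + q') * (a * q + q' + q)" .
  moreover have "prod_list t * a \<le> a * q + q'"
    using mult_right_mono[OF IH(3), of a] by (metis mult.commute trans_le_add1 zero_le)
  moreover have "1 \<le> a * q + q'" "q \<le> a * q + q'" using IH aq by linarith+
  ultimately show ?case by (simp add: q_def[symmetric] q'_def[symmetric])
qed simp

lemma cf_den_append_le: "pos_digits (t @ u) \<Longrightarrow> cf_den t \<le> cf_den (t @ u)"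
proof (induction u rule: rev_induct)
  case (snoc a u)
  have "cf_den (t @ u) \<le> a * cf_den (t @ u)" using snoc.prems by simp
  then have "cf_den (t @ u) \<le> cf_den ((t @ u) @ [a])" by (simp only: cf_den_snoc)
  then show ?case using snoc by simp
qed simp

lemma prod_list_pos: "pos_digits t \<Longrightarrow> prod_list t \<ge> 1"
  by (induction t) auto

lemma digit_le_prod_list: "pos_digits t \<Longrightarrow> a \<in> set t \<Longrightarrow> a \<le> prod_list t"
proof (induction t)
  case (Cons b t)
  have "prod_list t \<ge> 1" using Cons.prems by (intro prod_list_pos) auto
  then show ?case using Cons by (auto intro: order.trans[OF Cons.IH])
qed simp

lemma cf_den_length:
  assumes "pos_digits t" "cf_den t \<le> m"
  shows "2 ^ length t \<le> 2 * m\<^sup>2"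
proof -
  have "2 ^ length t \<le> cf_den t * (cf_den t + cf_den' t)" using cf_den_props[OF assms(1)] by simp
  also have "\<dots> \<le> m * (m + m)" using assms cf_den_props[OF assms(1)] by (intro mult_mono) auto
  also have "\<dots> = 2 * m\<^sup>2" by (simp add: power2_eq_square distrib_left)
  finally show ?thesis .
qed

lemma finite_words_den: "finite {t. pos_digits t \<and> cf_den t \<le> m}"
proof (rule finite_subset)
  show "{t. pos_digits t \<and> cf_den t \<le> m} \<subseteq> {t. set t \<subseteq> {..m} \<and> length t \<le> 2 * m\<^sup>2}"
  proof clarify
    fix t assume t: "pos_digits t" "cf_den t \<le> m"
    have "a \<le> m" if "a \<in> set t" for a
      using digit_le_prod_list[OF t(1) that] cf_den_props[OF t(1)] t(2) by linarith
    moreover have "length t < 2 ^ length t" by (rule less_exp)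
    then have "length t \<le> 2 * m\<^sup>2" using cf_den_length[OF t] by linarith
    ultimately show "set t \<subseteq> {..m} \<and> length t \<le> 2 * m\<^sup>2" by auto
  qed
  show "finite {t. set t \<subseteq> {..m} \<and> length t \<le> 2 * m\<^sup>2}" by (rule finite_lists_length_le) simp
qed

section \<open>Short words are rare\<close>

lemma sum_three_halves: "N \<ge> 1 \<Longrightarrow> (\<Sum>a=1..N. 1 / (real a * sqrt a)) \<le> 3 - 2 / sqrt N"
proof (induction N rule: nat_induct_at_least)
  case (Suc N)
  define p q where "p = sqrt N" and "q = sqrt (Suc N)"
  have p: "p > 0" "p \<le> q" "q > 0" using Suc by (auto simp: p_def q_def)
  have qq: "q * q = p * p + 1" "q * q = Suc N" by (auto simp: p_def q_def)
  have "(q - p) * (q + p) = 1" using qq by (simp add: algebra_simps)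
  then have qp: "q - p = 1 / (q + p)" using p by (simp add: field_simps)
  have "1 / (q * q * q) = 2 / (q * q * (q + q))" using p by simp
  also have "\<dots> \<le> 2 / (p * q * (q + p))" using p by (intro divide_left_mono mult_mono mult_pos_pos) auto
  also have "\<dots> = 2 * (q - p) / (p * q)" unfolding qp by simp
  also have "\<dots> = 2 / p - 2 / q" using p by (simp add: field_simps)
  finally have "1 / (real (Suc N) * sqrt (Suc N)) \<le> 2 / sqrt N - 2 / sqrt (Suc N)"
    using qq(2) by (simp add: p_def q_def)
  then show ?case using Suc.IH by simp
qed simp

text \<open>Removing the first digit a leaves a word of product at most y / a, hence the real bound
  \<open>y\<close>. The exponent 3/2 is chosen between 1 and 2: above 1 the sum of a^(-3/2)
  converges, here with bound 3 per digit, and below 2 the count stays far under m^2.\<close>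

lemma card_words_prod:
  fixes y :: real
  assumes "y \<ge> 0"
  shows "finite {t. length t = k \<and> pos_digits t \<and> real (prod_list t) \<le> y} \<and>
    real (card {t. length t = k \<and> pos_digits t \<and> real (prod_list t) \<le> y}) \<le> 3 ^ k * (y * sqrt y)"
  using assms
proof (induction k arbitrary: y)
  case 0
  have eq: "{t. length t = 0 \<and> pos_digits t \<and> real (prod_list t) \<le> y} = (if y \<ge> 1 then {[]} else {})" by auto
  show ?case
  proof (cases "y \<ge> 1")
    case True
    then have "1 * 1 \<le> y * sqrt y" by (intro mult_mono) auto
    then show ?thesis unfolding eq using True by simp
  next
    case False
    then show ?thesis unfolding eq using 0 by simp
  qed
next
  case (Suc k)
  define W where "W k y = {t. length t = k \<and> pos_digits t \<and> real (prod_list t) \<le> y}" for k and y :: real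
  define N where "N = nat \<lfloor>y\<rfloor>"
  have sub: "W (Suc k) y \<subseteq> (\<Union>a\<in>{1..N}. (#) a ` W k (y / a))"
  proof
    fix t assume t: "t \<in> W (Suc k) y"
    then obtain a u where au: "t = a # u" "length u = k" "a \<ge> 1" "pos_digits u" "real a * real (prod_list u) \<le> y"
      by (cases t) (auto simp: W_def)
    have "prod_list u \<ge> 1" using au(4) by (rule prod_list_pos)
    then have "real a * 1 \<le> real a * real (prod_list u)" by (intro mult_left_mono) auto
    then have "real a \<le> y" using au(5) by linarith
    then have "a \<le> N" by (simp add: N_def le_nat_floor)
    moreover have "u \<in> W k (y / a)" using au by (simp add: W_def field_simps)
    ultimately show "t \<in> (\<Union>a\<in>{1..N}. (#) a ` W k (y / a))" using au by auto
  qed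
  have fin: "finite (W k (y / a))" and cd: "real (card (W k (y / a))) \<le> 3 ^ k * (y / a * sqrt (y / a))" for a :: nat
    using Suc.IH[of "y / a"] Suc.prems by (auto simp: W_def)
  have fin': "finite (\<Union>a\<in>{1..N}. (#) a ` W k (y / a))" using fin by auto
  have "real (card (W (Suc k) y)) \<le> real (card (\<Union>a\<in>{1..N}. (#) a ` W k (y / a)))"
    using card_mono[OF fin' sub] by simp
  also have "\<dots> \<le> (\<Sum>a=1..N. real (card (W k (y / a))))"
  proof -
    have "card (\<Union>a\<in>{1..N}. (#) a ` W k (y / a)) \<le> (\<Sum>a=1..N. card ((#) a ` W k (y / a)))"
      by (rule card_UN_le) simp
    also have "\<dots> \<le> (\<Sum>a=1..N. card (W k (y / a)))" by (intro sum_mono card_image_le fin)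
    finally show ?thesis by (simp flip: of_nat_sum)
  qed
  also have "\<dots> \<le> (\<Sum>a=1..N. 3 ^ k * (y * sqrt y) * (1 / (real a * sqrt a)))"
  proof (intro sum_mono order.trans[OF cd])
    fix a assume "a \<in> {1..N}"
    then show "3 ^ k * (y / real a * sqrt (y / real a)) \<le> 3 ^ k * (y * sqrt y) * (1 / (real a * sqrt (real a)))"
      by (simp add: real_sqrt_divide)
  qed
  also have "\<dots> = 3 ^ k * (y * sqrt y) * (\<Sum>a=1..N. 1 / (real a * sqrt a))" by (rule sum_distrib_left[symmetric])
  also have "\<dots> \<le> 3 ^ k * (y * sqrt y) * 3"
  proof (intro mult_left_mono)
    show "(\<Sum>a=1..N. 1 / (real a * sqrt a)) \<le> 3"
    proof (cases "N \<ge> 1")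
      case True
      have "2 / sqrt N \<ge> 0" by simp
      then show ?thesis using sum_three_halves[OF True] by linarith
    qed auto
  qed (use Suc.prems in auto)
  finally show ?case using finite_subset[OF sub fin'] unfolding W_def by simp
qed

text \<open>The product of the digits is at most the denominator, so the previous count applies for
  each length. For K a small multiple of log m the result is negligible against m^2 / log m.\<close>

lemma card_short_words:
  "real (card {t. pos_digits t \<and> cf_den t \<le> m \<and> length t < K}) \<le> 3 ^ K * (real m * sqrt m)"
proof -
  define W where "W k = {t. length t = k \<and> pos_digits t \<and> real (prod_list t) \<le> real m}" for k
  have W: "finite (W k)" "real (card (W k)) \<le> 3 ^ k * (real m * sqrt m)" for k
    using card_words_prod[of "real m" k] by (auto simp: W_def)
  have sub: "{t. pos_digits t \<and> cf_den t \<le> m \<and> length t < K} \<subseteq> (\<Union>k<K. W k)"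
  proof clarify
    fix t assume t: "pos_digits t" "cf_den t \<le> m" "length t < K"
    have "prod_list t \<le> m" using cf_den_props[OF t(1)] t(2) by linarith
    then have "t \<in> W (length t)" using t by (simp add: W_def)
    then show "t \<in> (\<Union>k<K. W k)" using t(3) by blast
  qed
  have "card {t. pos_digits t \<and> cf_den t \<le> m \<and> length t < K} \<le> card (\<Union>k<K. W k)"
    using W by (intro card_mono sub) auto
  also have "\<dots> \<le> (\<Sum>k<K. card (W k))" by (rule card_UN_le) simp
  finally have "real (card {t. pos_digits t \<and> cf_den t \<le> m \<and> length t < K}) \<le> (\<Sum>k<K. real (card (W k)))"
    by (simp flip: of_nat_sum)
  also have "\<dots> \<le> (\<Sum>k<K. 3 ^ k * (real m * sqrt m))" by (intro sum_mono W)
  also have "\<dots> = (\<Sum>k<K. 3 ^ k) * (real m * sqrt m)" by (rule sum_distrib_right[symmetric])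
  also have "\<dots> \<le> 3 ^ K * (real m * sqrt m)"
  proof (intro mult_right_mono)
    show "(\<Sum>k<K. (3::real) ^ k) \<le> 3 ^ K"
    proof (induction K)
      case (Suc K)
      have "(0::real) \<le> 3 ^ K" by simp
      then show ?case using Suc unfolding sum.lessThan_Suc power_Suc by linarith
    qed simp
  qed auto
  finally show ?thesis .
qed

section \<open>Words with a wrong frequency of s\<close>

definition bad_word :: "nat list \<Rightarrow> real \<Rightarrow> nat list \<Rightarrow> bool" where
  "bad_word s \<epsilon> t \<longleftrightarrow> \<bar>hits s (length t) t - gauss_mean (word_prob s) * length t\<bar> > \<epsilon> * length t"

lemma hits_take_le: "s \<noteq> [] \<Longrightarrow> hits s k (take k l) \<le> hits s k l"
  unfolding hits_def
proof (intro sum_mono)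
  fix i assume "s \<noteq> []"
  have "hit s i l" if "hit s i (take k l)"
  proof -
    have "i + length s \<le> length (take k l)" using hit_length[OF that] \<open>s \<noteq> []\<close> by auto
    then have "hit s i (take k l @ drop k l)" using that by (subst hit_append_left) auto
    then show ?thesis by simp
  qed
  then show "of_bool (hit s i (take k l)) \<le> (of_bool (hit s i l) :: real)" by auto
qed

text \<open>Among the start positions below k only the last \<open>length s\<close> can carry an
  occurrence that runs past position k.\<close>

lemma hits_take_ge:
  assumes "k \<le> length l"
  shows "hits s k l - length s \<le> hits s k (take k l)"
proof -
  have "hits s k l \<le> hits s ((k - length s) + length s) l" by (rule hits_mono) simp
  also have "\<dots> \<le> hits s (k - length s) l + length s" by (rule hits_add_le)
  also have "hits s (k - length s) l = hits s (k - length s) (take k l)"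
    unfolding hits_def
  proof (intro sum.cong refl)
    fix i assume "i \<in> {..<k - length s}"
    then have "hit s i (take k l @ drop k l) = hit s i (take k l)"
      using assms by (intro hit_append_left) auto
    then show "of_bool (hit s i l) = (of_bool (hit s i (take k l)) :: real)" by simp
  qed
  also have "\<dots> \<le> hits s k (take k l)" by (rule hits_mono) simp
  finally show ?thesis by simp
qed

text \<open>Word counts are monotone in the length, so good behaviour along the multiples of \<open>M\<close> propagates
  to all intermediate lengths.\<close>

lemma not_bad_if_grid:
  fixes s
  defines "c \<equiv> gauss_mean (word_prob s)"
  assumes s: "s \<noteq> []" "pos_digits s"
    and M: "M \<ge> 1" "length s \<le> M" and J1: "2 / J1 \<le> \<epsilon> / 2" "J1 \<ge> 1" and d: "0 < \<delta>" "\<delta> \<le> 1" "\<delta> \<le> \<epsilon> / 2"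
    and k: "J1 * M \<le> k" "k < J * M" "k \<le> length l"
    and grid: "\<And>j. j \<in> {1..J} \<Longrightarrow> \<bar>hits s (j * M) l - real (j * M) * c\<bar> \<le> \<delta> * real (j * M)"
  shows "\<not> bad_word s \<epsilon> (take k l)"
proof -
  have c: "0 \<le> c" "c \<le> 1" unfolding c_def by (rule gauss_mean_word_prob_bounds[OF s(2)])+
  \<comment> \<open>The grid points around k are j M and (j + 1) M; since J1 \<le> j < J, both
    indices lie in {1..J}.\<close>
  define j where "j = k div M"
  have j: "j * M \<le> k" "k < (j + 1) * M" using M(1) dividend_less_times_div[of M k] by (auto simp: j_def algebra_simps)
  have jJ: "j \<ge> J1" "j < J"
    using k M(1) by (auto simp: j_def less_mult_imp_div_less less_eq_div_iff_mult_less_eq)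
  have MJ: "real M \<le> k / J1"
    using k(1) J1(2) by (simp add: le_divide_eq mult.commute flip: of_nat_mult)
  have r: "real (j * M) \<le> k" "real ((j + 1) * M) \<le> k + M" "k \<le> real (j * M) + M"
    using j by (simp_all only: of_nat_le_iff flip: of_nat_add) (auto simp: algebra_simps)
  \<comment> \<open>Rounding k to the grid costs at most 2 M on either side, which half of
    \<epsilon> k absorbs because k \<ge> J1 M; the other half pays for the deviation
    \<delta>.\<close>
  have two: "2 * real M \<le> \<epsilon> / 2 * k"
  proof -
    have "2 * real M \<le> 2 * (k / J1)" using MJ by simp
    also have "\<dots> = (2 / J1) * k" by simp
    also have "\<dots> \<le> \<epsilon> / 2 * k" by (intro mult_right_mono J1) auto
    finally show ?thesis .
  qed
  have dk: "\<delta> * k \<le> \<epsilon> / 2 * k" by (intro mult_right_mono d) auto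
  have up: "hits s k (take k l) \<le> c * k + \<epsilon> * k"
  proof -
    have "hits s k (take k l) \<le> hits s ((j + 1) * M) l"
      using hits_take_le[OF s(1), of k l] hits_mono[of k "(j + 1) * M" s l] j(2) by simp
    also have "\<dots> \<le> (c + \<delta>) * real ((j + 1) * M)"
      using grid[of "j + 1"] jJ J1(2) by (simp add: abs_le_iff algebra_simps)
    also have "\<dots> \<le> (c + \<delta>) * (k + M)" using r(2) c d by (intro mult_left_mono) auto
    also have "\<dots> = c * k + \<delta> * k + (c + \<delta>) * M" by (simp add: algebra_simps)
    also have "(c + \<delta>) * M \<le> 2 * real M" using c d by (intro mult_right_mono) auto
    also have "2 * real M \<le> \<epsilon> / 2 * k" by (rule two)
    finally show ?thesis using dk by (simp add: field_simps)
  qed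
  have low: "hits s k (take k l) \<ge> c * k - \<epsilon> * k"
  proof -
    have "c * k - c * M \<le> c * real (j * M)"
      using mult_left_mono[OF r(3) c(1)] by (simp add: algebra_simps)
    moreover have "c * M \<le> 1 * real M" using c by (intro mult_right_mono) auto
    moreover have "c * real (j * M) - \<delta> * real (j * M) \<le> hits s (j * M) l"
      using grid[of j] jJ J1(2) by (simp add: abs_le_iff algebra_simps)
    moreover have "\<delta> * real (j * M) \<le> \<delta> * k" using r(1) d by (intro mult_left_mono) auto
    moreover have "hits s (j * M) l \<le> hits s k l" using j(1) by (rule hits_mono)
    moreover have "hits s k l - length s \<le> hits s k (take k l)" by (rule hits_take_ge[OF k(3)])
    moreover have "real (length s) \<le> M" using M by simp
    ultimately show ?thesis using two dk by (simp add: field_simps)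
  qed
  have "length (take k l) = k" using k(3) by simp
  then show ?thesis unfolding bad_word_def c_def[symmetric] using up low by (simp add: abs_le_iff not_less algebra_simps)
qed

text \<open>Appending to a word of denominator at most \<open>m\<close> the least digit that makes the denominator exceed
  \<open>m\<close> yields pairwise incompatible words, each of probability at least \<open>1 / (8 m\<^sup>2)\<close>.\<close>

definition exit_digit :: "nat \<Rightarrow> nat list \<Rightarrow> nat" where
  "exit_digit m t = (LEAST a. cf_den (t @ [a]) > m)"

lemma exit_digit:
  assumes t: "pos_digits t" "cf_den t \<le> m"
  shows "cf_den (t @ [exit_digit m t]) > m" "cf_den (t @ [exit_digit m t]) \<le> 2 * m" "exit_digit m t \<ge> 1"
proof -
  note p = cf_den_props[OF t(1)]
  have "(m + 1) * 1 \<le> (m + 1) * cf_den t" using p by (intro mult_left_mono) auto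
  then have "cf_den (t @ [m + 1]) > m" by simp
  then show gt: "cf_den (t @ [exit_digit m t]) > m" unfolding exit_digit_def by (rule LeastI)
  show ge: "exit_digit m t \<ge> 1"
  proof (rule ccontr)
    assume "\<not> ?thesis"
    then have "exit_digit m t = 0" by simp
    then show False using gt p t(2) by simp
  qed
  then have "\<not> cf_den (t @ [exit_digit m t - 1]) > m"
    unfolding exit_digit_def by (intro not_less_Least) auto
  then have "(exit_digit m t - 1) * cf_den t + cf_den' t \<le> m" by simp
  moreover have "exit_digit m t * cf_den t = (exit_digit m t - 1) * cf_den t + cf_den t"
    using ge by (cases "exit_digit m t") auto
  ultimately show "cf_den (t @ [exit_digit m t]) \<le> 2 * m" using t(2) by simp
qed

text \<open>The extended denominator is at most 2 m, so q (q + q') \<le> 2 m * 4 m.\<close>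

lemma exit_prob:
  assumes t: "pos_digits t" "cf_den t \<le> m"
  shows "word_prob (t @ [exit_digit m t]) 0 \<ge> 1 / (8 * (real m)\<^sup>2)"
proof -
  let ?e = "t @ [exit_digit m t]"
  have e: "pos_digits ?e" using t exit_digit(3)[OF t] by auto
  note p = cf_den_props[OF e]
  have "real (cf_den ?e) * (real (cf_den ?e) + real (cf_den' ?e)) \<le> (2 * real m) * (2 * real m + 2 * real m)"
  proof (intro mult_mono add_mono)
    show "real (cf_den ?e) \<le> 2 * real m" using exit_digit(2)[OF t] by linarith
    moreover have "real (cf_den' ?e) \<le> real (cf_den ?e)" using p by linarith
    ultimately show "real (cf_den' ?e) \<le> 2 * real m" "real (cf_den ?e) \<le> 2 * real m" by linarith+
  qed auto
  also have "\<dots> = 8 * (real m)\<^sup>2" by (simp add: power2_eq_square)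
  finally have "real (cf_den ?e) * (real (cf_den ?e) + real (cf_den' ?e)) \<le> 8 * (real m)\<^sup>2" .
  moreover have "0 < real (cf_den ?e)" using p by linarith
  then have "0 < real (cf_den ?e) * (real (cf_den ?e) + real (cf_den' ?e))"
    by (intro mult_pos_pos add_pos_nonneg) (simp_all only: of_nat_0_le_iff)
  ultimately show ?thesis unfolding word_prob_0[OF e]
    by (intro frac_le[of 1 1 "real (cf_den ?e) * (real (cf_den ?e) + real (cf_den' ?e))"]) (simp_all only: zero_le_one order_refl)
qed

text \<open>If t were shorter than u, then u would begin with the extension of t and have
  denominator greater than m.\<close>

lemma exit_incompatible:
  assumes t: "pos_digits t" "cf_den t \<le> m" and u: "pos_digits u" "cf_den u \<le> m"
    and l: "take (length t + 1) l = t @ [exit_digit m t]" "take (length u + 1) l = u @ [exit_digit m u]"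
  shows "t = u"
proof -
  have *: "\<not> length t < length u"
    if "pos_digits t" "cf_den t \<le> m" "pos_digits u" "cf_den u \<le> m"
      "take (length t + 1) l = t @ [exit_digit m t]" "take (length u + 1) l = u @ [exit_digit m u]" for t u
  proof
    assume lt: "length t < length u"
    have "take (length u) l = u" using that(6)
      by (metis append_eq_conv_conj butlast_snoc butlast_take length_append_singleton nat_le_linear take_all Suc_eq_plus1 add_diff_cancel_right' length_take min_def)
    then have "take (length t + 1) u = t @ [exit_digit m t]"
      using that(5) lt by (metis Suc_eq_plus1 Suc_leI min.absorb1 take_take)
    then have "u = (t @ [exit_digit m t]) @ drop (length t + 1) u" by (metis append_take_drop_id)
    then have "cf_den (t @ [exit_digit m t]) \<le> cf_den u" using cf_den_append_le that(3) by metis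
    then show False using exit_digit(1)[OF that(1,2)] that(4) by linarith
  qed
  have "length t = length u" using *[OF t u l] *[OF u t l(2,1)] by linarith
  then show ?thesis using l by simp
qed

text \<open>Every random word that begins with the extension of a bad t deviates at some grid point.
  Disjoint events of probability at least 1 / (8 m^2), one for each t, thus lie in the union of
  \<open>J\<close> events of probability O(1/M).\<close>

lemma card_long_bad_words:
  fixes s
  defines "c \<equiv> gauss_mean (word_prob s)"
  assumes s: "s \<noteq> []" "pos_digits s"
    and M: "M \<ge> 1" "length s \<le> M" and J1: "2 / J1 \<le> \<epsilon> / 2" "J1 \<ge> 1" and d: "0 < \<delta>" "\<delta> \<le> 1" "\<delta> \<le> \<epsilon> / 2"
    and m: "m \<ge> 1" and J: "\<And>t. pos_digits t \<Longrightarrow> cf_den t \<le> m \<Longrightarrow> length t < J * M"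
  shows "real (card {t. pos_digits t \<and> cf_den t \<le> m \<and> J1 * M \<le> length t \<and> bad_word s \<epsilon> t})
    \<le> 8 * (real m)\<^sup>2 * (J * ((28 * (8/7) ^ length s + 1) / (\<delta>\<^sup>2 * M)))"
proof -
  define B where "B = {t. pos_digits t \<and> cf_den t \<le> m \<and> J1 * M \<le> length t \<and> bad_word s \<epsilon> t}"
  \<comment> \<open>Long enough for every extended word and for every window that starts below
    \<open>J * M\<close>.\<close>
  define n where "n = J * M + length s"
  define p where "p = digits_pmf n 0"
  \<comment> \<open>Restricting to the support ensures that the members have length
    \<open>n\<close>.\<close>
  define A where "A t = {l. take (length t + 1) l = t @ [exit_digit m t]} \<inter> set_pmf p" for t
  define G where "G j = {l. \<bar>hits s (j * M) l - real (j * M) * c\<bar> > \<delta> * real (j * M)}" for j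
  have finB: "finite B" by (rule finite_subset[OF _ finite_words_den[of m]]) (auto simp: B_def)
  have PA: "1 / (8 * (real m)\<^sup>2) \<le> measure_pmf.prob p (A t)" if "t \<in> B" for t
  proof -
    have t: "pos_digits t" "cf_den t \<le> m" using that by (auto simp: B_def)
    have le: "length t + 1 \<le> n" using J[OF t] by (simp add: n_def)
    have "measure_pmf.prob p (A t) = measure_pmf.prob p {l. take (length t + 1) l = t @ [exit_digit m t]}"
      unfolding A_def by (rule measure_Int_set_pmf)
    also have "\<dots> = measure_pmf.expectation p (\<lambda>l. indicator {t @ [exit_digit m t]} (take (length t + 1) l))"
    proof -
      have "measure_pmf.prob p {l. take (length t + 1) l = t @ [exit_digit m t]}
        = measure_pmf.expectation p (indicator {l. take (length t + 1) l = t @ [exit_digit m t]})" by simp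
      also have "\<dots> = measure_pmf.expectation p (\<lambda>l. indicator {t @ [exit_digit m t]} (take (length t + 1) l))"
        by (rule Bochner_Integration.integral_cong) (auto simp: indicator_def)
      finally show ?thesis .
    qed
    also have "\<dots> = measure_pmf.expectation (digits_pmf (length t + 1) 0) (indicator {t @ [exit_digit m t]})"
      unfolding p_def by (rule expectation_digits_take[where B=1]) (use le in \<open>auto simp: indicator_def\<close>)
    also have "\<dots> = word_prob (t @ [exit_digit m t]) 0" by (simp add: word_prob_def measure_pmf_single)
    finally show ?thesis using exit_prob[OF t] by simp
  qed
  have disj: "disjoint_family_on A B"
    unfolding disjoint_family_on_def A_def B_def using exit_incompatible by blast
  have sub: "(\<Union>t\<in>B. A t) \<subseteq> (\<Union>j\<in>{1..J}. G j)"
  proof (rule ccontr)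
    assume "\<not> ?thesis"
    then obtain t l where tl: "t \<in> B" "l \<in> A t" "\<And>j. j \<in> {1..J} \<Longrightarrow> l \<notin> G j" by blast
    have t: "pos_digits t" "cf_den t \<le> m" "J1 * M \<le> length t" "bad_word s \<epsilon> t" using tl(1) by (auto simp: B_def)
    have l: "take (length t + 1) l = t @ [exit_digit m t]" "length l = n"
      using tl(2) set_digits_pmf[of 0 l n] by (auto simp: A_def p_def)
    have "take (length t) (take (length t + 1) l) = t" unfolding l(1) by simp
    then have tk: "take (length t) l = t" by simp
    have "\<not> bad_word s \<epsilon> (take (length t) l)"
    proof (rule not_bad_if_grid[OF s M J1 d t(3) J[OF t(1,2)]])
      show "length t \<le> length l" using J[OF t(1,2)] l(2) by (simp add: n_def)
      show "\<bar>hits s (j * M) l - real (j * M) * gauss_mean (word_prob s)\<bar> \<le> \<delta> * real (j * M)" if "j \<in> {1..J}" for j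
        using tl(3)[OF that] by (simp add: G_def c_def)
    qed
    then show False using t(4) tk by simp
  qed
  have "real (card B) * (1 / (8 * (real m)\<^sup>2)) \<le> (\<Sum>t\<in>B. measure_pmf.prob p (A t))"
    using sum_mono[OF PA] by simp
  also have "\<dots> = measure_pmf.prob p (\<Union>t\<in>B. A t)"
    by (rule measure_pmf.finite_measure_finite_Union[symmetric, OF finB _ disj]) auto
  also have "\<dots> \<le> measure_pmf.prob p (\<Union>j\<in>{1..J}. G j)"
    by (rule measure_pmf.finite_measure_mono[OF sub]) auto
  also have "\<dots> \<le> (\<Sum>j\<in>{1..J}. measure_pmf.prob p (G j))"
    by (rule measure_pmf.finite_measure_subadditive_finite) auto
  also have "\<dots> \<le> (\<Sum>j\<in>{1..J}. (28 * (8/7) ^ length s + 1) / (\<delta>\<^sup>2 * M))"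
  proof (rule sum_mono)
    fix j assume j: "j \<in> {1..J}"
    have "measure_pmf.prob p (G j) \<le> (28 * (8/7) ^ length s + 1) / (\<delta>\<^sup>2 * real (j * M))"
      unfolding p_def G_def c_def using j M by (intro hits_deviation s d) (auto simp: n_def)
    also have "\<dots> \<le> (28 * (8/7) ^ length s + 1) / (\<delta>\<^sup>2 * M)"
    proof (intro divide_left_mono mult_left_mono mult_pos_pos)
      have "M \<le> j * M" using j by simp
      then show "real M \<le> real (j * M)" by (simp only: of_nat_le_iff)
    qed (use j M d in \<open>auto intro!: add_nonneg_nonneg\<close>)
    finally show "measure_pmf.prob p (G j) \<le> (28 * (8/7) ^ length s + 1) / (\<delta>\<^sup>2 * M)" .
  qed
  also have "\<dots> = J * ((28 * (8/7) ^ length s + 1) / (\<delta>\<^sup>2 * M))" by simp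
  finally have "real (card B) * (1 / (8 * (real m)\<^sup>2)) \<le> J * ((28 * (8/7) ^ length s + 1) / (\<delta>\<^sup>2 * M))" .
  then have "real (card B) \<le> J * ((28 * (8/7) ^ length s + 1) / (\<delta>\<^sup>2 * M)) * (8 * (real m)\<^sup>2)"
    using m by (simp add: pos_divide_le_eq)
  then show ?thesis unfolding B_def by (simp only: mult_ac)
qed

lemma card_bad_words:
  assumes s: "s \<noteq> []" "pos_digits s" and eps: "\<epsilon> > 0"
  shows "\<exists>C>0. eventually (\<lambda>m. real (card {t. pos_digits t \<and> cf_den t \<le> m \<and> bad_word s \<epsilon> t})
     \<le> C * ((real m)\<^sup>2 / ln (real m))) sequentially"
proof -
  \<comment> \<open>\<open>J1\<close> absorbs the rounding to the grid. \<open>M\<close> is about ln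
    m / (8 J1), so the words shorter than \<open>J1 * M\<close> number at most e^(2 J1 M) m^(3/2)
    \<le> m^(7/4). The factor 40 makes \<open>J * M\<close> at least 5 ln m - 40 J1, which for large
    m exceeds the maximal length 1 + 3 ln m. In \<open>C\<close> the 1 pays for short words, and 128
    is 8 * 16, with 16 from M \<ge> ln m / (16 J1).\<close>
  define J1 where "J1 = nat \<lceil>4 / \<epsilon>\<rceil> + 1"
  define J where "J = 40 * J1"
  define \<delta> where "\<delta> = min 1 (\<epsilon> / 2)"
  define K :: real where "K = 28 * (8/7) ^ length s + 1"
  define M where "M m = nat \<lfloor>ln (real m) / (8 * J1)\<rfloor>" for m :: nat
  define C where "C = 1 + 128 * J * J1 * K / \<delta>\<^sup>2"
  have J1: "J1 \<ge> 1" "real J1 > 0" by (auto simp: J1_def)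
  have "4 / \<epsilon> \<le> J1" unfolding J1_def by linarith
  then have J1': "2 / J1 \<le> \<epsilon> / 2" using eps J1 by (simp add: field_simps)
  have d: "0 < \<delta>" "\<delta> \<le> 1" "\<delta> \<le> \<epsilon> / 2" using eps by (auto simp: \<delta>_def)
  have K: "K > 0" by (auto simp: K_def intro: add_nonneg_pos)
  have C: "C > 0" unfolding C_def using K d by (intro add_pos_nonneg) auto
  have lnlim: "filterlim (\<lambda>m::nat. ln (real m)) at_top sequentially" by real_asymp
  have ev: "eventually (\<lambda>m::nat. ln (real m) \<ge> X) sequentially" for X
    using lnlim by (simp add: filterlim_at_top)
  have short_ev: "eventually (\<lambda>m::nat. exp (ln (real m) / 4) * (real m * sqrt (real m)) \<le> (real m)\<^sup>2 / ln (real m)) sequentially"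
    by real_asymp
  have "eventually (\<lambda>m. real (card {t. pos_digits t \<and> cf_den t \<le> m \<and> bad_word s \<epsilon> t})
     \<le> C * ((real m)\<^sup>2 / ln (real m))) sequentially"
    using short_ev ev[of "8 * J1 * (length s + 2)"] ev[of "20 * J1 + 1"] ev[of "16 * J1"] eventually_ge_at_top[of 2]
  proof eventually_elim
    case (elim m)
    define x where "x = ln (real m)"
    have m: "real m > 0" "m \<ge> 1" using elim by auto
    have x: "x > 0" "x \<ge> 8 * J1 * (length s + 2)" "x \<ge> 20 * real J1 + 1" "x \<ge> 16 * real J1"
      using elim by (auto simp: x_def)
    have "x / (8 * J1) \<ge> 0" using x J1 by simp
    then have Mu: "real (M m) \<le> x / (8 * J1)" and Ml: "real (M m) \<ge> x / (8 * J1) - 1"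
      unfolding M_def x_def[symmetric] by linarith+
    have "real (length s + 2) \<le> x / (8 * J1)" using x(2) J1 by (simp add: le_divide_eq mult_ac)
    then have "real (length s + 1) \<le> real (M m)" using Ml by simp
    then have M: "M m \<ge> 1" "length s \<le> M m" by linarith+
    have "1 \<le> x / (16 * J1)" using x(4) J1 by (simp add: le_divide_eq)
    moreover have "x / (8 * J1) = 2 * (x / (16 * J1))" by simp
    ultimately have M16: "x / (16 * J1) \<le> real (M m)" using Ml by linarith
    have JM: "3 * x + 2 \<le> real (J * M m)"
    proof -
      have "5 * x - 40 * J1 = 40 * real J1 * (x / (8 * J1) - 1)" using J1 by (simp add: field_simps)
      also have "\<dots> \<le> 40 * real J1 * real (M m)" using Ml by (intro mult_left_mono) auto
      also have "\<dots> = real (J * M m)" by (simp add: J_def)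
      finally show ?thesis using x(3) by linarith
    qed
    have len: "length t < J * M m" if t: "pos_digits t" "cf_den t \<le> m" for t
    proof -
      have "real (2 ^ length t) \<le> real (2 * m\<^sup>2)" using cf_den_length[OF t] by (simp only: of_nat_le_iff)
      then have "ln (2 ^ length t) \<le> ln (2 * (real m)\<^sup>2)" using m by (subst ln_le_cancel_iff) auto
      then have "length t * ln 2 \<le> ln 2 + 2 * x"
        using m by (simp add: ln_realpow ln_mult x_def)
      moreover have "2 * x \<le> 3 * x * ln 2" using ln2_ge_two_thirds x(1) by (simp add: field_simps)
      ultimately have "length t * ln 2 \<le> (1 + 3 * x) * ln 2" by (simp add: algebra_simps)
      then have "real (length t) \<le> 1 + 3 * x" by (simp add: mult_le_cancel_right)
      then have "real (length t) < real (J * M m)" using JM by linarith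
      then show ?thesis by (simp only: of_nat_less_iff)
    qed
    define Sh where "Sh = {t. pos_digits t \<and> cf_den t \<le> m \<and> length t < J1 * M m}"
    define Lo where "Lo = {t. pos_digits t \<and> cf_den t \<le> m \<and> J1 * M m \<le> length t \<and> bad_word s \<epsilon> t}"
    have fin: "finite Sh" "finite Lo"
      unfolding Sh_def Lo_def by (rule finite_subset[OF _ finite_words_den[of m]], auto)+
    have "card {t. pos_digits t \<and> cf_den t \<le> m \<and> bad_word s \<epsilon> t} \<le> card (Sh \<union> Lo)"
      using fin by (intro card_mono) (auto simp: Sh_def Lo_def)
    also have "\<dots> \<le> card Sh + card Lo" by (rule card_Un_le)
    finally have split: "real (card {t. pos_digits t \<and> cf_den t \<le> m \<and> bad_word s \<epsilon> t}) \<le> real (card Sh) + real (card Lo)"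
      by linarith
    have "real (card Sh) \<le> 3 ^ (J1 * M m) * (real m * sqrt m)" unfolding Sh_def by (rule card_short_words)
    also have "(3::real) ^ (J1 * M m) \<le> exp 2 ^ (J1 * M m)"
      using exp_ge_add_one_self[of 2] by (intro power_mono) auto
    also have "\<dots> = exp (2 * (J1 * M m))" by (simp add: exp_of_nat_mult[symmetric] mult.commute)
    also have "\<dots> \<le> exp (x / 4)"
    proof -
      have "real J1 * real (M m) \<le> real J1 * (x / (8 * J1))" using Mu by (intro mult_left_mono) auto
      also have "\<dots> = x / 8" using J1 by simp
      finally show ?thesis by simp
    qed
    finally have "real (card Sh) \<le> exp (x / 4) * (real m * sqrt m)" by (simp add: mult_right_mono)
    also have "\<dots> \<le> (real m)\<^sup>2 / x" using elim(1) by (simp add: x_def)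
    finally have short: "real (card Sh) \<le> (real m)\<^sup>2 / x" .
    have "real (card Lo) \<le> 8 * (real m)\<^sup>2 * (J * (K / (\<delta>\<^sup>2 * M m)))"
      unfolding Lo_def K_def by (rule card_long_bad_words[OF s M J1' J1(1) d m(2) len])
    also have "\<dots> \<le> 8 * (real m)\<^sup>2 * (J * (K / (\<delta>\<^sup>2 * (x / (16 * J1)))))"
      using M16 d K x J1 M by (intro mult_left_mono divide_left_mono mult_pos_pos) auto
    also have "\<dots> = 128 * J * J1 * K / \<delta>\<^sup>2 * ((real m)\<^sup>2 / x)" using x J1 d by (simp add: field_simps)
    finally have "real (card Lo) \<le> 128 * J * J1 * K / \<delta>\<^sup>2 * ((real m)\<^sup>2 / x)" .
    moreover have "C * ((real m)\<^sup>2 / x) = (real m)\<^sup>2 / x + 128 * J * J1 * K / \<delta>\<^sup>2 * ((real m)\<^sup>2 / x)"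
      unfolding C_def by (simp only: distrib_right mult_1)
    ultimately show ?case using split short unfolding x_def[symmetric] by linarith
  qed
  then show ?thesis using C by blast
qed

section \<open>Continued fractions of rationals\<close>

lemma cf_short_0 [simp]: "cf_short 0 q = []"
  by (subst cf_short.simps) simp

lemma cf_short_pos: "p > 0 \<Longrightarrow> cf_short p q = (q div p) # cf_short (q mod p) p"
  by (subst cf_short.simps) simp

lemma cf_short_pos_digits: "p \<le> q \<Longrightarrow> pos_digits (cf_short p q)"
proof (induction p q rule: cf_short.induct)
  case (1 p q)
  show ?case
  proof (cases "p = 0")
    case False
    then have "pos_digits (cf_short (q mod p) p)" using 1 by (simp add: less_imp_le)
    moreover have "q div p \<ge> 1" using False 1(2) by (simp add: div_greater_zero_iff Suc_leI)
    ultimately show ?thesis using False by (simp add: cf_short_pos)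
  qed simp
qed

text \<open>This makes \<open>last xs - 1\<close> in \<open>cf_rat\<close> a positive digit.\<close>

lemma cf_short_last: "0 < p \<Longrightarrow> p < q \<Longrightarrow> cf_short p q \<noteq> [] \<and> last (cf_short p q) \<ge> 2"
proof (induction p q rule: cf_short.induct)
  case (1 p q)
  show ?case
  proof (cases "q mod p = 0")
    case True
    then obtain k where k: "q = p * k" by auto
    then have "k \<ge> 2" using 1(2,3) by (cases "k = 0 \<or> k = 1") auto
    then show ?thesis using 1(2) True k by (simp add: cf_short_pos)
  next
    case False
    then show ?thesis using 1 by (simp add: cf_short_pos)
  qed
qed

text \<open>The Euclidean step preserves y q + x p for an arbitrary start pair; coprimality enters
  at the end, where p = 0 forces q = 1.\<close>

lemma cf_short_den:
  "coprime p q \<Longrightarrow> snd (foldl den_step (x, y) (cf_short p q)) = y * q + x * p"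
proof (induction p q arbitrary: x y rule: cf_short.induct)
  case (1 p q)
  show ?case
  proof (cases "p = 0")
    case True
    then show ?thesis using 1 by simp
  next
    case False
    have "coprime (q mod p) p" using 1(2) False by (simp add: coprime_commute coprime_mod_left_iff)
    then have "snd (foldl den_step (y, q div p * y + x) (cf_short (q mod p) p)) = (q div p * y + x) * p + y * (q mod p)"
      using 1(1) False by blast
    also have "\<dots> = y * (q div p * p + q mod p) + x * p" by (simp only: distrib_left distrib_right mult_ac add_ac)
    also have "\<dots> = y * q + x * p" by (simp only: div_mult_mod_eq)
    finally show ?thesis using False by (simp add: cf_short_pos)
  qed
qed

lemma cf_short_eval: "q > 0 \<Longrightarrow> cf_eval (cf_short p q) 0 = real p / real q"
proof (induction p q rule: cf_short.induct)
  case (1 p q)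
  show ?case
  proof (cases "p = 0")
    case False
    then have "cf_eval (cf_short p q) 0 = 1 / (real (q div p) + real (q mod p) / real p)"
      using 1 by (simp add: cf_short_pos)
    also have "real (q div p) + real (q mod p) / real p = real (q div p * p + q mod p) / real p"
      using False by (simp only: of_nat_add of_nat_mult add_divide_distrib) simp
    also have "\<dots> = real q / real p" by (simp only: div_mult_mod_eq)
    finally show ?thesis by simp
  qed simp
qed

definition rat_den :: "rat \<Rightarrow> nat" where "rat_den r = nat (snd (quotient_of r))"
definition rat_num :: "rat \<Rightarrow> nat" where "rat_num r = nat (fst (quotient_of r))"

lemma rats01_num_den:
  assumes "r \<in> rats01"
  shows "0 < rat_num r" "rat_num r < rat_den r" "coprime (rat_num r) (rat_den r)" "r = of_nat (rat_num r) / of_nat (rat_den r)"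
    "quotient_of r = (int (rat_num r), int (rat_den r))"
proof -
  obtain p q where pq: "quotient_of r = (p, q)" by (cases "quotient_of r")
  have q: "q > 0" "coprime p q" "r = of_int p / of_int q"
    using quotient_of_denom_pos[OF pq] quotient_of_coprime[OF pq] quotient_of_div[OF pq] by auto
  have r: "0 < r" "r < 1" using assms by (auto simp: rats01_def)
  have p: "0 < p" "p < q" using r q by (auto simp: zero_less_divide_iff divide_less_eq)
  have nd: "int (rat_num r) = p" "int (rat_den r) = q" using pq p q by (auto simp: rat_num_def rat_den_def)
  show "0 < rat_num r" "rat_num r < rat_den r" using nd p by linarith+
  show "coprime (rat_num r) (rat_den r)" using q(2) unfolding nd[symmetric] by simp
  show "r = of_nat (rat_num r) / of_nat (rat_den r)" using q(3) unfolding nd[symmetric] of_int_of_nat_eq .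
  show "quotient_of r = (int (rat_num r), int (rat_den r))" using pq nd by simp
qed

lemma rats01_fraction:
  assumes "0 < p" "p < q" "coprime p q"
  shows "(of_nat p / of_nat q :: rat) \<in> rats01" "rat_num (of_nat p / of_nat q) = p" "rat_den (of_nat p / of_nat q) = q"
proof -
  have "quotient_of (Fract (int p) (int q)) = (int p, int q)"
    using assms by (simp add: quotient_of_Fract normalize_def coprime_iff_gcd_eq_1 gcd_int_def)
  moreover have "Fract (int p) (int q) = of_nat p / of_nat q" by (simp add: Fract_of_int_quotient)
  ultimately show "rat_num (of_nat p / of_nat q) = p" "rat_den (of_nat p / of_nat q) = q"
    by (simp_all add: rat_num_def rat_den_def)
  show "(of_nat p / of_nat q :: rat) \<in> rats01" using assms by (auto simp: rats01_def divide_less_eq)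
qed

text \<open>Replacing the last digit b by b - 1, 1 keeps the denominator, as ((b - 1) q + q') + q =
  b q + q', and the value, as b - 1 + 1/1 = b. So everything reduces to the Euclidean
  expansion.\<close>

lemma cf_rat_props:
  assumes "r \<in> rats01"
  shows "pos_digits (cf_rat r)" "cf_den (cf_rat r) = rat_den r" "cf_eval (cf_rat r) 0 = real (rat_num r) / real (rat_den r)"
    "length (cf_rat r) \<ge> 2"
proof -
  note nd = rats01_num_den[OF assms]
  define xs where "xs = cf_short (rat_num r) (rat_den r)"
  have eq: "cf_rat r = butlast xs @ [last xs - 1, 1]"
    unfolding cf_rat_def nd(5) xs_def by (simp add: Let_def)
  have xs: "xs \<noteq> []" "last xs \<ge> 2" using cf_short_last[OF nd(1,2)] by (auto simp: xs_def)
  have bl: "butlast xs @ [last xs] = xs" using xs by simp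
  have "pos_digits xs" unfolding xs_def using nd(2) by (intro cf_short_pos_digits) simp
  then show "pos_digits (cf_rat r)" unfolding eq using xs by (auto dest: in_set_butlastD)
  have l: "last xs = Suc (last xs - 1)" using xs by simp
  have "cf_den (cf_rat r) = cf_den ((butlast xs @ [last xs - 1]) @ [1])" by (simp add: eq)
  also have "\<dots> = cf_den (butlast xs @ [Suc (last xs - 1)])" by (simp only: cf_den_snoc) simp
  also have "\<dots> = cf_den xs" using l bl by simp
  also have "\<dots> = rat_den r" unfolding cf_den_def cf_dens_def xs_def by (simp add: cf_short_den[OF nd(3)])
  finally show "cf_den (cf_rat r) = rat_den r" .
  have "cf_eval (cf_rat r) 0 = cf_eval (butlast xs) (cf_eval [last xs] 0)"
    unfolding eq cf_eval_append using xs by (simp add: of_nat_diff)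
  also have "\<dots> = cf_eval xs 0" unfolding cf_eval_append[symmetric] bl ..
  also have "\<dots> = real (rat_num r) / real (rat_den r)" unfolding xs_def using nd by (intro cf_short_eval) simp
  finally show "cf_eval (cf_rat r) 0 = real (rat_num r) / real (rat_den r)" .
  show "length (cf_rat r) \<ge> 2" by (simp add: eq)
qed

lemma inj_on_cf_rat: "inj_on cf_rat rats01"
proof (rule inj_onI)
  fix r r' assume r: "r \<in> rats01" "r' \<in> rats01" and eq: "cf_rat r = cf_rat r'"
  have d: "rat_den r = rat_den r'" using cf_rat_props(2)[OF r(1)] cf_rat_props(2)[OF r(2)] eq by simp
  have "rat_den r > 0" using rats01_num_den[OF r(1)] by simp
  moreover have "real (rat_num r) / real (rat_den r) = real (rat_num r') / real (rat_den r)"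
    using cf_rat_props(3)[OF r(1)] cf_rat_props(3)[OF r(2)] eq d by metis
  ultimately have "rat_num r = rat_num r'" by simp
  then show "r = r'" using rats01_num_den(4)[OF r(1)] rats01_num_den(4)[OF r(2)] d by metis
qed

section \<open>The enumeration of the rationals\<close>

lemma card_less_enumerate:
  fixes A :: "nat set"
  assumes "infinite A"
  shows "card {a \<in> A. a < enumerate A k} = k"
proof -
  have "{a \<in> A. a < enumerate A k} = enumerate A ` {..<k}"
  proof (intro equalityI subsetI)
    fix a assume a: "a \<in> {a \<in> A. a < enumerate A k}"
    then obtain i where i: "enumerate A i = a" using enumerate_Ex assms by blast
    then have "enumerate A i < enumerate A k" using a by simp
    then have "i < k" using enumerate_mono_iff[OF assms] by blast
    then show "a \<in> enumerate A ` {..<k}" using i by auto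
  qed (use assms in \<open>auto simp: enumerate_in_set\<close>)
  moreover have "inj (enumerate A)" using assms by (rule inj_enumerate)
  ultimately show ?thesis by (simp add: card_image inj_on_subset)
qed

text \<open>For p < q the number q^2 + p lies below (q + 1)^2, so the keys realize the order by
  denominator and then numerator inside the natural numbers, where \<open>enumerate\<close> is
  available.\<close>

definition rat_key :: "rat \<Rightarrow> nat" where "rat_key r = (rat_den r)\<^sup>2 + rat_num r"

lemma square_add_less_iff:
  fixes p q p' q' :: nat
  assumes "p < q" "p' < q'"
  shows "q\<^sup>2 + p < q'\<^sup>2 + p' \<longleftrightarrow> q < q' \<or> q = q' \<and> p < p'"
proof -
  have *: "q\<^sup>2 + p < q'\<^sup>2 + p'" if "p < q" "q < q'" for p q p' q' :: nat
  proof -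
    have "q\<^sup>2 + p < (q + 1)\<^sup>2" using that by (simp add: power2_eq_square)
    also have "\<dots> \<le> q'\<^sup>2" using that by (intro power_mono) auto
    finally show ?thesis by simp
  qed
  from *[of p q q' p'] *[of p' q' q p] assms show ?thesis
    by (cases q q' rule: linorder_cases) auto
qed

lemma rat_before_iff:
  assumes "r \<in> rats01" "r' \<in> rats01"
  shows "rat_before r r' \<longleftrightarrow> rat_key r < rat_key r'"
  using rats01_num_den[OF assms(1)] rats01_num_den[OF assms(2)]
  by (simp add: rat_before_def rat_key_def square_add_less_iff)

lemma inj_on_rat_key: "inj_on rat_key rats01"
proof (rule inj_onI)
  fix r r' assume r: "r \<in> rats01" "r' \<in> rats01" and eq: "rat_key r = rat_key r'"
  note n = rats01_num_den[OF r(1)] and n' = rats01_num_den[OF r(2)]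
  have "rat_den r = rat_den r' \<and> rat_num r = rat_num r'"
    using square_add_less_iff[OF n(2) n'(2)] square_add_less_iff[OF n'(2) n(2)] eq
    unfolding rat_key_def by auto
  then show "r = r'" using n(4) n'(4) by metis
qed

lemma infinite_rats01: "infinite rats01"
proof
  assume f: "finite rats01"
  have "inj_on (\<lambda>q. of_nat 1 / of_nat q :: rat) {2..}"
    by (rule inj_onI) auto
  moreover have "(\<lambda>q. of_nat 1 / of_nat q :: rat) ` {2..} \<subseteq> rats01"
    using rats01_fraction(1)[of 1] by auto
  ultimately have "finite {2::nat..}" using f by (meson finite_imageD finite_subset)
  then show False using infinite_Ici by blast
qed

text \<open>Justifies the definite description in \<open>rseq\<close>: ranks among rationals are
  ranks among keys, and the key of rank n - 1 is \<open>enumerate A (n - 1)\<close>.\<close>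

lemma rseq_props:
  shows "rseq n \<in> rats01" "card {y \<in> rats01. rat_before y (rseq n)} = n - 1"
proof -
  define A where "A = rat_key ` rats01"
  have A: "infinite A" unfolding A_def using infinite_rats01 inj_on_rat_key by (simp add: finite_image_iff)
  have rank: "card {y \<in> rats01. rat_before y x} = card {a \<in> A. a < rat_key x}" if x: "x \<in> rats01" for x
  proof -
    have "{a \<in> A. a < rat_key x} = rat_key ` {y \<in> rats01. rat_before y x}"
      using x by (auto simp: A_def rat_before_iff)
    moreover have "inj_on rat_key {y \<in> rats01. rat_before y x}"
      by (rule inj_on_subset[OF inj_on_rat_key]) auto
    ultimately show ?thesis by (simp add: card_image)
  qed
  have "\<exists>!x. x \<in> rats01 \<and> card {y \<in> rats01. rat_before y x} = n - 1"
  proof (rule ex_ex1I)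
    have "enumerate A (n - 1) \<in> A" using A by (rule enumerate_in_set)
    then obtain x where x: "x \<in> rats01" "enumerate A (n - 1) = rat_key x" unfolding A_def by (rule imageE)
    have "card {y \<in> rats01. rat_before y x} = n - 1"
      using rank[OF x(1)] card_less_enumerate[OF A, of "n - 1"] unfolding x(2) by simp
    then show "\<exists>x. x \<in> rats01 \<and> card {y \<in> rats01. rat_before y x} = n - 1" using x(1) by blast
  next
    fix x y assume x: "x \<in> rats01 \<and> card {z \<in> rats01. rat_before z x} = n - 1"
      and y: "y \<in> rats01 \<and> card {z \<in> rats01. rat_before z y} = n - 1"
    obtain i where i: "enumerate A i = rat_key x" using enumerate_Ex[of A "rat_key x"] A x by (auto simp: A_def)
    obtain j where j: "enumerate A j = rat_key y" using enumerate_Ex[of A "rat_key y"] A y by (auto simp: A_def)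
    have "i = n - 1" using card_less_enumerate[OF A, of i] rank[of x] x unfolding i by simp
    moreover have "j = n - 1" using card_less_enumerate[OF A, of j] rank[of y] y unfolding j by simp
    ultimately have "i = j" by simp
    then have "rat_key x = rat_key y" using i j by metis
    then show "x = y" using inj_onD[OF inj_on_rat_key] x y by blast
  qed
  from theI'[OF this] show "rseq n \<in> rats01" "card {y \<in> rats01. rat_before y (rseq n)} = n - 1"
    unfolding rseq_def by blast+
qed

text \<open>Index 0 is left out since n - 1 truncates and \<open>rseq 0\<close> equals
  \<open>rseq 1\<close>.\<close>

lemma inj_on_rseq: "inj_on rseq {1..}"
proof (rule inj_onI)
  fix m n :: nat assume "m \<in> {1..}" "n \<in> {1..}" "rseq m = rseq n"
  then show "m = n" using rseq_props(2)[of m] rseq_props(2)[of n] by simp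
qed

section \<open>Counting reduced fractions\<close>

lemma sum_inverse_squares_le: "m \<ge> 2 \<Longrightarrow> (\<Sum>d=2..m. 1 / (real d)\<^sup>2) \<le> 3/4 - 1 / m"
proof (induction m rule: nat_induct_at_least)
  case (Suc m)
  have "1 / (real (Suc m))\<^sup>2 \<le> 1 / real m - 1 / real (Suc m)"
    using Suc.hyps by (simp add: divide_simps power2_eq_square)
  then show ?case using Suc by simp
qed simp

text \<open>A union bound in place of Moebius inversion: a pair in the square is coprime, or
  divisible by some d \<ge> 2, and these d account for at most 3/4 of the square. The remaining
  quarter is covered by the reduced fractions, their mirror images and (1, 1); m \<ge> 3 absorbs the
  last pair.\<close>

lemma card_coprime_pairs:
  assumes m: "m \<ge> 3"
  shows "(real m)\<^sup>2 / 16 \<le> card {(p, q). 0 < p \<and> p < q \<and> q \<le> m \<and> coprime p q}"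
proof -
  define L where "L = {(p, q). 0 < p \<and> p < q \<and> q \<le> m \<and> coprime p q}"
  define D where "D d = (\<lambda>(a, b). (d * a, d * b)) ` ({1..m div d} \<times> {1..m div d})" for d
  have finL: "finite L" by (rule finite_subset[of _ "{..m} \<times> {..m}"]) (auto simp: L_def)
  have cover: "{1..m} \<times> {1..m} \<subseteq> (L \<union> prod.swap ` L \<union> {(1, 1)}) \<union> (\<Union>d\<in>{2..m}. D d)"
  proof (rule subsetI, rule ccontr)
    fix z assume "z \<in> {1..m} \<times> {1..m}" and z: "z \<notin> (L \<union> prod.swap ` L \<union> {(1, 1)}) \<union> (\<Union>d\<in>{2..m}. D d)"
    then obtain a b where zab: "z = (a, b)" and ab: "a \<in> {1..m}" "b \<in> {1..m}" by auto
    have no: "(a, b) \<notin> (\<Union>d\<in>{2..m}. D d)" "(a, b) \<noteq> (1, 1)" "(a, b) \<notin> prod.swap ` L" "(a, b) \<notin> L"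
      using z unfolding zab by simp_all
    define d where "d = gcd a b"
    have d: "d dvd a" "d dvd b" "d \<ge> 1" "d \<le> m"
      using ab order.trans[OF gcd_le1_nat[of a b], of m] by (auto simp: d_def Suc_le_eq)
    have "d = 1"
    proof (rule ccontr)
      assume "d \<noteq> 1"
      then have "d \<in> {2..m}" using d by auto
      moreover have "(a, b) \<in> D d"
      proof -
        have "a = d * (a div d)" "b = d * (b div d)" using d by auto
        moreover have "a div d \<in> {1..m div d}" "b div d \<in> {1..m div d}"
          using d ab by (auto simp: div_le_mono Suc_le_eq div_greater_zero_iff dvd_imp_le)
        ultimately show ?thesis unfolding D_def
          by (intro image_eqI[of _ _ "(a div d, b div d)"]) (auto simp del: dvd_mult_div_cancel)
      qed
      ultimately show False using no(1) by blast
    qed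
    then have cop: "coprime a b" by (simp add: d_def coprime_iff_gcd_eq_1)
    have "(a, b) \<in> L"
    proof (cases a b rule: linorder_cases)
      case less
      then show ?thesis using ab cop by (auto simp: L_def)
    next
      case equal
      then show ?thesis using no(2) cop by simp
    next
      case greater
      then have "(b, a) \<in> L" using ab cop by (auto simp: L_def coprime_commute)
      then have "(a, b) \<in> prod.swap ` L" by (intro image_eqI[of _ _ "(b, a)"]) auto
      then show ?thesis using no(3) by blast
    qed
    then show False using no(4) by blast
  qed
  have cD: "real (card (D d)) \<le> (real m)\<^sup>2 * (1 / (real d)\<^sup>2)" for d
  proof -
    have "card (D d) \<le> card ({1..m div d} \<times> {1..m div d})" unfolding D_def by (rule card_image_le) simp
    also have "\<dots> = (m div d)\<^sup>2" by (simp add: card_cartesian_product power2_eq_square)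
    finally have "real (card (D d)) \<le> (real (m div d))\<^sup>2" by (metis of_nat_le_iff of_nat_power)
    also have "\<dots> \<le> (real m / real d)\<^sup>2" by (intro power_mono of_nat_div_le_of_nat) auto
    finally show ?thesis by (simp add: power_divide)
  qed
  have "real (m * m) = real (card ({1..m} \<times> {1..m}))" by (simp add: card_cartesian_product)
  also have "\<dots> \<le> real (card ((L \<union> prod.swap ` L \<union> {(1, 1)}) \<union> (\<Union>d\<in>{2..m}. D d)))"
    using finL by (intro of_nat_mono card_mono cover) (auto simp: D_def)
  also have "\<dots> \<le> real (card L + card L + 1 + (\<Sum>d=2..m. card (D d)))"
  proof -
    have "card (L \<union> prod.swap ` L) \<le> card L + card L"
      using card_image_le[OF finL, of prod.swap] card_Un_le[of L "prod.swap ` L"] by linarith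
    moreover have "card (L \<union> prod.swap ` L \<union> {(1, 1)}) \<le> card (L \<union> prod.swap ` L) + 1"
      using card_Un_le[of "L \<union> prod.swap ` L" "{(1, 1)}"] by simp
    moreover have "card (\<Union>d\<in>{2..m}. D d) \<le> (\<Sum>d=2..m. card (D d))" by (rule card_UN_le) simp
    moreover note card_Un_le[of "L \<union> prod.swap ` L \<union> {(1, 1)}" "\<Union>d\<in>{2..m}. D d"]
    ultimately show ?thesis by linarith
  qed
  also have "\<dots> = 2 * real (card L) + 1 + (\<Sum>d=2..m. real (card (D d)))" by simp
  also have "(\<Sum>d=2..m. real (card (D d))) \<le> (\<Sum>d=2..m. (real m)\<^sup>2 * (1 / (real d)\<^sup>2))" by (intro sum_mono cD)
  also have "\<dots> = (real m)\<^sup>2 * (\<Sum>d=2..m. 1 / (real d)\<^sup>2)" by (rule sum_distrib_left[symmetric])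
  also have "\<dots> \<le> (real m)\<^sup>2 * (3/4)"
  proof (intro mult_left_mono)
    have "1 / real m \<ge> 0" by simp
    then show "(\<Sum>d=2..m. 1 / (real d)\<^sup>2) \<le> 3/4" using sum_inverse_squares_le[of m] m by linarith
  qed auto
  finally have "(real m)\<^sup>2 / 4 \<le> 2 * real (card L) + 1" by (simp add: power2_eq_square)
  moreover have "(3::real)\<^sup>2 \<le> (real m)\<^sup>2" using m by (intro power_mono) auto
  ultimately show ?thesis unfolding L_def[symmetric] by simp
qed

text \<open>A denominator above m would place all reduced fractions of denominator at most m before
  \<open>rseq n\<close>, giving n - 1 \<ge> m^2 / 16 \<ge> n.\<close>

lemma rat_den_rseq_le:
  assumes n: "n \<ge> 1" and m: "m \<ge> 3" "real n \<le> (real m)\<^sup>2 / 16"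
  shows "rat_den (rseq n) \<le> m"
proof (rule ccontr)
  assume gt: "\<not> rat_den (rseq n) \<le> m"
  define L where "L = {(p, q). 0 < p \<and> p < q \<and> q \<le> m \<and> coprime p q}"
  define g :: "nat \<times> nat \<Rightarrow> rat" where "g = (\<lambda>(p, q). of_nat p / of_nat q)"
  have inj: "inj_on g L"
  proof (rule inj_onI, clarify)
    fix p q p' q' assume "(p, q) \<in> L" "(p', q') \<in> L" "g (p, q) = g (p', q')"
    then show "p = p' \<and> q = q'"
      using rats01_fraction(2,3)[of p q] rats01_fraction(2,3)[of p' q'] by (simp add: L_def g_def)
  qed
  have sub: "g ` L \<subseteq> {y \<in> rats01. rat_before y (rseq n)}"
  proof clarify
    fix p q assume "(p, q) \<in> L"
    then have pq: "0 < p" "p < q" "q \<le> m" "coprime p q" by (auto simp: L_def)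
    note f = rats01_fraction[OF pq(1,2,4)]
    have "rat_den (g (p, q)) < rat_den (rseq n)" using f pq gt by (simp add: g_def)
    moreover have "g (p, q) \<in> rats01" using f by (simp add: g_def)
    ultimately show "g (p, q) \<in> rats01 \<and> rat_before (g (p, q)) (rseq n)"
      using rats01_num_den(5)[of "g (p, q)"] rats01_num_den(5)[OF rseq_props(1)[of n]]
      by (simp add: rat_before_def)
  qed
  \<comment> \<open>Finiteness is essential for comparing cardinalities: an infinite set has
    \<open>card\<close> 0.\<close>
  have "finite {y \<in> rats01. rat_before y (rseq n)}"
  proof (rule finite_imageD)
    show "finite (rat_key ` {y \<in> rats01. rat_before y (rseq n)})"
      by (rule finite_subset[of _ "{..rat_key (rseq n)}"]) (auto simp: rat_before_iff rseq_props(1))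
    show "inj_on rat_key {y \<in> rats01. rat_before y (rseq n)}" by (rule inj_on_subset[OF inj_on_rat_key]) auto
  qed
  from card_mono[OF this sub] have "card L \<le> n - 1" using rseq_props(2)[of n] inj by (simp add: card_image)
  then have "real (card L) < real n" using n by linarith
  then show False using card_coprime_pairs[OF m(1)] m(2) unfolding L_def by linarith
qed

lemma bad_indices_bigo:
  assumes s: "s \<noteq> []" "pos_digits s" and eps: "\<epsilon> > 0"
  defines "S \<equiv> {n. n \<ge> 1 \<and> bad_word s \<epsilon> (cf_rat (rseq n))}"
  shows "(\<lambda>x::real. real (card {n \<in> S. real n \<le> x})) \<in> O(\<lambda>x. x / ln x)"
proof -
  obtain C where C: "C > 0" and ev: "eventually (\<lambda>m. real (card {t. pos_digits t \<and> cf_den t \<le> m \<and> bad_word s \<epsilon> t})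
     \<le> C * ((real m)\<^sup>2 / ln (real m))) sequentially"
    using card_bad_words[OF s eps] by blast
  \<comment> \<open>The least denominator bound with x \<le> m^2 / 16. As m^2 \<le> 25 x and ln m
    \<ge> (ln x) / 2 for large x, the constant becomes 25 * 2 = 50.\<close>
  define m where "m x = nat \<lceil>4 * sqrt x\<rceil>" for x :: real
  have mlim: "filterlim m at_top at_top"
  proof -
    have "filterlim (\<lambda>x::real. 4 * sqrt x) at_top at_top" by real_asymp
    then have "filterlim (\<lambda>x. real (m x)) at_top at_top"
      by (rule filterlim_at_top_mono) (auto simp: m_def intro!: always_eventually real_nat_ceiling_ge)
    then show ?thesis by (simp add: filterlim_sequentially_iff_filterlim_real)
  qed
  have ev': "eventually (\<lambda>x. real (card {t. pos_digits t \<and> cf_den t \<le> m x \<and> bad_word s \<epsilon> t})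
     \<le> C * ((real (m x))\<^sup>2 / ln (real (m x)))) at_top"
    using eventually_compose_filterlim[OF ev mlim] .
  have "eventually (\<lambda>x. norm (real (card {n \<in> S. real n \<le> x})) \<le> (50 * C) * norm (x / ln x)) at_top"
    using ev' eventually_ge_at_top[of 4]
  proof eventually_elim
    case (elim x)
    have sq: "sqrt x \<ge> 2" using elim by (simp add: real_le_rsqrt)
    have m1: "4 * sqrt x \<le> real (m x)" "real (m x) \<le> 4 * sqrt x + 1" unfolding m_def using sq by linarith+
    have m3: "m x \<ge> 3" using m1 sq by linarith
    have "(4 * sqrt x)\<^sup>2 \<le> (real (m x))\<^sup>2" using m1 elim by (intro power_mono) auto
    then have mx: "x \<le> (real (m x))\<^sup>2 / 16" using elim by (simp add: power_mult_distrib)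
    have "real (m x) \<le> 5 * sqrt x" using m1 sq by linarith
    then have "(real (m x))\<^sup>2 \<le> (5 * sqrt x)\<^sup>2" by (rule power_mono) simp
    then have m25: "(real (m x))\<^sup>2 \<le> 25 * x" using elim by (simp add: power_mult_distrib)
    have "ln (sqrt x) \<le> ln (real (m x))" using m1 sq elim by (intro ln_mono) auto
    then have lnm: "ln x / 2 \<le> ln (real (m x))" using elim by (simp add: ln_sqrt)
    have lnx: "ln x > 0" using elim by simp
    have "card {n \<in> S. real n \<le> x} \<le> card {t. pos_digits t \<and> cf_den t \<le> m x \<and> bad_word s \<epsilon> t}"
    proof (rule card_inj_on_le[where f = "\<lambda>n. cf_rat (rseq n)"])
      show "inj_on (\<lambda>n. cf_rat (rseq n)) {n \<in> S. real n \<le> x}"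
      proof (rule inj_onI)
        fix k l assume k: "k \<in> {n \<in> S. real n \<le> x}" and l: "l \<in> {n \<in> S. real n \<le> x}"
          and "cf_rat (rseq k) = cf_rat (rseq l)"
        then have "rseq k = rseq l" using inj_onD[OF inj_on_cf_rat _ rseq_props(1) rseq_props(1)] by simp
        then show "k = l" using inj_onD[OF inj_on_rseq] k l by (simp add: S_def)
      qed
      show "(\<lambda>n. cf_rat (rseq n)) ` {n \<in> S. real n \<le> x} \<subseteq> {t. pos_digits t \<and> cf_den t \<le> m x \<and> bad_word s \<epsilon> t}"
      proof clarify
        fix n assume n: "n \<in> S" "real n \<le> x"
        have "rat_den (rseq n) \<le> m x" using n m3 mx by (intro rat_den_rseq_le) (auto simp: S_def)
        then show "pos_digits (cf_rat (rseq n)) \<and> cf_den (cf_rat (rseq n)) \<le> m x \<and> bad_word s \<epsilon> (cf_rat (rseq n))"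
          using cf_rat_props[OF rseq_props(1)[of n]] n by (simp add: S_def)
      qed
      show "finite {t. pos_digits t \<and> cf_den t \<le> m x \<and> bad_word s \<epsilon> t}"
        by (rule finite_subset[OF _ finite_words_den[of "m x"]]) auto
    qed
    then have "real (card {n \<in> S. real n \<le> x}) \<le> C * ((real (m x))\<^sup>2 / ln (real (m x)))" using elim by linarith
    also have "\<dots> \<le> C * (25 * x / (ln x / 2))"
      using C m25 lnm lnx elim by (intro mult_left_mono frac_le) auto
    also have "\<dots> = (50 * C) * norm (x / ln x)" using lnx elim by simp
    finally show ?case by simp
  qed
  then show ?thesis by (rule bigoI)
qed

section \<open>Reals with prescribed digits\<close>

definition prefix_word :: "(nat \<Rightarrow> nat) \<Rightarrow> nat \<Rightarrow> nat list" where
  "prefix_word a n = map (\<lambda>i. a (Suc i)) [0..<n]"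

lemma prefix_word_0 [simp]: "prefix_word a 0 = []"
  by (simp add: prefix_word_def)

lemma prefix_word_Suc: "prefix_word a (Suc n) = a 1 # prefix_word (\<lambda>i. a (Suc i)) n"
  unfolding prefix_word_def by (simp add: upt_conv_Cons map_Suc_upt[symmetric] del: upt_Suc)

lemma prefix_word_Suc': "prefix_word a (Suc n) = prefix_word a n @ [a (Suc n)]"
  by (simp add: prefix_word_def)

lemma prefix_word_pos: "\<forall>i\<ge>1. a i \<ge> 1 \<Longrightarrow> pos_digits (prefix_word a n)"
  by (simp add: prefix_word_def)

text \<open>Closed segments are used instead of cylinders because compactness then provides a common
  point.\<close>

definition in_cylinders :: "(nat \<Rightarrow> nat) \<Rightarrow> real \<Rightarrow> bool" where
  "in_cylinders a x \<longleftrightarrow> (\<forall>n. x \<in> closed_segment (cf_eval (prefix_word a n) 0) (cf_eval (prefix_word a n) 1))"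

lemma cf_eval_in_segment:
  "pos_digits s \<Longrightarrow> y \<in> {0..1} \<Longrightarrow> cf_eval s y \<in> closed_segment (cf_eval s 0) (cf_eval s 1)"
proof (induction s)
  case Nil
  then show ?case by (auto simp: closed_segment_eq_real_ivl)
next
  case (Cons a s)
  then show ?case using cf_eval_unit[of 0 s] cf_eval_unit[of 1 s] by (simp add: recip_closed_segment)
qed

lemma in_cylinders_exists:
  assumes a: "\<forall>i\<ge>1. a i \<ge> 1"
  shows "\<exists>x. in_cylinders a x"
proof -
  define F where "F n = closed_segment (cf_eval (prefix_word a n) 0) (cf_eval (prefix_word a n) 1)" for n
  have step: "F (Suc n) \<subseteq> F n" for n
  proof -
    have "cf_eval (prefix_word a (Suc n)) y \<in> F n" if "y \<in> {0..1}" for y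
    proof -
      have "1 / (real (a (Suc n)) + y) \<in> {0..1}" using a that by (intro recip_shift_unit) auto
      from cf_eval_in_segment[OF prefix_word_pos[OF a] this] show ?thesis
        unfolding prefix_word_Suc' cf_eval_append F_def by simp
    qed
    then show ?thesis unfolding F_def[of "Suc n"] F_def[of n]
      by (intro closed_segment_subset) auto
  qed
  have "\<Inter>(range F) \<noteq> {}"
  proof (rule compact_nest)
    show "F n \<subseteq> F m" if "m \<le> n" for m n
      using that step by (induction n rule: dec_induct) blast+
  qed (simp_all add: F_def)
  then show ?thesis unfolding in_cylinders_def F_def by blast
qed

lemma recip_closed_segment_inverse:
  fixes a :: nat and u v x :: real
  assumes "a \<ge> 1" "u \<ge> 0" "v \<ge> 0" "x \<in> closed_segment (1 / (real a + u)) (1 / (real a + v))"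
  shows "x > 0" "1 / x - real a \<in> closed_segment u v"
proof -
  have p: "real a + u > 0" "real a + v > 0" using assms by auto
  have x: "1 / (real a + u) \<le> x \<and> x \<le> 1 / (real a + v) \<or> 1 / (real a + v) \<le> x \<and> x \<le> 1 / (real a + u)"
    using assms(4) by (simp add: closed_segment_eq_real_ivl split: if_splits)
  moreover have "1 / (real a + u) > 0" "1 / (real a + v) > 0" using p by simp_all
  ultimately show x0: "x > 0" by linarith
  have le: "1 / (real a + p) \<le> x \<longleftrightarrow> 1 / x - a \<le> p" "x \<le> 1 / (real a + p) \<longleftrightarrow> p \<le> 1 / x - a"
    if "real a + p > 0" for p
  proof -
    have "1 / x - a \<le> p \<longleftrightarrow> 1 / x \<le> real a + p" "p \<le> 1 / x - a \<longleftrightarrow> real a + p \<le> 1 / x" by auto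
    then show "1 / (real a + p) \<le> x \<longleftrightarrow> 1 / x - a \<le> p" "x \<le> 1 / (real a + p) \<longleftrightarrow> p \<le> 1 / x - a"
      using x0 that by (simp_all add: pos_divide_le_eq pos_le_divide_eq mult.commute)
  qed
  show "1 / x - real a \<in> closed_segment u v"
    using x le[OF p(1)] le[OF p(2)] by (auto simp: closed_segment_eq_real_ivl)
qed

lemma in_cylinders_shift:
  assumes a: "\<forall>i\<ge>1. a i \<ge> 1" and x: "in_cylinders a x"
  shows "x > 0" "in_cylinders (\<lambda>i. a (Suc i)) (1 / x - real (a 1))"
proof -
  let ?b = "\<lambda>i. a (Suc i)"
  have b: "\<forall>i\<ge>1. ?b i \<ge> 1" using a by auto
  have u: "cf_eval (prefix_word ?b n) 0 \<ge> 0" "cf_eval (prefix_word ?b n) 1 \<ge> 0" for n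
    using cf_eval_unit[of 0, OF _ prefix_word_pos[OF b, of n]] cf_eval_unit[of 1, OF _ prefix_word_pos[OF b, of n]] by auto
  have "x \<in> closed_segment (1 / (real (a 1) + cf_eval (prefix_word ?b n) 0)) (1 / (real (a 1) + cf_eval (prefix_word ?b n) 1))" for n
    using x[unfolded in_cylinders_def, rule_format, of "Suc n"] by (simp only: prefix_word_Suc cf_eval_simps)
  note * = recip_closed_segment_inverse[OF _ u this]
  show "x > 0" using *(1) a by simp
  show "in_cylinders ?b (1 / x - real (a 1))" unfolding in_cylinders_def using *(2) a by simp
qed

text \<open>Closed segments alone do not exclude end points. Positivity of the next two remainders y
  and z does: z > 0 gives 1 / y > a 2 \<ge> 1, so y lies strictly inside the unit interval and
  \<open>gauss_map\<close> recovers it.\<close>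

lemma in_cylinders_gauss_map:
  assumes a: "\<forall>i\<ge>1. a i \<ge> 1" and x: "in_cylinders a x"
  shows "x \<in> {0<..<1}" "nat \<lfloor>1 / x\<rfloor> = a 1" "in_cylinders (\<lambda>i. a (Suc i)) (gauss_map x)"
proof -
  have b: "\<forall>i\<ge>1. a (Suc i) \<ge> 1" and c: "\<forall>i\<ge>1. a (Suc (Suc i)) \<ge> 1" using a by auto
  define y where "y = 1 / x - real (a 1)"
  define z where "z = 1 / y - real (a (Suc 1))"
  note x1 = in_cylinders_shift[OF a x, folded y_def]
  note y1 = in_cylinders_shift[OF b x1(2), folded z_def]
  note z1 = in_cylinders_shift[OF c y1(2)]
  have "1 / y > 1"
  proof -
    have "real (a (Suc 1)) \<ge> 1" using a by simp
    then show ?thesis using z1(1) unfolding z_def by linarith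
  qed
  then have y: "0 < y" "y < 1" using y1(1) by (simp_all add: less_divide_eq)
  have xy: "1 / (real (a 1) + y) = x" unfolding y_def by simp
  note g = gauss_map_recip[of "a 1" y, OF _ y, unfolded xy]
  show "x \<in> {0<..<1}" "nat \<lfloor>1 / x\<rfloor> = a 1" using g a by simp_all
  show "in_cylinders (\<lambda>i. a (Suc i)) (gauss_map x)" using g(2) a x1(2) by simp
qed

lemma in_cylinders_digit:
  assumes "\<forall>i\<ge>1. a i \<ge> 1" "in_cylinders a x"
  shows "cf_digit x (Suc i) = a (Suc i)"
  using assms
proof (induction i arbitrary: a x)
  case 0
  then show ?case using in_cylinders_gauss_map(2) by (simp add: cf_digit_def)
next
  case (Suc i)
  have "cf_digit x (Suc (Suc i)) = cf_digit (gauss_map x) (Suc i)" by (rule cf_digit_Suc) simp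
  also have "\<dots> = a (Suc (Suc i))"
    using Suc.IH[of "\<lambda>i. a (Suc i)" "gauss_map x"] in_cylinders_gauss_map(3)[OF Suc.prems] Suc.prems by simp
  finally show ?case .
qed

text \<open>The segment of the first n digits has length 1 / (q (q + q')), at most 1 / 2^n.\<close>

lemma in_cylinders_unique:
  assumes a: "\<forall>i\<ge>1. a i \<ge> 1" and x: "in_cylinders a x" "in_cylinders a y"
  shows "x = y"
proof -
  have "\<bar>x - y\<bar> \<le> (1/2) ^ n" for n
  proof -
    let ?w = "prefix_word a n"
    have w: "pos_digits ?w" using a by (rule prefix_word_pos)
    have "\<bar>x - y\<bar> \<le> \<bar>cf_eval ?w 1 - cf_eval ?w 0\<bar>"
      using x[unfolded in_cylinders_def] by (auto simp: closed_segment_eq_real_ivl split: if_splits dest!: spec[of _ n])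
    also have "\<dots> = word_prob ?w 0" by (rule cf_eval_diff[OF w])
    also have "\<dots> = 1 / real (cf_den ?w * (cf_den ?w + cf_den' ?w))" by (simp add: word_prob_0[OF w])
    also have "\<dots> \<le> 1 / real (2 ^ length ?w)"
    proof (rule frac_le)
      show "real (2 ^ length ?w) \<le> real (cf_den ?w * (cf_den ?w + cf_den' ?w))"
        using cf_den_props[OF w] by (simp only: of_nat_le_iff)
    qed auto
    finally show ?thesis by (simp add: prefix_word_def power_divide)
  qed
  moreover have "(\<lambda>n. (1/2 :: real) ^ n) \<longlonglongrightarrow> 0" by (rule LIMSEQ_power_zero) simp
  ultimately have "\<bar>x - y\<bar> \<le> 0" by (intro LIMSEQ_le[OF tendsto_const]) auto
  then show ?thesis by simp
qed

text \<open>Justifies the definite description in \<open>cf_real\<close>. Uniqueness holds because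
  every number with these digits lies in all the cylinders.\<close>

lemma cf_real_props:
  assumes a: "\<forall>i\<ge>1. a i \<ge> 1"
  shows "0 \<le> cf_real a" "cf_real a < 1" "i \<ge> 1 \<Longrightarrow> cf_digit (cf_real a) i = a i"
proof -
  have "\<exists>!x. 0 \<le> x \<and> x < 1 \<and> (\<forall>i\<ge>1. cf_digit x i = a i)"
  proof (rule ex_ex1I)
    obtain x where x: "in_cylinders a x" using in_cylinders_exists[OF a] by blast
    have "cf_digit x i = a i" if "i \<ge> 1" for i using in_cylinders_digit[OF a x, of "i - 1"] that by simp
    then show "\<exists>x. 0 \<le> x \<and> x < 1 \<and> (\<forall>i\<ge>1. cf_digit x i = a i)"
      using in_cylinders_gauss_map(1)[OF a x] by (intro exI[of _ x]) auto
  next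
    have *: "in_cylinders a x" if "0 \<le> x \<and> x < 1 \<and> (\<forall>i\<ge>1. cf_digit x i = a i)" for x
      unfolding in_cylinders_def
    proof
      fix n
      have "x \<in> cylinder (prefix_word a n)" using that by (simp add: cylinder_def prefix_word_def)
      then show "x \<in> closed_segment (cf_eval (prefix_word a n) 0) (cf_eval (prefix_word a n) 1)"
        by (rule cylinder_subset_segment[OF prefix_word_pos[OF a]])
    qed
    fix x y assume "0 \<le> x \<and> x < 1 \<and> (\<forall>i\<ge>1. cf_digit x i = a i)" "0 \<le> y \<and> y < 1 \<and> (\<forall>i\<ge>1. cf_digit y i = a i)"
    then show "x = y" using in_cylinders_unique[OF a] * by simp
  qed
  from theI'[OF this]
  show "0 \<le> cf_real a" "cf_real a < 1" "i \<ge> 1 \<Longrightarrow> cf_digit (cf_real a) i = a i"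
    unfolding cf_real_def by auto
qed

section \<open>Concatenations\<close>

lemma cum_len_0 [simp]: "cum_len g 0 = 0"
  by (simp add: cum_len_def)

lemma cum_len_Suc [simp]: "cum_len g (Suc n) = cum_len g n + length (g (Suc n))"
  by (simp add: cum_len_def)

lemma cum_len_mono: "m \<le> n \<Longrightarrow> cum_len g m \<le> cum_len g n"
  by (induction n rule: dec_induct) auto

lemma concat_digits_block:
  assumes "k < length (g (Suc n))"
  shows "concat_digits g (cum_len g n + k + 1) = g (Suc n) ! k"
proof -
  have "(LEAST m. cum_len g n + k + 1 \<le> cum_len g m) = Suc n"
  proof (rule Least_equality)
    show "cum_len g n + k + 1 \<le> cum_len g (Suc n)" using assms by simp
    fix m assume m: "cum_len g n + k + 1 \<le> cum_len g m"
    show "Suc n \<le> m"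
    proof (rule ccontr)
      assume "\<not> Suc n \<le> m"
      then have "cum_len g m \<le> cum_len g n" by (intro cum_len_mono) simp
      then show False using m by simp
    qed
  qed
  then show ?thesis by (simp add: concat_digits_def)
qed

lemma cum_len_block_exists:
  assumes "\<And>n. length (g n) \<ge> 1"
  shows "\<exists>n. cum_len g n \<le> N \<and> N < cum_len g (Suc n)"
proof -
  have ge: "n \<le> cum_len g n" for n
  proof (induction n)
    case (Suc n)
    then show ?case using assms[of "Suc n"] by simp
  qed simp
  define n where "n = (LEAST n. N < cum_len g (Suc n))"
  have "N < cum_len g (Suc N)" using ge[of "Suc N"] by linarith
  then have lt: "N < cum_len g (Suc n)" unfolding n_def by (rule LeastI)
  have "cum_len g n \<le> N"
  proof (cases n)
    case (Suc k)
    then have "\<not> N < cum_len g (Suc k)" unfolding n_def by (intro not_less_Least) simp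
    then show ?thesis using Suc by simp
  qed simp
  with lt show ?thesis by blast
qed

lemma concat_digits_pos:
  assumes g: "\<And>n. length (g n) \<ge> 1" "\<And>n. pos_digits (g n)" and i: "i \<ge> 1"
  shows "concat_digits g i \<ge> 1"
proof -
  obtain n where n: "cum_len g n \<le> i - 1" "i - 1 < cum_len g (Suc n)"
    using cum_len_block_exists[of g "i - 1"] g(1) by blast
  define k where "k = i - 1 - cum_len g n"
  have k: "k < length (g (Suc n))" "i = cum_len g n + k + 1" using n i by (auto simp: k_def)
  show ?thesis using concat_digits_block[of k g n, OF k(1)] g(2)[of "Suc n"] k nth_mem by metis
qed

definition match :: "nat list \<Rightarrow> (nat \<Rightarrow> nat) \<Rightarrow> nat \<Rightarrow> bool" where
  "match s D i \<longleftrightarrow> (\<forall>j<length s. D (i + j) = s ! j)"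

lemma match_concat_digits:
  assumes "k + length s \<le> length (g (Suc n))"
  shows "match s (concat_digits g) (cum_len g n + k + 1) \<longleftrightarrow> hit s k (g (Suc n))"
proof -
  have "match s (concat_digits g) (cum_len g n + k + 1) \<longleftrightarrow> (\<forall>j<length s. g (Suc n) ! (k + j) = s ! j)"
  proof -
    have "concat_digits g (cum_len g n + k + 1 + j) = g (Suc n) ! (k + j)" if "j < length s" for j
      using concat_digits_block[of "k + j" g n] that assms by (simp add: add_ac)
    then show ?thesis unfolding match_def by simp
  qed
  also have "\<dots> \<longleftrightarrow> take (length s) (drop k (g (Suc n))) = s"
    using assms by (auto simp: list_eq_iff_nth_eq)
  finally show ?thesis unfolding hit_def .
qed

text \<open>Inside a block, occurrences in the concatenation and in the block itself differ only
  where they cross the right border, which concerns the last \<open>length s\<close> start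
  positions.\<close>

lemma block_matches:
  fixes g :: "nat \<Rightarrow> nat list"
  assumes "s \<noteq> []"
  defines "L \<equiv> \<lambda>n. length (g (Suc n))"
  shows "hits s (L n) (g (Suc n)) \<le> (\<Sum>k<L n. of_bool (match s (concat_digits g) (cum_len g n + k + 1)))"
    "(\<Sum>k<L n. of_bool (match s (concat_digits g) (cum_len g n + k + 1))) \<le> hits s (L n) (g (Suc n)) + length s"
proof -
  let ?m = "\<lambda>k. match s (concat_digits g) (cum_len g n + k + 1)"
  have "hit s k (g (Suc n)) \<Longrightarrow> ?m k" for k
    using hit_length[of s k "g (Suc n)"] assms(1) match_concat_digits[of k s g n] by blast
  then show "hits s (L n) (g (Suc n)) \<le> (\<Sum>k<L n. of_bool (?m k))"
    unfolding hits_def by (intro sum_mono) auto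
  have "(\<Sum>k<L n. of_bool (?m k)) \<le> (\<Sum>k<(L n - length s) + length s. of_bool (?m k) :: real)"
    by (rule sum_mono2) auto
  also have "\<dots> \<le> (\<Sum>k<L n - length s. of_bool (?m k)) + real (length s)"
  proof -
    have "(\<Sum>k<a + b. of_bool (P k)) \<le> (\<Sum>k<a. of_bool (P k)) + real b" for a b and P :: "nat \<Rightarrow> bool"
      by (induction b) (auto simp: of_bool_def)
    then show ?thesis .
  qed
  also have "(\<Sum>k<L n - length s. of_bool (?m k)) = hits s (L n - length s) (g (Suc n))"
    unfolding hits_def
  proof (intro sum.cong refl)
    fix k assume "k \<in> {..<L n - length s}"
    then have "k + length s \<le> length (g (Suc n))" by (auto simp: L_def)
    from match_concat_digits[of k s g n, OF this] show "of_bool (?m k) = (of_bool (hit s k (g (Suc n))) :: real)" by simp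
  qed
  also have "\<dots> \<le> hits s (L n) (g (Suc n))" by (rule hits_mono) simp
  finally show "(\<Sum>k<L n. of_bool (?m k)) \<le> hits s (L n) (g (Suc n)) + length s" by simp
qed

lemma concat_matches:
  fixes g :: "nat \<Rightarrow> nat list"
  assumes "s \<noteq> []"
  defines "F \<equiv> \<lambda>N. (\<Sum>i<N. of_bool (match s (concat_digits g) (i + 1)) :: real)"
  shows "(\<Sum>k=1..n. hits s (length (g k)) (g k)) \<le> F (cum_len g n)"
    "F (cum_len g n) \<le> (\<Sum>k=1..n. hits s (length (g k)) (g k)) + n * length s"
proof -
  have step: "F (a + b) = F a + (\<Sum>k<b. of_bool (match s (concat_digits g) (a + k + 1)))" for a b
  proof (induction b)
    case (Suc b)
    have "F (a + Suc b) = F (a + b) + of_bool (match s (concat_digits g) (a + b + 1))"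
      unfolding F_def add_Suc_right sum.lessThan_Suc ..
    then show ?case unfolding Suc sum.lessThan_Suc by simp
  qed simp
  have "(\<Sum>k=1..n. hits s (length (g k)) (g k)) \<le> F (cum_len g n)
    \<and> F (cum_len g n) \<le> (\<Sum>k=1..n. hits s (length (g k)) (g k)) + n * length s"
  proof (induction n)
    case (Suc n)
    then show ?case using block_matches[OF assms(1), of g n]
      unfolding cum_len_Suc step by (simp add: algebra_simps)
  qed (simp add: F_def)
  then show "(\<Sum>k=1..n. hits s (length (g k)) (g k)) \<le> F (cum_len g n)"
    "F (cum_len g n) \<le> (\<Sum>k=1..n. hits s (length (g k)) (g k)) + n * length s" by auto
qed

lemma hits_le: "hits s k l \<le> k" "0 \<le> hits s k l"
  using hits_add_le[of s 0 k l] by (auto simp: hits_def intro: sum_nonneg)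

text \<open>A good block errs by at most \<epsilon> times its length, a bad one by at most its whole
  length.\<close>

lemma block_error_sum:
  fixes s
  defines "c \<equiv> gauss_mean (word_prob s)"
  assumes s: "pos_digits s" and eps: "\<epsilon> \<ge> 0" and X: "\<And>k. k \<in> {1..n} \<Longrightarrow> length (g k) \<le> X"
  shows "\<bar>(\<Sum>k=1..n. hits s (length (g k)) (g k)) - c * real (cum_len g n)\<bar>
    \<le> \<epsilon> * real (cum_len g n) + real (card {k \<in> {1..n}. bad_word s \<epsilon> (g k)}) * real X"
proof -
  have c: "0 \<le> c" "c \<le> 1" unfolding c_def by (rule gauss_mean_word_prob_bounds[OF s])+
  have "\<bar>(\<Sum>k=1..n. hits s (length (g k)) (g k)) - c * real (cum_len g n)\<bar>
    = \<bar>\<Sum>k=1..n. hits s (length (g k)) (g k) - c * real (length (g k))\<bar>"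
    by (simp add: cum_len_def sum_subtractf sum_distrib_left)
  also have "\<dots> \<le> (\<Sum>k=1..n. \<epsilon> * real (length (g k)) + (if bad_word s \<epsilon> (g k) then real X else 0))"
  proof (intro order.trans[OF sum_abs] sum_mono)
    fix k assume k: "k \<in> {1..n}"
    have "c * real (length (g k)) \<le> 1 * real (length (g k))" using c by (intro mult_right_mono) auto
    moreover have "0 \<le> c * real (length (g k))" using c by simp
    ultimately have "\<bar>hits s (length (g k)) (g k) - c * real (length (g k))\<bar> \<le> length (g k)"
      using hits_le[of s "length (g k)" "g k"] by linarith
    moreover have "real (length (g k)) \<le> X" using X[OF k] by simp
    moreover have "0 \<le> \<epsilon> * real (length (g k))" using eps by simp
    ultimately show "\<bar>hits s (length (g k)) (g k) - c * real (length (g k))\<bar> \<le> \<epsilon> * real (length (g k)) + (if bad_word s \<epsilon> (g k) then real X else 0)"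
      unfolding bad_word_def c_def[symmetric] by simp
  qed
  also have "\<dots> = \<epsilon> * real (cum_len g n) + real (card {k \<in> {1..n}. bad_word s \<epsilon> (g k)}) * real X"
    by (simp add: sum.distrib cum_len_def sum_distrib_left sum.If_cases Int_def of_nat_sum)
  finally show ?thesis .
qed

lemma occ_count_concat:
  assumes "\<And>i. i \<ge> 1 \<Longrightarrow> cf_digit x i = D i"
  shows "real (occ_count s N x) = (\<Sum>i<N. of_bool (match s D (i + 1)))"
proof -
  have "match s D i \<longleftrightarrow> (\<forall>j<length s. cf_digit x (i + j) = s ! j)" if "i \<ge> 1" for i
    using assms that by (simp add: match_def)
  then have "{i \<in> {1..N}. \<forall>j<length s. cf_digit x (i + j) = s ! j} = {i \<in> {1..N}. match s D i}" by auto
  also have "\<dots> = Suc ` {i. i < N \<and> match s D (i + 1)}"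
  proof (intro equalityI subsetI)
    fix i assume "i \<in> {i \<in> {1..N}. match s D i}"
    then show "i \<in> Suc ` {i. i < N \<and> match s D (i + 1)}" by (intro image_eqI[of _ _ "i - 1"]) auto
  qed auto
  finally have "occ_count s N x = card {i. i < N \<and> match s D (i + 1)}"
    unfolding occ_count_def by (simp add: card_image)
  also have "{i. i < N \<and> match s D (i + 1)} = {..<N} \<inter> {i. match s D (i + 1)}" by auto
  finally show ?thesis by simp
qed

section \<open>Normality of the concatenation\<close>

theorem theorem1p1:
  fixes f :: "nat \<Rightarrow> nat"
  assumes f_pos: "\<forall>n\<ge>1. f n \<ge> 1"
    and h1: "(\<lambda>N. real N) \<in> o(\<lambda>N. real (\<Sum>n=1..N. cf_len (rseq (f n))))"
    and h2: "(\<lambda>N. real N * real (Max {cf_len (rseq (f n)) | n. 1 \<le> n \<and> n \<le> N}))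
               \<in> O(\<lambda>N. real (\<Sum>n=1..N. cf_len (rseq (f n))))"
    and h3: "\<forall>S :: nat set.
               (\<lambda>x::real. real (card {n \<in> S. real n \<le> x})) \<in> O(\<lambda>x. x / ln x)
               \<longrightarrow> has_density {n. 1 \<le> n \<and> f n \<in> S} 0"
  shows "cf_normal (x_f f)"
proof -
  define g where "g n = cf_rat (rseq (f n))" for n
  define \<Lambda> where "\<Lambda> n = cum_len g n" for n
  define X where "X n = Max {cf_len (rseq (f k)) | k. 1 \<le> k \<and> k \<le> n}" for n
  have \<Lambda>: "(\<Sum>k=1..n. cf_len (rseq (f k))) = \<Lambda> n" for n
    by (simp add: \<Lambda>_def cum_len_def g_def cf_len_def)
  have g: "length (g n) \<ge> 1" "pos_digits (g n)" for n
    using cf_rat_props[OF rseq_props(1)[of "f n"]] by (auto simp: g_def)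
  have X: "length (g k) \<le> X n" if "k \<in> {1..n}" for k n
  proof -
    have "{cf_len (rseq (f k)) | k. 1 \<le> k \<and> k \<le> n} = (\<lambda>k. cf_len (rseq (f k))) ` {1..n}" by auto
    moreover have "cf_len (rseq (f k)) \<le> Max ((\<lambda>k. cf_len (rseq (f k))) ` {1..n})"
      using that by (intro Max_ge imageI) simp_all
    ultimately show ?thesis unfolding X_def by (simp add: g_def cf_len_def)
  qed
  have xf: "x_f f = cf_real (concat_digits g)" by (simp add: x_f_def g_def[abs_def])
  have pos: "\<forall>i\<ge>1. concat_digits g i \<ge> 1" using concat_digits_pos[of g, OF g] by simp
  note digits = cf_real_props[OF pos, folded xf]
  have "(\<lambda>N. real (occ_count s N (x_f f)) / real N) \<longlonglongrightarrow> gauss_measure (cylinder s)"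
    if "\<forall>d\<in>set s. d > 0" for s
  proof -
    have s: "pos_digits s" using that by (auto simp: Suc_le_eq)
    define c where "c = gauss_mean (word_prob s)"
    have c: "0 \<le> c" "c \<le> 1" unfolding c_def by (rule gauss_mean_word_prob_bounds[OF s])+
    define F where "F N = (\<Sum>i<N. of_bool (match s (concat_digits g) (i + 1)) :: real)" for N
    have occ: "real (occ_count s N (x_f f)) = F N" for N
      unfolding F_def using digits(3) by (rule occ_count_concat)
    have "(\<lambda>N. F N / real N) \<longlonglongrightarrow> c"
    proof (cases "s = []")
      \<comment> \<open>The empty word occurs everywhere; it is separated because the count of bad
        words concerns nonempty ones.\<close>
      case True
      have "c = 1" unfolding c_def gauss_mean_word_prob[OF s] by (simp add: True)
      moreover have "F N = real N" for N by (simp add: F_def match_def True)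
      moreover have "eventually (\<lambda>N. real N / real N = 1) sequentially"
        using eventually_gt_at_top[of 0] by eventually_elim simp
      ultimately show ?thesis by (simp add: tendsto_eventually)
    next
      case False
      obtain K where K: "K > 0" and evK: "eventually (\<lambda>n. real n * real (X n) \<le> K * real (\<Lambda> n)) sequentially"
      proof -
        obtain K where "K > 0" "eventually (\<lambda>n. norm (real n * real (X n)) \<le> K * norm (real (\<Lambda> n))) sequentially"
          using h2 unfolding \<Lambda> X_def[symmetric] by (rule landau_o.bigE)
        then show thesis by (intro that[of K]) auto
      qed
      \<comment> \<open>Relative to the \<Lambda> n digits of the complete blocks, good blocks, bad
        blocks and block boundaries each contribute at most \<epsilon>, and the incomplete block 2
        \<epsilon>; 7 leaves room.\<close>
      have main: "eventually (\<lambda>N. \<bar>F N - c * N\<bar> \<le> 7 * \<epsilon> * N) sequentially" if eps: "0 < \<epsilon>" "\<epsilon> \<le> 1/2" for \<epsilon> :: real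
      proof -
        define S where "S = {n. n \<ge> 1 \<and> bad_word s \<epsilon> (cf_rat (rseq n))}"
        have "has_density {n. 1 \<le> n \<and> f n \<in> S} 0"
          by (rule h3[rule_format]) (unfold S_def, rule bad_indices_bigo[OF False s eps(1)])
        then have dens: "(\<lambda>N. real (card {n \<in> {n. 1 \<le> n \<and> f n \<in> S}. 1 \<le> n \<and> n \<le> N}) / real N) \<longlonglongrightarrow> 0"
          by (simp add: has_density_def)
        have bad_eq: "{n \<in> {n. 1 \<le> n \<and> f n \<in> S}. 1 \<le> n \<and> n \<le> N} = {k \<in> {1..N}. bad_word s \<epsilon> (g k)}" for N
          using f_pos by (auto simp: S_def g_def)
        \<comment> \<open>Density 0 counts blocks, not digits. The second growth hypothesis bridges
          this: fewer than (\<epsilon> / K) n bad blocks of length at most X n hold at most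
          (\<epsilon> / K) n X n \<le> \<epsilon> \<Lambda> n digits.\<close>
        have ev_bad: "eventually (\<lambda>n. real (card {k \<in> {1..n}. bad_word s \<epsilon> (g k)}) * X n \<le> \<epsilon> * \<Lambda> n) sequentially"
        proof -
          have "eventually (\<lambda>n. real (card {k \<in> {1..n}. bad_word s \<epsilon> (g k)}) / real n < \<epsilon> / K) sequentially"
            using order_tendstoD(2)[OF dens, of "\<epsilon> / K"] eps K unfolding bad_eq by simp
          then show ?thesis using evK eventually_gt_at_top[of 0]
          proof eventually_elim
            case (elim n)
            have "real (card {k \<in> {1..n}. bad_word s \<epsilon> (g k)}) \<le> \<epsilon> / K * n"
              using elim by (simp add: pos_divide_less_eq)
            then have "real (card {k \<in> {1..n}. bad_word s \<epsilon> (g k)}) * X n \<le> \<epsilon> / K * n * X n"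
              by (intro mult_right_mono) auto
            also have "\<dots> = \<epsilon> / K * (real n * real (X n))" by simp
            also have "\<dots> \<le> \<epsilon> / K * (K * \<Lambda> n)" using elim eps K by (intro mult_left_mono) auto
            also have "\<dots> = \<epsilon> * \<Lambda> n" using K by simp
            finally show ?case .
          qed
        qed
        have ev_edge: "eventually (\<lambda>n. real n * length s \<le> \<epsilon> * \<Lambda> n) sequentially"
        proof -
          have p: "\<epsilon> / length s > 0" using eps False by simp
          have "eventually (\<lambda>n. norm (real n) \<le> \<epsilon> / length s * norm (real (\<Lambda> n))) sequentially"
            using landau_o.smallD[OF h1 p] unfolding \<Lambda> .
          then show ?thesis
          proof eventually_elim
            case (elim n)
            have "real n \<le> \<epsilon> * \<Lambda> n / length s" using elim by simp
            then show ?case using False by (simp add: pos_le_divide_eq)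
          qed
        qed
        \<comment> \<open>The growth hypothesis at n + 1 bounds the next block by \<epsilon>
          \<Lambda> (n + 1), which still contains that block; \<epsilon> \<le> 1/2 lets it be
          absorbed, at the price of the factor 2.\<close>
        have ev_next: "eventually (\<lambda>n. real (length (g (Suc n))) \<le> 2 * \<epsilon> * \<Lambda> n) sequentially"
        proof -
          have "eventually (\<lambda>n. real (Suc n) * real (X (Suc n)) \<le> K * real (\<Lambda> (Suc n))) sequentially"
            using evK by (subst eventually_sequentially_Suc)
          moreover have "eventually (\<lambda>n. K / \<epsilon> \<le> real (Suc n)) sequentially" by real_asymp
          ultimately show ?thesis
          proof eventually_elim
            case (elim n)
            let ?l = "real (length (g (Suc n)))"
            have "?l \<le> real (X (Suc n))" using X[of "Suc n" "Suc n"] by simp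
            then have "real (Suc n) * ?l \<le> real (Suc n) * real (X (Suc n))" by (intro mult_left_mono) auto
            moreover have "K / \<epsilon> * ?l \<le> real (Suc n) * ?l" using elim by (intro mult_right_mono) auto
            ultimately have "K / \<epsilon> * ?l \<le> K * real (\<Lambda> (Suc n))" using elim by linarith
            then have "K * ?l \<le> K * (\<epsilon> * real (\<Lambda> (Suc n)))" using eps by (simp add: pos_divide_le_eq mult_ac)
            then have "?l \<le> \<epsilon> * real (\<Lambda> (Suc n))" using K by (simp only: mult_le_cancel_left_pos)
            also have "real (\<Lambda> (Suc n)) = real (\<Lambda> n) + ?l" by (simp add: \<Lambda>_def)
            finally have "?l \<le> \<epsilon> * \<Lambda> n + \<epsilon> * ?l" by (simp add: distrib_left)
            moreover have "\<epsilon> * ?l \<le> 1/2 * ?l" using eps by (intro mult_right_mono) auto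
            ultimately show ?case by linarith
          qed
        qed
        obtain n0 where n0: "\<And>n. n \<ge> n0 \<Longrightarrow> real (card {k \<in> {1..n}. bad_word s \<epsilon> (g k)}) * X n \<le> \<epsilon> * \<Lambda> n
            \<and> real n * length s \<le> \<epsilon> * \<Lambda> n \<and> real (length (g (Suc n))) \<le> 2 * \<epsilon> * \<Lambda> n"
          using eventually_conj[OF ev_bad eventually_conj[OF ev_edge ev_next]]
          unfolding eventually_sequentially by blast
        have "\<bar>F N - c * N\<bar> \<le> 7 * \<epsilon> * N" if N: "N \<ge> \<Lambda> n0" for N
        proof -
          obtain n where n: "\<Lambda> n \<le> N" "N < \<Lambda> (Suc n)"
            using cum_len_block_exists[of g N, OF g(1)] unfolding \<Lambda>_def by blast
          have "n \<ge> n0"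
          proof (rule ccontr)
            assume "\<not> n0 \<le> n"
            then have "\<Lambda> (Suc n) \<le> \<Lambda> n0" unfolding \<Lambda>_def by (intro cum_len_mono) simp
            then show False using n N by linarith
          qed
          note b = n0[OF this]
          define H where "H = (\<Sum>k=1..n. hits s (length (g k)) (g k))"
          define l where "l = real (length (g (Suc n)))"
          have H1: "H \<le> F (\<Lambda> n)" "F (\<Lambda> n) \<le> H + n * length s"
            unfolding H_def F_def \<Lambda>_def by (rule concat_matches[OF False])+
          have H2: "\<bar>H - c * real (\<Lambda> n)\<bar> \<le> \<epsilon> * real (\<Lambda> n) + real (card {k \<in> {1..n}. bad_word s \<epsilon> (g k)}) * real (X n)"
            unfolding H_def \<Lambda>_def c_def using X eps by (intro block_error_sum[OF s]) auto
          have Nl: "real N \<le> \<Lambda> n + l" using n by (simp add: \<Lambda>_def l_def)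
          have FN: "F (\<Lambda> n) \<le> F N" "F N \<le> F (\<Lambda> n) + (real N - \<Lambda> n)"
          proof -
            show "F (\<Lambda> n) \<le> F N" unfolding F_def using n by (intro sum_mono2) auto
            have "F (\<Lambda> n + d) \<le> F (\<Lambda> n) + d" for d
            proof (induction d)
              case (Suc d)
              have "F (\<Lambda> n + Suc d) \<le> F (\<Lambda> n + d) + 1"
                unfolding F_def add_Suc_right sum.lessThan_Suc by simp
              then show ?case using Suc by simp
            qed simp
            from this[of "N - \<Lambda> n"] show "F N \<le> F (\<Lambda> n) + (real N - \<Lambda> n)" using n by (simp add: of_nat_diff)
          qed
          have cN: "c * \<Lambda> n \<le> c * N" "c * N \<le> c * \<Lambda> n + l"
          proof -
            show "c * \<Lambda> n \<le> c * N" using n c by (intro mult_left_mono) auto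
            have "c * N \<le> c * (\<Lambda> n + l)" using Nl c by (intro mult_left_mono) auto
            also have "\<dots> = c * \<Lambda> n + c * l" by (simp add: distrib_left)
            also have "c * l \<le> 1 * l" using c by (intro mult_right_mono) (auto simp: l_def)
            finally show "c * N \<le> c * \<Lambda> n + l" by simp
          qed
          have l: "l \<le> 2 * \<epsilon> * \<Lambda> n" using b by (simp add: l_def)
          have "\<bar>F N - c * N\<bar> \<le> 7 * (\<epsilon> * \<Lambda> n)" using H1 H2 FN cN Nl b l by (simp add: abs_le_iff)
          also have "\<dots> \<le> 7 * (\<epsilon> * N)" using n eps by (intro mult_left_mono) auto
          finally show ?thesis by simp
        qed
        then show ?thesis unfolding eventually_sequentially by blast
      qed
      show ?thesis
      proof (rule tendstoI)
        fix e :: real assume e: "e > 0"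
        define \<epsilon> where "\<epsilon> = min (1/2) (e / 14)"
        have eps: "0 < \<epsilon>" "\<epsilon> \<le> 1/2" "7 * \<epsilon> < e" using e by (auto simp: \<epsilon>_def min_def)
        from main[OF eps(1,2)] eventually_gt_at_top[of 0]
        show "eventually (\<lambda>N. dist (F N / real N) c < e) sequentially"
        proof eventually_elim
          case (elim N)
          have "F N / real N - c = (F N - c * N) / real N" using elim by (simp add: field_simps)
          then have "dist (F N / real N) c = \<bar>F N - c * N\<bar> / real N" by (simp add: dist_real_def)
          also have "\<dots> \<le> 7 * \<epsilon>" using elim by (simp add: pos_divide_le_eq)
          finally show ?case using eps(3) by linarith
        qed
      qed
    qed
    then show ?thesis unfolding occ gauss_measure_cylinder[OF s] c_def .
  qed
  then show ?thesis unfolding cf_normal_def using digits(1,2) by simp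
qed

end
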